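(* Fix parameters $0<w\le 1$ and $0<\delta\le 1$. Let $v\colon \mathbb{R}^2\to[0,1]$ be a function depending only on the horizontal variable, i.e. $v(a,b)=v(a)$. Let $\mathcal{R}_\delta$ be the collection of all rectangles $R$ of width $w$ such that $|V_R|\ge \delta |R|$. Then for every $f\in L^2(\mathbb{R}^2)$, $$\|M_{\mathcal{R}_\delta} f\|_{2}\le C\left(\log \tfrac{1}{\delta}\right)^{3/2}\|f\|_{2},$$ where $C$ is a universal constant (independent of $w$, $\delta$, $v$ and $f$).
   Context: For a collection of rectangles $\mathcal{R}$ in $\mathbb{R}^2$, the maximal operator is $M_{\mathcal{R}} f(x)=\sup_{x\in R\in\mathcal{R}} \frac{1}{|R|}\int_R f$. For a rectangle $R$, $L(R)$ denotes its length (long side), $w(R)$ its width (short side), and $\theta(R)$ is the interval of width $w(R)/L(R)$ centered at the slope of the long side of $R$. Given the slope field $v$, $V_R=\{p\in R: v(p)\in\theta(R)\}$. $|\cdot|$ denotes Lebesgue measure.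
   Formalization: The factor log(1/δ) is replaced by 1+log(1/δ), since the bound as written fails at and near δ=1 (it would force the maximal function to vanish); v is assumed Lebesgue measurable so that |V_R| is defined. *)

theory Defs
  imports "HOL-Analysis.Analysis"
begin

text \<open>A rectangle is encoded as a tuple (c, phi, L, w): centre c, angle phi of the
  long side (unit direction (cos phi, sin phi)), length L (long side) and width w
  (short side), with w \<le> L. The point set is the open rectangle.\<close>

type_synonym rect_data = "(real \<times> real) \<times> real \<times> real \<times> real"

definition rect_set :: "rect_data \<Rightarrow> (real \<times> real) set" where
  "rect_set R = (case R of (c, phi, L, w) \<Rightarrow>
     {p. \<bar>(p - c) \<bullet> (cos phi, sin phi)\<bar> < L / 2 \<and>
         \<bar>(p - c) \<bullet> (- sin phi, cos phi)\<bar> < w / 2})"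

definition rect_length :: "rect_data \<Rightarrow> real" where
  "rect_length R = (case R of (c, phi, L, w) \<Rightarrow> L)"

definition rect_width :: "rect_data \<Rightarrow> real" where
  "rect_width R = (case R of (c, phi, L, w) \<Rightarrow> w)"

text \<open>theta(R): interval of width w(R)/L(R) centred at the slope tan phi of the long
  side; empty if the long side is vertical (infinite slope).\<close>
definition theta :: "rect_data \<Rightarrow> real set" where
  "theta R = (case R of (c, phi, L, w) \<Rightarrow>
     (if cos phi = 0 then {} else {tan phi - w / (2 * L) .. tan phi + w / (2 * L)}))"

text \<open>V_R for a slope field depending only on the horizontal variable: v(a,b) = v a.\<close>
definition V_set :: "(real \<Rightarrow> real) \<Rightarrow> rect_data \<Rightarrow> (real \<times> real) set" where
  "V_set v R = {p \<in> rect_set R. v (fst p) \<in> theta R}"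

definition R_delta :: "(real \<Rightarrow> real) \<Rightarrow> real \<Rightarrow> real \<Rightarrow> rect_data set" where
  "R_delta v w \<delta> = {R. rect_width R = w \<and> w \<le> rect_length R \<and>
      measure lebesgue (V_set v R) \<ge> \<delta> * measure lebesgue (rect_set R)}"

definition maxop :: "rect_data set \<Rightarrow> ((real \<times> real) \<Rightarrow> real) \<Rightarrow> (real \<times> real) \<Rightarrow> ereal" where
  "maxop \<R> f x = (if \<exists>R\<in>\<R>. x \<in> rect_set R then
     (SUP R\<in>{R\<in>\<R>. x \<in> rect_set R}.
        ereal ((1 / measure lebesgue (rect_set R)) * (\<integral>p\<in>rect_set R. f p \<partial>lebesgue)))
   else 0)"

end

theory Submission
  imports Defs
begin

text \<open>Rectangles are compared with tiles: a base interval \<open>I\<close> of a dyadic grid (or of its translate by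
  a third of the coarsest cell) together with a slope interval \<open>\<omega>\<close> such that \<open>|I| |\<omega>| = w\<close>. A tile is live
  if \<open>v \<in> \<omega>\<close> on a proportion \<open>\<eta> \<sim> \<delta>\<close> of \<open>I\<close>. Up to constants the operator is the supremum over live tiles
  \<open>P\<close> of \<open>B\<^sub>P U f\<close>, where \<open>U\<close> averages over vertical windows of radius comparable to \<open>w\<close> and \<open>B\<^sub>P\<close> averages
  over \<open>I\<close> along lines of the slope of \<open>P\<close>.

  Linearise this supremum as \<open>g = \<Sum>\<^sub>P g\<^sub>P\<close> with disjointly supported \<open>g\<^sub>P\<close>, and put \<open>h = \<Sum>\<^sub>P U B\<^sub>P g\<^sub>P\<close>.
  Then \<open>\<integral>g\<^sup>2 = \<integral>f h\<close>, so by Cauchy--Schwarz it suffices to bound \<open>h\<close> by \<open>g\<close> in \<open>L\<^sup>2\<close>. In \<open>\<integral>h\<^sup>2\<close> a pair of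
  tiles contributes the pairing of the \<open>g\<^sub>P\<close> of the shorter tile with a vertical average, in the same
  column, of the dual function \<open>U B\<^sub>P g\<^sub>P\<close> of the longer one. Grouping the tiles into generations leaves,
  in every column and generation, at most \<open>D \<sim> \<delta>\<^sup>-\<^sup>2\<close> groups of comparable tiles; the sum of the vertical
  maximal functions of the groups costs a factor \<open>1 + ln D\<close>, and the interaction of two generations
  decays geometrically in their distance. This yields the power 1 of the logarithm.\<close>

section \<open>Elementary inequalities\<close>

lemma ennreal_le_if_square_le:
  fixes x c :: ennreal
  assumes "x < top" and "x\<^sup>2 \<le> c * x"
  shows "x \<le> c"
proof (cases "x = 0")
  case False
  then show ?thesis
    using assms ennreal_mult_le_mult_iff[of x x c] by (simp add: power2_eq_square mult.commute)
qed simp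

lemma ennreal_le_twice_if_le_add_half:
  fixes x a :: ennreal
  assumes "x < top" and "x \<le> a + x / 2"
  shows "x \<le> 2 * a"
proof (cases a)
  case (real r)
  obtain t where t: "0 \<le> t" "x = ennreal t" using \<open>x < top\<close> by (cases x) auto
  have "ennreal t \<le> ennreal (r + t / 2)"
    using assms(2) t real by (simp add: ennreal_divide_numeral)
  then have "t \<le> r + t / 2" using real t by (subst (asm) ennreal_le_iff) auto
  then have "ennreal t \<le> ennreal (2 * r)" by (intro ennreal_leI) simp
  then show ?thesis using real t by (simp add: ennreal_mult')
qed (simp add: ennreal_mult_top)

lemma ennreal_two_mult_le_weighted_squares:
  fixes a b :: ennreal
  assumes "0 < c"
  shows "2 * (a * b) \<le> ennreal c * a\<^sup>2 + ennreal (1 / c) * b\<^sup>2"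
proof -
  have "ennreal (sqrt c) * ennreal (1 / sqrt c) = 1"
    using assms by (simp flip: ennreal_mult')
  then have "2 * (a * b) = 2 * (ennreal (sqrt c) * a) * (ennreal (1 / sqrt c) * b)"
    by (metis (no_types, opaque_lifting) mult.assoc mult.left_commute mult.right_neutral)
  also have "\<dots> \<le> (ennreal (sqrt c) * a)\<^sup>2 + (ennreal (1 / sqrt c) * b)\<^sup>2"
    by (rule sum_of_squares_ge_ennreal)
  also have "\<dots> = ennreal c * a\<^sup>2 + ennreal (1 / c) * b\<^sup>2"
    using assms by (simp add: power_mult_distrib ennreal_power power_divide)
  finally show ?thesis .
qed

lemma ennreal_power2_add_le: "(x + y)\<^sup>2 \<le> 2 * x\<^sup>2 + 2 * y\<^sup>2" for x y :: ennreal
proof -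
  have "(x + y)\<^sup>2 = x\<^sup>2 + y\<^sup>2 + 2 * x * y" by (rule power2_sum)
  also have "\<dots> \<le> x\<^sup>2 + y\<^sup>2 + (x\<^sup>2 + y\<^sup>2)"
    by (intro add_left_mono sum_of_squares_ge_ennreal)
  finally show ?thesis by (simp add: mult_2 add_ac)
qed

lemma ennreal_sum_power2_le:
  fixes f :: "'a \<Rightarrow> ennreal"
  assumes "finite A"
  shows "(\<Sum>j\<in>A. f j)\<^sup>2 \<le> of_nat (card A) * (\<Sum>j\<in>A. (f j)\<^sup>2)"
  using Cauchy_Schwarz_nn_integral[of f "count_space A" "\<lambda>_. 1"] assms
  by (simp add: nn_integral_count_space_finite mult.commute)

lemma ennreal_sum_of_squares_le:
  fixes f :: "'a \<Rightarrow> ennreal"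
  assumes "finite A"
  shows "(\<Sum>j\<in>A. (f j)\<^sup>2) \<le> (\<Sum>j\<in>A. f j)\<^sup>2"
proof -
  have "(\<Sum>j\<in>A. f j * f j) \<le> (\<Sum>j\<in>A. f j * (\<Sum>i\<in>A. f i))"
    using assms by (intro sum_mono mult_left_mono member_le_sum) auto
  then show ?thesis by (simp add: power2_eq_square sum_distrib_right)
qed

lemma ennreal_SUP_power2: "(SUP i\<in>I. f i)\<^sup>2 = (SUP i\<in>I. (f i)\<^sup>2)" for f :: "'i \<Rightarrow> ennreal"
proof (rule antisym)
  have "f i * f j \<le> (SUP i\<in>I. (f i)\<^sup>2)" if "i \<in> I" "j \<in> I" for i j
  proof (rule SUP_upper2)
    show "(if f i \<le> f j then j else i) \<in> I" using that by simp
    show "f i * f j \<le> (f (if f i \<le> f j then j else i))\<^sup>2"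
      by (auto simp: power2_eq_square intro: mult_mono)
  qed
  then show "(SUP i\<in>I. f i)\<^sup>2 \<le> (SUP i\<in>I. (f i)\<^sup>2)"
    by (simp add: power2_eq_square SUP_mult_left_ennreal SUP_mult_right_ennreal SUP_least mult.commute)
qed (intro SUP_least power_mono SUP_upper, auto)

lemma sum_half_powers_le:
  assumes "finite A" and "inj_on f A"
  shows "(\<Sum>i\<in>A. (1/2::real) ^ f i) \<le> 2"
proof -
  have "(\<Sum>i\<in>A. (1/2::real) ^ f i) = (\<Sum>k\<in>f ` A. (1/2) ^ k)"
    using assms by (simp add: sum.reindex)
  also have "\<dots> \<le> (\<Sum>k. (1/2) ^ k)"
    using assms by (intro sum_le_suminf) auto
  also have "\<dots> = 2" by (simp add: suminf_geometric)
  finally show ?thesis .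
qed

lemma sum_geometric_pairs_le:
  fixes x y :: "nat \<Rightarrow> ennreal"
  assumes I: "finite I"
  shows "(\<Sum>j\<in>I. \<Sum>i\<in>{i \<in> I. i \<le> j}. ennreal ((1/2) ^ (j - i)) * (x i + y j))
    \<le> 2 * ((\<Sum>i\<in>I. x i) + (\<Sum>j\<in>I. y j))"
proof -
  have geometric: "(\<Sum>i\<in>A. ennreal ((1/2) ^ f i)) \<le> 2" if "finite A" "inj_on f A" for A and f :: "nat \<Rightarrow> nat"
    using ennreal_leI[OF sum_half_powers_le[OF that]] by (simp add: sum_ennreal)
  have "(\<Sum>j\<in>I. \<Sum>i\<in>{i \<in> I. i \<le> j}. ennreal ((1/2) ^ (j - i)) * x i)
      = (\<Sum>i\<in>I. (\<Sum>j\<in>{j \<in> I. i \<le> j}. ennreal ((1/2) ^ (j - i))) * x i)"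
    unfolding sum_distrib_right using I by (intro sum.swap_restrict) auto
  also have "\<dots> \<le> (\<Sum>i\<in>I. 2 * x i)"
    using I by (intro sum_mono mult_right_mono geometric) (auto simp: inj_on_def)
  finally have "(\<Sum>j\<in>I. \<Sum>i\<in>{i \<in> I. i \<le> j}. ennreal ((1/2) ^ (j - i)) * x i) \<le> 2 * (\<Sum>i\<in>I. x i)"
    by (simp add: sum_distrib_left)
  moreover have "(\<Sum>j\<in>I. \<Sum>i\<in>{i \<in> I. i \<le> j}. ennreal ((1/2) ^ (j - i)) * y j) \<le> 2 * (\<Sum>j\<in>I. y j)"
    unfolding sum_distrib_right[symmetric] sum_distrib_left
    using I by (intro sum_mono mult_right_mono geometric) (auto simp: inj_on_def)
  ultimately show ?thesis
    by (simp add: distrib_left sum.distrib add_mono)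
qed

lemma power_of_two_between:
  fixes x :: real
  assumes "1 \<le> x"
  shows "\<exists>n::nat. 2 ^ n \<le> x \<and> x < 2 ^ Suc n"
proof -
  define n where "n = nat \<lfloor>log 2 x\<rfloor>"
  have "of_int \<lfloor>log 2 x\<rfloor> = real n" using assms by (simp add: n_def)
  then show ?thesis
    using floor_log_eq_powr_iff[of x 2 "\<lfloor>log 2 x\<rfloor>"] assms powr_realpow[of 2 n] powr_realpow[of 2 "Suc n"]
    by (intro exI[of _ n]) (simp add: add.commute)
qed

lemma dyadic_scales:
  fixes R :: "'a \<Rightarrow> real"
  assumes "finite X" and R: "\<And>x. x \<in> X \<Longrightarrow> 0 < R x"
  obtains \<kappa> :: real and N :: nat where "0 < \<kappa>"
    "\<And>x. x \<in> X \<Longrightarrow> \<exists>k<N. 6 * R x \<le> \<kappa> / 2 ^ k \<and> \<kappa> / 2 ^ k \<le> 12 * R x"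
proof -
  define \<kappa> where "\<kappa> = 1 + 6 * (\<Sum>x\<in>X. R x)"
  have \<kappa>: "0 < \<kappa>" using R by (simp add: \<kappa>_def sum_nonneg less_imp_le add_pos_nonneg)
  have "\<exists>k. 6 * R x \<le> \<kappa> / 2 ^ k \<and> \<kappa> / 2 ^ k \<le> 12 * R x" if x: "x \<in> X" for x
  proof -
    have "R x \<le> (\<Sum>x\<in>X. R x)" using \<open>finite X\<close> R x by (intro member_le_sum) (auto intro: less_imp_le)
    then have "1 \<le> \<kappa> / (6 * R x)" using R[OF x] by (simp add: \<kappa>_def)
    then obtain k where "2 ^ k \<le> \<kappa> / (6 * R x)" "\<kappa> / (6 * R x) < 2 ^ Suc k"
      using power_of_two_between by blast
    then show ?thesis
      using R[OF x] by (intro exI[of _ k]) (auto simp: field_simps)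
  qed
  then obtain k where k: "\<And>x. x \<in> X \<Longrightarrow> 6 * R x \<le> \<kappa> / 2 ^ k x \<and> \<kappa> / 2 ^ k x \<le> 12 * R x" by metis
  have "k x < Suc (Max (k ` X))" if "x \<in> X" for x using \<open>finite X\<close> that by (simp add: less_Suc_eq_le)
  then show thesis using that[OF \<kappa>, of "Suc (Max (k ` X))"] k by blast
qed

lemma nn_integral_add_power2_le:
  fixes C :: ennreal
  assumes [measurable]: "f \<in> borel_measurable M" "g \<in> borel_measurable M"
    and bound: "(\<integral>\<^sup>+z. (f z)\<^sup>2 \<partial>M) \<le> C" "(\<integral>\<^sup>+z. (g z)\<^sup>2 \<partial>M) \<le> C"
  shows "(\<integral>\<^sup>+z. (f z + g z)\<^sup>2 \<partial>M) \<le> 4 * C"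
proof -
  have "(\<integral>\<^sup>+z. (f z + g z)\<^sup>2 \<partial>M) \<le> (\<integral>\<^sup>+z. 2 * (f z)\<^sup>2 + 2 * (g z)\<^sup>2 \<partial>M)"
    by (intro nn_integral_mono ennreal_power2_add_le)
  also have "\<dots> = 2 * (\<integral>\<^sup>+z. (f z)\<^sup>2 \<partial>M) + 2 * (\<integral>\<^sup>+z. (g z)\<^sup>2 \<partial>M)"
    by (simp add: nn_integral_add nn_integral_cmult)
  also have "\<dots> \<le> 2 * C + 2 * C"
    by (intro add_mono mult_left_mono bound) simp_all
  finally show ?thesis by (simp add: distrib_right[symmetric])
qed

lemma nn_integral_sum_power2_finite:
  fixes f :: "'i \<Rightarrow> 'a \<Rightarrow> ennreal"
  assumes "finite I" and [measurable]: "\<And>i. i \<in> I \<Longrightarrow> f i \<in> borel_measurable M"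
    and bounded: "\<And>i z. i \<in> I \<Longrightarrow> f i z \<le> ennreal K"
    and integrable: "\<And>i. i \<in> I \<Longrightarrow> (\<integral>\<^sup>+z. f i z \<partial>M) < \<infinity>"
  shows "(\<integral>\<^sup>+z. (\<Sum>i\<in>I. f i z)\<^sup>2 \<partial>M) < \<infinity>"
proof -
  have "(\<Sum>i\<in>I. f i z)\<^sup>2 \<le> of_nat (card I) * (\<Sum>i\<in>I. ennreal K * f i z)" for z
  proof -
    have "(\<Sum>i\<in>I. (f i z)\<^sup>2) \<le> (\<Sum>i\<in>I. ennreal K * f i z)"
      unfolding power2_eq_square by (intro sum_mono mult_right_mono bounded) auto
    then show ?thesis
      by (rule order_trans[OF ennreal_sum_power2_le[OF \<open>finite I\<close>] mult_left_mono]) simp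
  qed
  then have "(\<integral>\<^sup>+z. (\<Sum>i\<in>I. f i z)\<^sup>2 \<partial>M) \<le> (\<integral>\<^sup>+z. of_nat (card I) * (\<Sum>i\<in>I. ennreal K * f i z) \<partial>M)"
    by (rule nn_integral_mono)
  also have "\<dots> = of_nat (card I) * (\<Sum>i\<in>I. ennreal K * (\<integral>\<^sup>+z. f i z \<partial>M))"
    by (simp add: nn_integral_cmult nn_integral_sum)
  also have "\<dots> < \<infinity>"
    using integrable \<open>finite I\<close> by (auto simp: ennreal_mult_less_top of_nat_less_top)
  finally show ?thesis .
qed

section \<open>Sums of maximal functions\<close>

lemma Young_powr:
  fixes a b p :: real
  assumes "0 \<le> a" and "0 \<le> b" and "1 < p"
  shows "p * (a * b powr (p - 1)) \<le> a powr p + (p - 1) * b powr p"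
proof -
  have "a * b powr (p - 1) \<le> a powr p / p + (b powr (p - 1)) powr (p / (p - 1)) / (p / (p - 1))"
    by (rule Youngs_inequality) (use assms in \<open>auto simp: field_simps\<close>)
  also have "\<dots> = (a powr p + (p - 1) * b powr p) / p"
    using assms by (simp add: powr_powr add_divide_distrib)
  finally show ?thesis using assms by (simp add: field_simps)
qed

lemma powr_diff_le_mult_diff:
  fixes x y p :: real
  assumes "0 \<le> x" and "0 \<le> y" and "1 < p"
  shows "x powr p - y powr p \<le> p * x powr (p - 1) * (x - y)"
  using Young_powr[of y x p] powr_mult_base[of x "p - 1"] assms by (simp add: algebra_simps)

lemma powr_diff_le_mult_powr_diff:
  fixes x y u :: real
  assumes "0 \<le> x" and "0 \<le> y" and "0 < u"
  shows "x powr (1 + u) - y powr (1 + u) \<le> (1 + 1/u) * (x * (x powr u - y powr u))"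
proof -
  have "(1 + u) * (x * y powr u) \<le> x powr (1 + u) + u * y powr (1 + u)"
    using Young_powr[of x y "1 + u"] assms by simp
  then have "u * (x powr (1 + u) - y powr (1 + u)) \<le> (1 + u) * (x powr (1 + u) - x * y powr u)"
    by (simp add: algebra_simps)
  also have "\<dots> = u * ((1 + 1/u) * (x * (x powr u - y powr u)))"
    using assms powr_mult_base[of x u] by (simp add: field_simps)
  finally show ?thesis using assms by (simp only: mult_le_cancel_left_pos)
qed

lemma sum_le_card_mult_powr_norm:
  fixes m :: "'j \<Rightarrow> real"
  assumes "finite J" and "card J \<le> D" and "0 < D" and m: "\<And>j. j \<in> J \<Longrightarrow> 0 \<le> m j" and u: "0 < u"
  shows "(\<Sum>j\<in>J. m j) \<le> D powr (u / (1 + u)) * (\<Sum>j\<in>J. m j powr (1 + u)) powr (1 / (1 + u))"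
proof (cases "(\<Sum>j\<in>J. m j powr (1 + u)) = 0")
  case True
  then have "m j = 0" if "j \<in> J" for j
    using that \<open>finite J\<close> by (simp add: sum_nonneg_eq_0_iff)
  then show ?thesis by simp
next
  case False
  define V where "V = (\<Sum>j\<in>J. m j powr (1 + u))"
  define b where "b = (V / D) powr (1 / (1 + u))"
  have V_pos: "0 < V" using False by (simp add: V_def order.strict_iff_order sum_nonneg)
  have b: "0 \<le> b" "b powr (1 + u) = V / D" "b powr u = (V / D) powr (u / (1 + u))"
    using V_pos u by (simp_all add: b_def powr_powr)
  have "(1 + u) * (b powr u * (\<Sum>j\<in>J. m j)) = (\<Sum>j\<in>J. (1 + u) * (b powr u * m j))"
    by (simp only: sum_distrib_left)
  also have "\<dots> \<le> (\<Sum>j\<in>J. m j powr (1 + u) + u * (V / D))"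
    using Young_powr[of _ b "1 + u"] m u by (intro sum_mono) (simp add: b mult.commute)
  also have "\<dots> = V + u * (card J * (V / D))"
    by (simp add: sum.distrib V_def)
  also have "\<dots> \<le> (1 + u) * V"
  proof -
    have "card J * (V / D) \<le> D * (V / D)"
      using assms V_pos by (intro mult_right_mono) auto
    then have "card J * (V / D) \<le> V" using \<open>0 < D\<close> by simp
    from mult_left_mono[OF this, of u] u show ?thesis by (simp add: distrib_right)
  qed
  finally have "b powr u * (\<Sum>j\<in>J. m j) \<le> V" using u by simp
  moreover have "V = b powr u * (D powr (u / (1 + u)) * V powr (1 / (1 + u)))"
  proof -
    have "u / (1 + u) + 1 / (1 + u) = 1" using u by (simp add: field_simps)
    then have "V powr (u / (1 + u)) * V powr (1 / (1 + u)) = V powr 1"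
      by (metis powr_add)
    then show ?thesis using V_pos \<open>0 < D\<close> by (simp add: b(3) powr_divide)
  qed
  moreover have "0 < b powr u" using V_pos \<open>0 < D\<close> by (simp add: b_def)
  ultimately show ?thesis
    unfolding V_def[symmetric] by (metis mult_le_cancel_left_pos)
qed

lemma powr_norm_le_sum:
  fixes m :: "'j \<Rightarrow> real"
  assumes m: "\<And>j. j \<in> J \<Longrightarrow> 0 \<le> m j" and u: "0 < u" and "finite J"
  shows "(\<Sum>j\<in>J. m j powr (1 + u)) powr (1 / (1 + u)) \<le> (\<Sum>j\<in>J. m j)"
proof -
  define S where "S = (\<Sum>j\<in>J. m j)"
  have S: "0 \<le> S" "\<And>j. j \<in> J \<Longrightarrow> m j \<le> S"
    using assms by (auto simp: S_def intro: sum_nonneg member_le_sum)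
  have "(\<Sum>j\<in>J. m j powr (1 + u)) \<le> (\<Sum>j\<in>J. m j * S powr u)"
    using m S u by (intro sum_mono) (auto simp flip: powr_mult_base intro!: mult_left_mono powr_mono2)
  also have "\<dots> = S powr (1 + u)"
    using powr_mult_base[OF S(1)] by (simp add: S_def sum_distrib_right)
  finally have "(\<Sum>j\<in>J. m j powr (1 + u)) powr (1 / (1 + u)) \<le> (S powr (1 + u)) powr (1 / (1 + u))"
    using u by (intro powr_mono2) (auto intro: sum_nonneg)
  also have "\<dots> = S"
    using S(1) u by (simp add: powr_powr)
  finally show ?thesis by (simp add: S_def)
qed

primrec runmax :: "(nat \<Rightarrow> real) \<Rightarrow> nat \<Rightarrow> real" where
  "runmax x 0 = 0"
| "runmax x (Suc n) = max (runmax x n) (x n)"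

lemma runmax_nonneg: "0 \<le> runmax x n"
  by (induction n) auto

lemma runmax_mono: "m \<le> n \<Longrightarrow> runmax x m \<le> runmax x n"
  by (induction n rule: dec_induct) auto

lemma runmax_le_sum: "(\<And>n. 0 \<le> x n) \<Longrightarrow> runmax x N \<le> (\<Sum>n<N. x n)"
  by (induction N) (auto intro: add_increasing add_increasing2 sum_nonneg)

lemma runmax_cong: "(\<And>n. n < N \<Longrightarrow> x n = y n) \<Longrightarrow> runmax x N = runmax y N"
  by (induction N) auto

lemma runmax_zero: "runmax (\<lambda>_. 0) N = 0"
  by (induction N) auto

lemma runmax_measurable[measurable]:
  assumes "\<And>n. (\<lambda>z. x n z) \<in> borel_measurable M"
  shows "(\<lambda>z. runmax (\<lambda>n. x n z) N) \<in> borel_measurable M"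
  using assms by (induction N) auto

lemma ennreal_runmax: "ennreal (runmax x N) = (SUP n\<in>{..<N}. ennreal (x n))"
proof (induction N)
  case (Suc N)
  have "ennreal (max p q) = sup (ennreal q) (ennreal p)" for p q
    by (cases "p \<le> q") (simp_all add: sup.absorb1 sup.absorb2 ennreal_leI max_def)
  then show ?case by (simp add: Suc lessThan_Suc)
qed (simp add: bot_ennreal)

lemma runmax_powr_step:
  assumes "0 < u"
  shows "runmax x (Suc n) powr (1 + u) - runmax x n powr (1 + u)
      \<le> (1 + 1/u) * (x n * (runmax x (Suc n) powr u - runmax x n powr u))"
proof (cases "runmax x n < x n")
  case True
  then show ?thesis
    using powr_diff_le_mult_powr_diff[of "x n" "runmax x n" u] runmax_nonneg[of x n] assms by auto
qed auto

definition runmax_norm :: "real \<Rightarrow> 'j set \<Rightarrow> ('j \<Rightarrow> nat \<Rightarrow> real) \<Rightarrow> nat \<Rightarrow> real" where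
  "runmax_norm u J x n = (\<Sum>j\<in>J. runmax (x j) n powr (1 + u)) powr (1 / (1 + u))"

definition runmax_weight :: "real \<Rightarrow> 'j set \<Rightarrow> ('j \<Rightarrow> nat \<Rightarrow> real) \<Rightarrow> 'j \<Rightarrow> nat \<Rightarrow> real" where
  "runmax_weight u J x j n =
    (runmax (x j) (Suc n) powr u - runmax (x j) n powr u) * runmax_norm u J x (Suc n) powr (1 - u)"

lemma runmax_norm_nonneg: "0 \<le> runmax_norm u J x n"
  by (simp add: runmax_norm_def)

lemma runmax_norm_mono: "0 < u \<Longrightarrow> m \<le> n \<Longrightarrow> runmax_norm u J x m \<le> runmax_norm u J x n"
  unfolding runmax_norm_def
  by (intro powr_mono2 sum_mono runmax_mono runmax_nonneg sum_nonneg) auto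

lemma runmax_le_norm:
  assumes "finite J" and "j \<in> J" and "0 < u"
  shows "runmax (x j) n \<le> runmax_norm u J x n"
proof -
  have "runmax (x j) n powr (1 + u) \<le> (\<Sum>j\<in>J. runmax (x j) n powr (1 + u))"
    using assms by (intro member_le_sum) auto
  then have "(runmax (x j) n powr (1 + u)) powr (1 / (1 + u)) \<le> runmax_norm u J x n"
    unfolding runmax_norm_def using assms by (intro powr_mono2) auto
  then show ?thesis using assms runmax_nonneg[of "x j" n] by (simp add: powr_powr)
qed

lemma runmax_weight_nonneg: "0 < u \<Longrightarrow> 0 \<le> runmax_weight u J x j n"
  unfolding runmax_weight_def
  by (simp add: powr_mono2 runmax_mono runmax_nonneg del: runmax.simps)

lemma runmax_weight_cong:
  assumes "\<And>j k. k \<le> n \<Longrightarrow> x j k = y j k"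
  shows "runmax_weight u J x j n = runmax_weight u J y j n"
proof -
  have "runmax (x j) k = runmax (y j) k" if "k \<le> Suc n" for j k
    using assms that by (intro runmax_cong) auto
  then show ?thesis unfolding runmax_weight_def runmax_norm_def by (simp del: runmax.simps)
qed

lemma runmax_weight_measurable[measurable]:
  assumes [measurable]: "\<And>j n. (\<lambda>z. x j n z) \<in> borel_measurable M"
  shows "(\<lambda>z. runmax_weight u J (\<lambda>j n. x j n z) j n) \<in> borel_measurable M"
  unfolding runmax_weight_def runmax_norm_def by measurable

lemma runmax_norm_square_le:
  assumes x: "\<And>j n. 0 \<le> x j n" and u: "0 < u" "u < 1"
  shows "(runmax_norm u J x N)\<^sup>2 \<le> 2 / u * (\<Sum>j\<in>J. \<Sum>n<N. x j n * runmax_weight u J x j n)"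
proof -
  define V where "V n = (\<Sum>j\<in>J. runmax (x j) n powr (1 + u))" for n
  define p where "p = 2 / (1 + u)"
  define d where "d j n = runmax (x j) (Suc n) powr u - runmax (x j) n powr u" for j n
  have p_props: "1 < p" "p * (1 + 1 / u) = 2 / u" using u by (auto simp: p_def divide_simps)
  have V_nonneg: "0 \<le> V n" for n by (simp add: V_def sum_nonneg)
  have norm_powr: "runmax_norm u J x n powr c = V n powr (c / (1 + u))" for n c
    by (simp add: runmax_norm_def V_def powr_powr)
  have step: "V (Suc n) powr p - V n powr p \<le> 2 / u * (\<Sum>j\<in>J. x j n * runmax_weight u J x j n)" for n
  proof -
    have "V (Suc n) - V n = (\<Sum>j\<in>J. runmax (x j) (Suc n) powr (1 + u) - runmax (x j) n powr (1 + u))"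
      by (simp add: V_def sum_subtractf)
    also have "\<dots> \<le> (\<Sum>j\<in>J. (1 + 1/u) * (x j n * d j n))"
      unfolding d_def by (intro sum_mono runmax_powr_step u)
    finally have V_step: "V (Suc n) - V n \<le> (1 + 1/u) * (\<Sum>j\<in>J. x j n * d j n)"
      by (simp add: sum_distrib_left)
    have "V (Suc n) powr p - V n powr p \<le> p * V (Suc n) powr (p - 1) * (V (Suc n) - V n)"
      by (rule powr_diff_le_mult_diff[OF V_nonneg V_nonneg p_props(1)])
    also have "\<dots> \<le> p * V (Suc n) powr (p - 1) * ((1 + 1/u) * (\<Sum>j\<in>J. x j n * d j n))"
      by (rule mult_left_mono[OF V_step]) (use p_props in auto)
    also have "\<dots> = 2 / u * (\<Sum>j\<in>J. x j n * (d j n * V (Suc n) powr (p - 1)))"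
      unfolding p_props(2)[symmetric] by (simp add: sum_distrib_left sum_distrib_right mult_ac)
    also have "p - 1 = (1 - u) / (1 + u)" using u by (simp add: p_def field_simps)
    finally show ?thesis by (simp add: runmax_weight_def d_def norm_powr)
  qed
  have "(runmax_norm u J x N)\<^sup>2 = V N powr p"
    using norm_powr[of N 2] runmax_norm_nonneg[of u J x N] by (simp add: p_def)
  also have "\<dots> = (\<Sum>n<N. V (Suc n) powr p - V n powr p)"
    using p_props by (subst sum_lessThan_telescope) (simp add: V_def)
  also have "\<dots> \<le> (\<Sum>n<N. 2 / u * (\<Sum>j\<in>J. x j n * runmax_weight u J x j n))"
    by (intro sum_mono step)
  also have "\<dots> = 2 / u * (\<Sum>j\<in>J. \<Sum>n<N. x j n * runmax_weight u J x j n)"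
    by (simp only: sum_distrib_left[symmetric] sum.swap[of _ J])
  finally show ?thesis .
qed

lemma sum_runmax_weight_le:
  assumes "finite J" and "j \<in> J" and u: "0 < u" "u < 1"
  shows "(\<Sum>n<N. runmax_weight u J x j n) \<le> runmax_norm u J x N"
proof -
  let ?m = "runmax (x j)" and ?G = "runmax_norm u J x"
  have "(\<Sum>n<N. runmax_weight u J x j n) \<le> (\<Sum>n<N. (?m (Suc n) powr u - ?m n powr u) * ?G N powr (1 - u))"
    unfolding runmax_weight_def using u
    by (intro sum_mono mult_left_mono powr_mono2 runmax_norm_mono)
      (auto simp: powr_mono2 runmax_mono runmax_nonneg runmax_norm_nonneg simp del: runmax.simps)
  also have "\<dots> = ?m N powr u * ?G N powr (1 - u)"
    using sum_lessThan_telescope[of "\<lambda>n. ?m n powr u" N] u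
    by (simp flip: sum_distrib_right del: runmax.simps) simp
  also have "\<dots> \<le> ?G N powr u * ?G N powr (1 - u)"
    using assms by (intro mult_right_mono powr_mono2 runmax_le_norm) (auto simp: runmax_nonneg)
  also have "\<dots> = ?G N"
    using runmax_norm_nonneg[of u J x N] by (simp flip: powr_add)
  finally show ?thesis .
qed

lemma sum_runmax_le_card_mult_norm:
  assumes "finite J" "finite A" and "card A \<le> D" "0 < D" and "\<And>j n. j \<in> J - A \<Longrightarrow> x j n = 0" and "0 < u"
  shows "(\<Sum>j\<in>J. runmax (x j) N) \<le> D powr (u / (1 + u)) * runmax_norm u J x N"
proof -
  have "x j = (\<lambda>_. 0)" if "j \<in> J - A" for j using assms(5)[OF that] by blast
  then have "(\<Sum>j\<in>J. runmax (x j) N) = (\<Sum>j\<in>J \<inter> A. runmax (x j) N)"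
    using \<open>finite J\<close> by (intro sum.mono_neutral_right) (auto simp: runmax_zero)
  also have "\<dots> \<le> D powr (u / (1 + u)) * (\<Sum>j\<in>J \<inter> A. runmax (x j) N powr (1 + u)) powr (1 / (1 + u))"
    using assms card_mono[of A "J \<inter> A"]
    by (intro sum_le_card_mult_powr_norm) (auto simp: runmax_nonneg)
  also have "\<dots> \<le> D powr (u / (1 + u)) * runmax_norm u J x N"
    unfolding runmax_norm_def using assms
    by (intro mult_left_mono powr_mono2 sum_mono2) (auto intro: sum_nonneg)
  finally show ?thesis .
qed

locale adapted_averages =
  fixes M :: "'a measure" and J :: "'j set" and \<phi> :: "'j \<Rightarrow> 'a \<Rightarrow> real"
    and x :: "'j \<Rightarrow> nat \<Rightarrow> 'a \<Rightarrow> real" and E :: "nat \<Rightarrow> 'a \<Rightarrow> 'a \<Rightarrow> bool"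
  assumes finite_J: "finite J"
    and \<phi>_measurable[measurable]: "\<And>j. \<phi> j \<in> borel_measurable M"
    and x_measurable[measurable]: "\<And>j n. x j n \<in> borel_measurable M"
    and \<phi>_nonneg: "\<And>j z. 0 \<le> \<phi> j z" and x_nonneg: "\<And>j n z. 0 \<le> x j n z"
    and E_mono: "\<And>m n z z'. m \<le> n \<Longrightarrow> E n z z' \<Longrightarrow> E m z z'"
    and x_adapted: "\<And>j n z z'. E n z z' \<Longrightarrow> x j n z = x j n z'"
    and integral_mult_adapted_le: "\<And>j n W. W \<in> borel_measurable M \<Longrightarrow> (\<And>z. 0 \<le> W z) \<Longrightarrow>
        (\<And>z z'. E n z z' \<Longrightarrow> W z = W z') \<Longrightarrow>
        (\<integral>\<^sup>+z. ennreal (x j n z * W z) \<partial>M) \<le> (\<integral>\<^sup>+z. ennreal (\<phi> j z * W z) \<partial>M)"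
begin

lemma runmax_norm_measurable[measurable]: "(\<lambda>z. runmax_norm u J (\<lambda>j n. x j n z) N) \<in> borel_measurable M"
  unfolding runmax_norm_def by measurable

lemma runmax_norm_square_integral_le:
  assumes u: "0 < u" "u < 1"
  shows "(\<integral>\<^sup>+z. ennreal ((runmax_norm u J (\<lambda>j n. x j n z) N)\<^sup>2) \<partial>M)
    \<le> ennreal (2 / u) * (\<integral>\<^sup>+z. ennreal (\<Sum>j\<in>J. \<phi> j z) * ennreal (runmax_norm u J (\<lambda>j n. x j n z) N) \<partial>M)"
    (is "?I \<le> _")
proof -
  define G where "G z = runmax_norm u J (\<lambda>j n. x j n z) N" for z
  define W where "W j n z = runmax_weight u J (\<lambda>j n. x j n z) j n" for j n z
  have [measurable]: "W j n \<in> borel_measurable M" for j n unfolding W_def by measurable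
  have const_nonneg: "0 \<le> 2 / u" using u by simp
  have W_nonneg: "0 \<le> W j n z" for j n z using u by (simp add: W_def runmax_weight_nonneg)
  have W_adapted: "W j n z = W j n z'" if "E n z z'" for j n z z'
    unfolding W_def using E_mono[OF _ that] by (intro runmax_weight_cong x_adapted)
  have sums: "ennreal (\<Sum>j\<in>J. \<Sum>n<N. y j n * W j n z) = (\<Sum>j\<in>J. \<Sum>n<N. ennreal (y j n * W j n z))"
    if "\<And>j n. 0 \<le> y j n" for y :: "'j \<Rightarrow> nat \<Rightarrow> real" and z
    using that W_nonneg by (simp add: sum_nonneg flip: sum_ennreal)
  have "?I \<le> (\<integral>\<^sup>+z. ennreal (2 / u) * ennreal (\<Sum>j\<in>J. \<Sum>n<N. x j n z * W j n z) \<partial>M)"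
    unfolding W_def ennreal_mult'[OF const_nonneg, symmetric]
    by (intro nn_integral_mono ennreal_leI runmax_norm_square_le x_nonneg u)
  also have "\<dots> = ennreal (2 / u) * (\<Sum>j\<in>J. \<Sum>n<N. \<integral>\<^sup>+z. ennreal (x j n z * W j n z) \<partial>M)"
    by (simp add: sums x_nonneg nn_integral_cmult nn_integral_sum)
  also have "\<dots> \<le> ennreal (2 / u) * (\<Sum>j\<in>J. \<Sum>n<N. \<integral>\<^sup>+z. ennreal (\<phi> j z * W j n z) \<partial>M)"
    by (intro mult_left_mono sum_mono integral_mult_adapted_le W_nonneg) (auto intro: W_adapted)
  also have "\<dots> = ennreal (2 / u) * (\<integral>\<^sup>+z. ennreal (\<Sum>j\<in>J. \<Sum>n<N. \<phi> j z * W j n z) \<partial>M)"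
    by (simp add: sums \<phi>_nonneg nn_integral_sum)
  also have "\<dots> \<le> ennreal (2 / u) * (\<integral>\<^sup>+z. ennreal (\<Sum>j\<in>J. \<phi> j z) * ennreal (G z) \<partial>M)"
  proof (intro mult_left_mono nn_integral_mono)
    fix z
    have "(\<Sum>j\<in>J. \<phi> j z * (\<Sum>n<N. W j n z)) \<le> (\<Sum>j\<in>J. \<phi> j z * G z)"
      unfolding W_def G_def using finite_J u
      by (intro sum_mono mult_left_mono sum_runmax_weight_le \<phi>_nonneg)
    then have "(\<Sum>j\<in>J. \<Sum>n<N. \<phi> j z * W j n z) \<le> (\<Sum>j\<in>J. \<phi> j z) * G z"
      by (simp add: sum_distrib_left sum_distrib_right)
    then show "ennreal (\<Sum>j\<in>J. \<Sum>n<N. \<phi> j z * W j n z) \<le> ennreal (\<Sum>j\<in>J. \<phi> j z) * ennreal (G z)"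
      by (simp add: ennreal_leI sum_nonneg \<phi>_nonneg flip: ennreal_mult')
  qed simp
  finally show ?thesis by (simp add: G_def)
qed

lemma runmax_norm_integral_le:
  assumes u: "0 < u" "u < 1"
    and finite_integral: "(\<integral>\<^sup>+z. ennreal ((\<Sum>j\<in>J. \<Sum>n<N. x j n z)\<^sup>2) \<partial>M) < \<infinity>"
  shows "(\<integral>\<^sup>+z. ennreal ((runmax_norm u J (\<lambda>j n. x j n z) N)\<^sup>2) \<partial>M)
    \<le> ennreal ((2 / u)\<^sup>2) * (\<integral>\<^sup>+z. ennreal ((\<Sum>j\<in>J. \<phi> j z)\<^sup>2) \<partial>M)"
proof -
  define G where "G z = runmax_norm u J (\<lambda>j n. x j n z) N" for z
  define \<Phi> where "\<Phi> z = (\<Sum>j\<in>J. \<phi> j z)" for z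
  let ?I = "\<integral>\<^sup>+z. ennreal ((G z)\<^sup>2) \<partial>M" and ?K = "\<integral>\<^sup>+z. ennreal ((\<Phi> z)\<^sup>2) \<partial>M"
  have [measurable]: "G \<in> borel_measurable M" "\<Phi> \<in> borel_measurable M"
    unfolding G_def \<Phi>_def by measurable
  have G_nonneg: "0 \<le> G z" for z by (simp add: G_def runmax_norm_nonneg)
  have "?I < top"
  proof (rule le_less_trans[OF nn_integral_mono finite_integral[unfolded infinity_ennreal_def]])
    fix z
    have "G z \<le> (\<Sum>j\<in>J. runmax (\<lambda>n. x j n z) N)"
      unfolding G_def runmax_norm_def using u finite_J by (intro powr_norm_le_sum runmax_nonneg)
    also have "\<dots> \<le> (\<Sum>j\<in>J. \<Sum>n<N. x j n z)"
      by (intro sum_mono runmax_le_sum x_nonneg)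
    finally show "ennreal ((G z)\<^sup>2) \<le> ennreal ((\<Sum>j\<in>J. \<Sum>n<N. x j n z)\<^sup>2)"
      using G_nonneg by (intro ennreal_leI power_mono) auto
  qed
  moreover have "?I\<^sup>2 \<le> (ennreal ((2 / u)\<^sup>2) * ?K) * ?I"
  proof -
    have "?I\<^sup>2 \<le> (ennreal (2 / u) * (\<integral>\<^sup>+z. ennreal (\<Phi> z) * ennreal (G z) \<partial>M))\<^sup>2"
      unfolding G_def \<Phi>_def by (intro power_mono runmax_norm_square_integral_le u) auto
    also have "\<dots> \<le> ennreal ((2 / u)\<^sup>2) * ((\<integral>\<^sup>+z. (ennreal (\<Phi> z))\<^sup>2 \<partial>M) * (\<integral>\<^sup>+z. (ennreal (G z))\<^sup>2 \<partial>M))"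
      unfolding power_mult_distrib using u
      by (intro mult_mono Cauchy_Schwarz_nn_integral) (auto simp: ennreal_power)
    finally show ?thesis
      using G_nonneg by (simp add: ennreal_power \<Phi>_def sum_nonneg \<phi>_nonneg mult.assoc)
  qed
  ultimately show ?thesis
    unfolding G_def \<Phi>_def by (rule ennreal_le_if_square_le)
qed

text \<open>With \<open>u = 1 / (2 + ln D)\<close> the norms of \<open>\<ell>\<^sup>1\<close> and \<open>\<ell>\<^bsup>1 + u\<^esup>\<close> over \<open>D\<close> indices are comparable, while
  the telescoping costs only the factor \<open>2 / u\<close>: this is why the loss is logarithmic in \<open>D\<close>.\<close>
theorem sum_maximal_ineq:
  assumes D: "0 < D"
    and sparse: "\<And>z. \<exists>A. finite A \<and> card A \<le> D \<and> (\<forall>j\<in>J - A. \<forall>n. x j n z = 0)"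
    and finite_integral: "(\<integral>\<^sup>+z. ennreal ((\<Sum>j\<in>J. \<Sum>n<N. x j n z)\<^sup>2) \<partial>M) < \<infinity>"
  shows "(\<integral>\<^sup>+z. ennreal ((\<Sum>j\<in>J. runmax (\<lambda>n. x j n z) N)\<^sup>2) \<partial>M)
     \<le> ennreal ((6 * (2 + ln D))\<^sup>2) * (\<integral>\<^sup>+z. ennreal ((\<Sum>j\<in>J. \<phi> j z)\<^sup>2) \<partial>M)"
proof -
  define u where "u = 1 / (2 + ln D)"
  define G where "G z = runmax_norm u J (\<lambda>j n. x j n z) N" for z
  have [measurable]: "G \<in> borel_measurable M" unfolding G_def by measurable
  have ln_D: "0 \<le> ln (real D)" using D by simp
  then have u: "0 < u" "u < 1" by (simp_all add: u_def)
  have "real D powr (u / (1 + u)) = exp (u / (1 + u) * ln D)" using D by (simp add: powr_def)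
  also have "\<dots> \<le> exp 1" using ln_D by (simp add: u_def field_simps)
  also have "\<dots> \<le> 3" by (rule exp_le)
  finally have D_powr: "real D powr (u / (1 + u)) \<le> 3" .
  have sum_le: "(\<Sum>j\<in>J. runmax (\<lambda>n. x j n z) N) \<le> 3 * G z" for z
  proof -
    obtain A where "finite A" "card A \<le> D" "\<forall>j\<in>J - A. \<forall>n. x j n z = 0" using sparse by blast
    then have "(\<Sum>j\<in>J. runmax (\<lambda>n. x j n z) N) \<le> real D powr (u / (1 + u)) * G z"
      unfolding G_def using finite_J D u by (intro sum_runmax_le_card_mult_norm[of J A]) auto
    also have "\<dots> \<le> 3 * G z"
      using D_powr by (intro mult_right_mono) (simp_all add: G_def runmax_norm_nonneg)
    finally show ?thesis .
  qed
  have "(\<integral>\<^sup>+z. ennreal ((\<Sum>j\<in>J. runmax (\<lambda>n. x j n z) N)\<^sup>2) \<partial>M) \<le> (\<integral>\<^sup>+z. ennreal ((3 * G z)\<^sup>2) \<partial>M)"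
    by (intro nn_integral_mono ennreal_leI power_mono sum_le sum_nonneg runmax_nonneg)
  also have "\<dots> = 9 * (\<integral>\<^sup>+z. ennreal ((G z)\<^sup>2) \<partial>M)"
    by (simp add: power_mult_distrib ennreal_mult' nn_integral_cmult)
  also have "\<dots> \<le> ennreal 9 * (ennreal ((2 / u)\<^sup>2) * (\<integral>\<^sup>+z. ennreal ((\<Sum>j\<in>J. \<phi> j z)\<^sup>2) \<partial>M))"
    unfolding G_def using runmax_norm_integral_le[OF u finite_integral] by (simp add: mult_left_mono)
  also have "\<dots> = ennreal (9 * (2 / u)\<^sup>2) * (\<integral>\<^sup>+z. ennreal ((\<Sum>j\<in>J. \<phi> j z)\<^sup>2) \<partial>M)"
    by (simp only: ennreal_mult'[of 9] mult.assoc zero_le_numeral)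
  also have "9 * (2 / u)\<^sup>2 = (6 * (2 + ln D))\<^sup>2"
    by (simp add: u_def power2_eq_square algebra_simps)
  finally show ?thesis .
qed

end

section \<open>Averages on the line\<close>

lemma nn_integral_translate:
  fixes f :: "real \<Rightarrow> ennreal"
  assumes "f \<in> borel_measurable borel"
  shows "(\<integral>\<^sup>+x. f (x + t) \<partial>lborel) = (\<integral>\<^sup>+x. f x \<partial>lborel)"
  using nn_integral_real_affine[OF assms, of 1 t] by (simp add: add.commute)

lemma ennreal_divide_eq_mult: "0 < d \<Longrightarrow> x / ennreal d = ennreal (1 / d) * x"
  by (simp add: divide_ennreal_def inverse_ennreal inverse_eq_divide mult.commute)

definition rel_avg :: "real \<Rightarrow> (real \<Rightarrow> real \<Rightarrow> bool) \<Rightarrow> (real \<Rightarrow> ennreal) \<Rightarrow> real \<Rightarrow> ennreal" where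
  "rel_avg d Q f x = (\<integral>\<^sup>+y. (if Q x y then f y else 0) \<partial>lborel) / ennreal d"

lemma rel_avg_mono: "(\<And>y. Q x y \<Longrightarrow> f y \<le> g y) \<Longrightarrow> rel_avg d Q f x \<le> rel_avg d Q g x"
  unfolding rel_avg_def by (intro divide_right_mono_ennreal nn_integral_mono) auto

lemma rel_avg_zero: "(\<And>y. Q x y \<Longrightarrow> f y = 0) \<Longrightarrow> rel_avg d Q f x = 0"
  by (simp add: rel_avg_def cong: if_cong)

lemma rel_avg_const:
  assumes "0 < d" and "{y. Q x y} \<in> sets borel" and "emeasure lborel {y. Q x y} = ennreal d"
  shows "rel_avg d Q (\<lambda>_. c) x = c"
proof -
  have "(\<integral>\<^sup>+y. (if Q x y then c else 0) \<partial>lborel) = (\<integral>\<^sup>+y. c * indicator {y. Q x y} y \<partial>lborel)"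
    by (intro nn_integral_cong) (simp add: indicator_def)
  then show ?thesis
    using assms by (simp add: rel_avg_def nn_integral_cmult_indicator mult_divide_eq_ennreal)
qed

lemma rel_avg_le:
  assumes "0 < d" and "{y. Q x y} \<in> sets borel" and "emeasure lborel {y. Q x y} = ennreal d"
    and "\<And>y. f y \<le> c"
  shows "rel_avg d Q f x \<le> c"
  using rel_avg_mono[of Q x f "\<lambda>_. c" d] rel_avg_const[of d Q x c] assms by simp

lemma rel_avg_eq_self:
  assumes "0 < d" and "{y. Q x y} \<in> sets borel" and "emeasure lborel {y. Q x y} = ennreal d"
    and "\<And>y. Q x y \<Longrightarrow> f y = f x"
  shows "rel_avg d Q f x = f x"
proof -
  have "rel_avg d Q f x = rel_avg d Q (\<lambda>_. f x) x"
    unfolding rel_avg_def using assms(4) by (metis (no_types, lifting))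
  then show ?thesis using rel_avg_const[of d Q x "f x"] assms by simp
qed

lemma rel_avg_sum:
  assumes [measurable]: "\<And>y. f y \<in> borel_measurable borel" "Measurable.pred borel (Q x)"
  shows "rel_avg d Q (\<lambda>y. \<Sum>i\<in>I. f i y) x = (\<Sum>i\<in>I. rel_avg d Q (f i) x)"
proof -
  have "(\<integral>\<^sup>+y. (if Q x y then \<Sum>i\<in>I. f i y else 0) \<partial>lborel)
      = (\<integral>\<^sup>+y. (\<Sum>i\<in>I. if Q x y then f i y else 0) \<partial>lborel)"
    by (intro nn_integral_cong) simp
  then show ?thesis
    by (simp add: rel_avg_def nn_integral_sum divide_ennreal_def sum_distrib_right)
qed

lemma rel_avg_SUP:
  fixes f :: "nat \<Rightarrow> real \<Rightarrow> ennreal"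
  assumes inc: "\<And>y. incseq (\<lambda>k. f k y)"
    and [measurable]: "\<And>k. f k \<in> borel_measurable borel" "Measurable.pred borel (Q x)"
  shows "rel_avg d Q (\<lambda>y. SUP k. f k y) x = (SUP k. rel_avg d Q (f k) x)"
proof -
  have "(\<integral>\<^sup>+y. (if Q x y then SUP k. f k y else 0) \<partial>lborel)
      = (\<integral>\<^sup>+y. (SUP k. if Q x y then f k y else 0) \<partial>lborel)"
    by (intro nn_integral_cong) simp
  also have "\<dots> = (SUP k. \<integral>\<^sup>+y. (if Q x y then f k y else 0) \<partial>lborel)"
    using inc by (intro nn_integral_monotone_convergence_SUP) (auto simp: incseq_def le_fun_def)
  finally show ?thesis by (simp add: rel_avg_def SUP_divide_ennreal)
qed

lemma rel_avg_symmetric: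
  assumes Q_sym: "\<And>x y. Q x y \<longleftrightarrow> Q y x"
    and [measurable]: "Measurable.pred (borel \<Otimes>\<^sub>M borel) (\<lambda>z. Q (fst z) (snd z))"
      "f \<in> borel_measurable borel" "g \<in> borel_measurable borel"
  shows "(\<integral>\<^sup>+x. g x * rel_avg d Q f x \<partial>lborel) = (\<integral>\<^sup>+x. f x * rel_avg d Q g x \<partial>lborel)"
proof -
  have [measurable]: "Measurable.pred borel (Q x)" for x
    using measurable_compose_Pair1[OF _ assms(2), of x] by simp
  have [measurable]: "Measurable.pred (borel \<Otimes>\<^sub>M borel) (\<lambda>z. Q (snd z) (fst z))"
    by (subst Q_sym) measurable
  have kernel: "(\<integral>\<^sup>+x. g x * rel_avg d Q f x \<partial>lborel)
      = (\<integral>\<^sup>+x. \<integral>\<^sup>+y. (if Q x y then g x * f y else 0) / ennreal d \<partial>lborel \<partial>lborel)"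
    if [measurable]: "f \<in> borel_measurable borel" "g \<in> borel_measurable borel" for f g
  proof (rule nn_integral_cong)
    fix x
    have "g x * rel_avg d Q f x = (\<integral>\<^sup>+y. g x * (if Q x y then f y else 0) / ennreal d \<partial>lborel)"
      by (simp add: rel_avg_def nn_integral_divide nn_integral_cmult ennreal_times_divide)
    also have "\<dots> = (\<integral>\<^sup>+y. (if Q x y then g x * f y else 0) / ennreal d \<partial>lborel)"
      by (intro nn_integral_cong) simp
    finally show "g x * rel_avg d Q f x = \<dots>" .
  qed
  have "(\<integral>\<^sup>+x. g x * rel_avg d Q f x \<partial>lborel)
      = (\<integral>\<^sup>+y. \<integral>\<^sup>+x. (if Q x y then g x * f y else 0) / ennreal d \<partial>lborel \<partial>lborel)"
    unfolding kernel[OF assms(3,4)]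
    by (rule lborel_pair.Fubini') measurable
  also have "\<dots> = (\<integral>\<^sup>+x. f x * rel_avg d Q g x \<partial>lborel)"
    unfolding kernel[OF assms(4,3)] by (intro nn_integral_cong) (simp add: Q_sym mult.commute)
  finally show ?thesis .
qed

definition window_avg :: "real \<Rightarrow> (real \<Rightarrow> ennreal) \<Rightarrow> real \<Rightarrow> ennreal" where
  "window_avg r = rel_avg (2 * r) (\<lambda>x y. \<bar>y - x\<bar> < r)"

lemma window_avg_eq:
  "0 < r \<Longrightarrow> window_avg r f x = ennreal (1 / (2 * r)) * (\<integral>\<^sup>+y. (if \<bar>y - x\<bar> < r then f y else 0) \<partial>lborel)"
  unfolding window_avg_def rel_avg_def by (rule ennreal_divide_eq_mult) simp

lemma emeasure_window: "0 < r \<Longrightarrow> emeasure lborel {y. \<bar>y - x\<bar> < r} = ennreal (2 * r)"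
proof -
  assume "0 < r"
  moreover have "{y. \<bar>y - x\<bar> < r} = {x - r<..<x + r}" by auto
  ultimately show ?thesis by simp
qed

lemma window_avg_translate:
  assumes [measurable]: "f \<in> borel_measurable borel"
  shows "window_avg r f (x + c) = window_avg r (\<lambda>y. f (y + c)) x"
  unfolding window_avg_def rel_avg_def
  by (subst nn_integral_translate[of _ c, symmetric]) auto

lemma window_avg_le_double_radius:
  assumes "0 < r" and "r \<le> R" and "R \<le> 2 * r"
  shows "window_avg r f x \<le> 2 * window_avg R f x"
proof -
  let ?I = "\<lambda>R. \<integral>\<^sup>+y. (if \<bar>y - x\<bar> < R then f y else 0) \<partial>lborel"
  have "window_avg r f x \<le> ennreal (2 * (1 / (2 * R))) * ?I R"
    unfolding window_avg_eq[OF assms(1)] using assms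
    by (intro mult_mono ennreal_leI nn_integral_mono) (auto simp: field_simps)
  also have "\<dots> = 2 * window_avg R f x"
    using assms by (subst ennreal_mult') (auto simp: window_avg_eq mult.assoc)
  finally show ?thesis .
qed

lemma window_avg_perturb_le:
  assumes [measurable]: "f \<in> borel_measurable borel" and "\<bar>e\<bar> \<le> w" and "w < r"
  shows "window_avg r f (x + e) \<le> window_avg r f (x - w) + window_avg r f (x + w)"
proof -
  let ?I = "\<lambda>c. \<integral>\<^sup>+y. (if \<bar>y - c\<bar> < r then f y else 0) \<partial>lborel"
  have "?I (x + e) \<le> (\<integral>\<^sup>+y. (if \<bar>y - (x - w)\<bar> < r then f y else 0)
      + (if \<bar>y - (x + w)\<bar> < r then f y else 0) \<partial>lborel)"
    using assms by (intro nn_integral_mono) (auto split: if_splits)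
  also have "\<dots> = ?I (x - w) + ?I (x + w)"
    by (rule nn_integral_add) measurable
  finally show ?thesis
    unfolding window_avg_def rel_avg_def add_divide_distrib_ennreal[symmetric]
    by (rule divide_right_mono_ennreal)
qed

lemma emeasure_slanted_window_le:
  fixes S :: "real set"
  assumes d: "emeasure lborel S = ennreal d" "0 < d" and r: "0 < r" and [measurable]: "S \<in> sets borel"
  shows "emeasure lborel {a \<in> S. \<bar>c + e * a\<bar> < r} \<le> ennreal (4 * r * d / (\<bar>e\<bar> * d + r))"
proof (cases "\<bar>e\<bar> * d \<le> r")
  case True
  have "emeasure lborel {a \<in> S. \<bar>c + e * a\<bar> < r} \<le> ennreal d"
    unfolding d(1)[symmetric] by (intro emeasure_mono) auto
  also have "d \<le> 4 * r * d / (\<bar>e\<bar> * d + r)"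
    using True d r by (simp add: pos_le_divide_eq add_nonneg_pos)
  finally show ?thesis by (simp add: ennreal_leI)
next
  case False
  then have e_large: "e \<noteq> 0" "r < \<bar>e\<bar> * d" using r by auto
  have "{a \<in> S. \<bar>c + e * a\<bar> < r} \<subseteq> {a. \<bar>a - - c / e\<bar> < r / \<bar>e\<bar>}"
  proof safe
    fix a assume "\<bar>c + e * a\<bar> < r"
    then have "\<bar>e * (a - - c / e)\<bar> < r" using e_large by (simp add: algebra_simps)
    then show "\<bar>a - - c / e\<bar> < r / \<bar>e\<bar>" using e_large by (simp add: abs_mult pos_less_divide_eq mult.commute)
  qed
  then have "emeasure lborel {a \<in> S. \<bar>c + e * a\<bar> < r} \<le> emeasure lborel {a. \<bar>a - - c / e\<bar> < r / \<bar>e\<bar>}"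
    by (intro emeasure_mono) auto
  also have "\<dots> = ennreal (2 * (r / \<bar>e\<bar>))"
    using e_large r by (intro emeasure_window) simp
  also have "2 * (r / \<bar>e\<bar>) \<le> 4 * r * d / (\<bar>e\<bar> * d + r)"
  proof -
    have "2 * r * (\<bar>e\<bar> * d + r) \<le> 4 * r * d * \<bar>e\<bar>"
      using e_large r by (simp add: algebra_simps)
    then show ?thesis using e_large r d by (simp add: field_simps add_pos_pos)
  qed
  finally show ?thesis by (simp add: ennreal_leI)
qed

lemma emeasure_slanted_window_le_indicator:
  fixes S :: "real set" and a0 b e y :: real
  assumes d: "emeasure lborel S = ennreal d" "0 < d" and diam: "\<And>a. a \<in> S \<Longrightarrow> \<bar>a - a0\<bar> \<le> d" and r: "0 < r"
    and S: "S \<in> sets borel"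
  defines "R \<equiv> \<bar>e\<bar> * d + r"
  shows "emeasure lborel {a \<in> S. \<bar>y - (b + e * (a - a0))\<bar> < r}
    \<le> ennreal (4 * r * d / R) * indicator {y. \<bar>y - b\<bar> < R} y"
proof -
  define T where "T = {a \<in> S. \<bar>y - (b + e * (a - a0))\<bar> < r}"
  have "emeasure lborel T \<le> ennreal (4 * r * d / R) * indicator {y. \<bar>y - b\<bar> < R} y"
  proof (cases "T = {}")
    case False
    then obtain a where a: "a \<in> S" "\<bar>y - (b + e * (a - a0))\<bar> < r" by (auto simp: T_def)
    have "\<bar>e * (a - a0)\<bar> \<le> \<bar>e\<bar> * d"
      unfolding abs_mult using diam[OF a(1)] by (intro mult_left_mono) auto
    then have "\<bar>y - b\<bar> < R" using a(2) by (simp add: R_def)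
    moreover have "T = {a \<in> S. \<bar>(y - b + e * a0) + (- e) * a\<bar> < r}"
      by (simp add: T_def algebra_simps)
    ultimately show ?thesis
      using emeasure_slanted_window_le[OF d r S, of "y - b + e * a0" "- e"] by (simp add: R_def)
  qed simp
  then show ?thesis by (simp add: T_def)
qed

lemma nn_integral_slanted_window_avg:
  assumes r: "0 < r" and [measurable]: "S \<in> sets borel" "f \<in> borel_measurable borel"
  shows "(\<integral>\<^sup>+a. (if a \<in> S then window_avg r f (b + e * (a - a0)) else 0) \<partial>lborel)
    = (\<integral>\<^sup>+y. ennreal (1 / (2 * r)) * (f y * emeasure lborel {a \<in> S. \<bar>y - (b + e * (a - a0))\<bar> < r}) \<partial>lborel)"
    (is "?lhs = _")
proof -
  define T where "T y = {a \<in> S. \<bar>y - (b + e * (a - a0))\<bar> < r}" for y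
  have "(if a \<in> S then window_avg r f (b + e * (a - a0)) else 0)
      = (\<integral>\<^sup>+y. ennreal (1 / (2 * r)) * (f y * indicator (T y) a) \<partial>lborel)" for a
  proof -
    have "(if a \<in> S then window_avg r f (b + e * (a - a0)) else 0)
        = ennreal (1 / (2 * r)) * (\<integral>\<^sup>+y. f y * indicator (T y) a \<partial>lborel)"
      unfolding window_avg_eq[OF r]
      by (auto simp: T_def indicator_def intro!: nn_integral_cong arg_cong2[where f = "(*)"])
    also have "\<dots> = (\<integral>\<^sup>+y. ennreal (1 / (2 * r)) * (f y * indicator (T y) a) \<partial>lborel)"
      by (rule nn_integral_cmult[symmetric]) (simp add: T_def)
    finally show ?thesis .
  qed
  then have "?lhs = (\<integral>\<^sup>+a. \<integral>\<^sup>+y. ennreal (1 / (2 * r)) * (f y * indicator (T y) a) \<partial>lborel \<partial>lborel)"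
    by simp
  also have "\<dots> = (\<integral>\<^sup>+y. \<integral>\<^sup>+a. ennreal (1 / (2 * r)) * (f y * indicator (T y) a) \<partial>lborel \<partial>lborel)"
    unfolding T_def by (rule lborel_pair.Fubini') measurable
  also have "\<dots> = (\<integral>\<^sup>+y. ennreal (1 / (2 * r)) * (f y * emeasure lborel (T y)) \<partial>lborel)"
    by (simp add: nn_integral_cmult T_def)
  finally show ?thesis by (simp only: T_def)
qed

lemma avg_slanted_window_avg_le:
  fixes S :: "real set"
  assumes d: "emeasure lborel S = ennreal d" "0 < d" and diam: "\<And>a. a \<in> S \<Longrightarrow> \<bar>a - a0\<bar> \<le> d" and r: "0 < r"
    and S[measurable]: "S \<in> sets borel" and [measurable]: "f \<in> borel_measurable borel"
  shows "(\<integral>\<^sup>+a. (if a \<in> S then window_avg r f (b + e * (a - a0)) else 0) \<partial>lborel) / ennreal d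
    \<le> 4 * window_avg (\<bar>e\<bar> * d + r) f b"
proof -
  define R where "R = \<bar>e\<bar> * d + r"
  define T where "T y = {a \<in> S. \<bar>y - (b + e * (a - a0))\<bar> < r}" for y
  have R_pos: "0 < R" using d r by (simp add: R_def add_nonneg_pos)
  let ?I = "\<integral>\<^sup>+y. (if \<bar>y - b\<bar> < R then f y else 0) \<partial>lborel"
  let ?lhs = "\<integral>\<^sup>+a. (if a \<in> S then window_avg r f (b + e * (a - a0)) else 0) \<partial>lborel"
  have "?lhs = (\<integral>\<^sup>+y. ennreal (1 / (2 * r)) * (f y * emeasure lborel (T y)) \<partial>lborel)"
    unfolding T_def by (rule nn_integral_slanted_window_avg[OF r]) measurable
  also have "\<dots> \<le> (\<integral>\<^sup>+y. ennreal (1 / (2 * r))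
      * (f y * (ennreal (4 * r * d / R) * indicator {y. \<bar>y - b\<bar> < R} y)) \<partial>lborel)"
    unfolding T_def R_def using d r
    by (intro nn_integral_mono mult_left_mono emeasure_slanted_window_le_indicator diam S) auto
  also have "\<dots> = (\<integral>\<^sup>+y. ennreal (2 * d / R) * (if \<bar>y - b\<bar> < R then f y else 0) \<partial>lborel)"
  proof (rule nn_integral_cong)
    fix y
    have "ennreal (1 / (2 * r)) * ennreal (4 * r * d / R) = ennreal (2 * d / R)"
      using r by (simp flip: ennreal_mult')
    then show "ennreal (1 / (2 * r)) * (f y * (ennreal (4 * r * d / R) * indicator {y. \<bar>y - b\<bar> < R} y))
        = ennreal (2 * d / R) * (if \<bar>y - b\<bar> < R then f y else 0)"
      by (simp add: mult.left_commute mult.assoc[symmetric]) (simp add: mult.commute)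
  qed
  also have "\<dots> = ennreal (2 * d / R) * ?I"
    by (rule nn_integral_cmult) measurable
  finally have "?lhs / ennreal d \<le> ennreal (1 / d) * (ennreal (2 * d / R) * ?I)"
    using d by (simp add: ennreal_divide_eq_mult mult_left_mono)
  also have "\<dots> = ennreal (4 * (1 / (2 * R))) * ?I"
    using d by (simp add: mult.assoc[symmetric] flip: ennreal_mult')
  also have "\<dots> = 4 * window_avg R f b"
    using R_pos by (subst ennreal_mult') (simp_all add: window_avg_eq mult.assoc)
  finally show ?thesis by (simp add: R_def)
qed

section \<open>Dyadic cells\<close>

definition cell :: "real \<Rightarrow> real \<Rightarrow> int" where
  "cell d x = \<lfloor>x / d\<rfloor>"

lemma cell_measurable[measurable]: "cell d \<in> borel \<rightarrow>\<^sub>M count_space UNIV"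
  unfolding cell_def by measurable

lemma cell_eq_iff: "0 < d \<Longrightarrow> cell d x = m \<longleftrightarrow> of_int m * d \<le> x \<and> x < (of_int m + 1) * d"
  unfolding cell_def floor_eq_iff by (simp add: pos_le_divide_eq pos_divide_less_eq)

lemma dist_less_if_cell_eq: "0 < d \<Longrightarrow> cell d x = cell d y \<Longrightarrow> \<bar>x - y\<bar> < d"
  using cell_eq_iff[of d x "cell d y"] cell_eq_iff[of d y "cell d y"] by (auto simp: distrib_right)

lemma emeasure_cell: "0 < d \<Longrightarrow> emeasure lborel {x. cell d (x + s) = m} = ennreal d"
proof -
  assume d: "0 < d"
  have "{x. cell d (x + s) = m} = {of_int m * d - s..<(of_int m + 1) * d - s}"
    by (auto simp: cell_eq_iff[OF d])
  then show ?thesis using d by (simp add: distrib_right)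
qed

lemma cell_coarsen: "cell (2 ^ k * d) x = cell d x div 2 ^ k"
  using floor_divide_real_eq_div[of "2 ^ k" "x / d"] by (simp add: cell_def mult.commute)

lemma cell_dyadic_div: "m \<le> n \<Longrightarrow> cell (l / 2 ^ m) x = cell (l / 2 ^ n) x div 2 ^ (n - m)"
  using cell_coarsen[of "n - m" "l / 2 ^ n" x] by (simp add: power_diff)

lemma cell_dyadic_mono:
  "m \<le> n \<Longrightarrow> cell (l / 2 ^ n) x = cell (l / 2 ^ n) y \<Longrightarrow> cell (l / 2 ^ m) x = cell (l / 2 ^ m) y"
  by (simp add: cell_dyadic_div)

lemma cell_boundary_between:
  assumes "0 < d" and "cell d x \<noteq> cell d y"
  shows "\<exists>z::int. min x y < of_int z * d \<and> of_int z * d \<le> max x y"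
  using assms(2)
proof (induction x y rule: linorder_wlog)
  case (le x y)
  have "cell d x \<le> cell d y"
    using \<open>0 < d\<close> le by (simp add: cell_def floor_mono divide_right_mono)
  then have "of_int (cell d x) + 1 \<le> (of_int (cell d y) :: real)"
    using le by linarith
  then have "(of_int (cell d x) + 1) * d \<le> of_int (cell d y) * d"
    using \<open>0 < d\<close> by (intro mult_right_mono) auto
  then have "x < of_int (cell d y) * d" "of_int (cell d y) * d \<le> y"
    using cell_eq_iff[OF \<open>0 < d\<close>, of x "cell d x"] cell_eq_iff[OF \<open>0 < d\<close>, of y "cell d y"] by simp_all
  then show ?case using le by (auto simp: min_def max_def)
next
  case (sym x y)
  then show ?case by (simp add: min.commute max.commute)
qed

lemma dyadic_third_apart:
  fixes l :: real and z :: int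
  assumes "0 < l"
  shows "l / 2 ^ n / 3 \<le> \<bar>of_int z * (l / 2 ^ n) - l / 3\<bar>"
proof -
  have "coprime (3::int) (2 ^ n)" by (simp add: coprime_power_right_iff)
  then have "\<not> (3::int) dvd 2 ^ n" using coprime_absorb_left[of "3::int" "2 ^ n"] by auto
  then have "3 * z \<noteq> 2 ^ n" by (metis dvd_triv_left)
  then have "1 \<le> \<bar>3 * z - 2 ^ n\<bar>" by linarith
  then have "real_of_int 1 \<le> of_int \<bar>3 * z - 2 ^ n\<bar>" by (simp only: of_int_le_iff)
  then have "1 \<le> \<bar>3 * real_of_int z - 2 ^ n\<bar>" by simp
  then have "l / 2 ^ n / 3 * 1 \<le> l / 2 ^ n / 3 * \<bar>3 * real_of_int z - 2 ^ n\<bar>"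
    using assms by (intro mult_left_mono) auto
  also have "\<dots> = \<bar>l / 2 ^ n / 3 * (3 * real_of_int z - 2 ^ n)\<bar>"
    using assms by (simp add: abs_mult)
  also have "l / 2 ^ n / 3 * (3 * real_of_int z - 2 ^ n) = of_int z * (l / 2 ^ n) - l / 3"
    by (simp add: field_simps)
  finally show ?thesis by simp
qed

text \<open>Because \<^term>\<open>2 ^ n\<close> is not a multiple of 3, one translation by a third of the coarsest cell
  serves as the second dyadic grid at all scales simultaneously.\<close>
lemma ball_in_shifted_dyadic_cell:
  fixes l b r :: real
  assumes l: "0 < l" and r: "0 < r" "6 * r \<le> l / 2 ^ n"
  shows "\<exists>s\<in>{0, l / 3}. \<forall>x. \<bar>x - b\<bar> < r \<longrightarrow> cell (l / 2 ^ n) (x + s) = cell (l / 2 ^ n) (b + s)"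
proof (rule ccontr)
  define d where "d = l / 2 ^ n"
  assume "\<not> ?thesis"
  then have split: "\<forall>s\<in>{0, l / 3}. \<exists>x. \<bar>x - b\<bar> < r \<and> cell d (x + s) \<noteq> cell d (b + s)"
    by (simp add: d_def)
  have boundary: "\<exists>z::int. \<bar>of_int z * d - s - b\<bar> < r" if s: "s \<in> {0, l / 3}" for s
  proof -
    obtain x where x: "\<bar>x - b\<bar> < r" "cell d (x + s) \<noteq> cell d (b + s)"
      using bspec[OF split s] by blast
    have "0 < d" using l by (simp add: d_def)
    then obtain z :: int where "min (x + s) (b + s) < of_int z * d" "of_int z * d \<le> max (x + s) (b + s)"
      using cell_boundary_between[OF _ x(2)] by blast
    then show ?thesis using x(1) by (intro exI[of _ z]) linarith
  qed
  obtain z z' :: int where z: "\<bar>of_int z * d - b\<bar> < r" "\<bar>of_int z' * d - l / 3 - b\<bar> < r"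
    using boundary[of 0] boundary[of "l / 3"] by auto
  have "\<bar>of_int (z' - z) * d - l / 3\<bar> = \<bar>(of_int z' * d - l / 3 - b) - (of_int z * d - b)\<bar>"
    by (simp add: left_diff_distrib)
  also have "\<dots> < 2 * r" using z(1) z(2) by linarith
  also have "\<dots> \<le> d / 3" using r by (simp add: d_def)
  finally show False using dyadic_third_apart[OF l, of n "z' - z"] by (simp add: d_def)
qed

definition cell_avg :: "real \<Rightarrow> real \<Rightarrow> (real \<Rightarrow> ennreal) \<Rightarrow> real \<Rightarrow> ennreal" where
  "cell_avg d s = rel_avg d (\<lambda>x y. cell d (y + s) = cell d (x + s))"

lemma cell_avg_measurable[measurable]:
  assumes [measurable]: "(\<lambda>(a, b). F a b) \<in> borel_measurable (N \<Otimes>\<^sub>M borel)"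
    and [measurable]: "g \<in> N' \<rightarrow>\<^sub>M N" "k \<in> N' \<rightarrow>\<^sub>M borel"
  shows "(\<lambda>z. cell_avg d s (F (g z)) (k z)) \<in> borel_measurable N'"
  unfolding cell_avg_def rel_avg_def by measurable

lemma cell_avg_cong_cell: "cell d (x + s) = cell d (y + s) \<Longrightarrow> cell_avg d s f x = cell_avg d s f y"
  by (simp add: cell_avg_def rel_avg_def)

lemma cell_avg_le: "0 < d \<Longrightarrow> (\<And>y. f y \<le> c) \<Longrightarrow> cell_avg d s f x \<le> c"
  unfolding cell_avg_def by (intro rel_avg_le) (auto simp: emeasure_cell)

lemma nn_integral_cell_avg_mult:
  assumes d: "0 < d" and [measurable]: "f \<in> borel_measurable borel" "W \<in> borel_measurable borel"
    and W: "\<And>x y. cell d (x + s) = cell d (y + s) \<Longrightarrow> W x = W y"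
  shows "(\<integral>\<^sup>+x. cell_avg d s f x * W x \<partial>lborel) = (\<integral>\<^sup>+x. f x * W x \<partial>lborel)"
proof -
  have "cell_avg d s W x = W x" for x
    unfolding cell_avg_def using d by (intro rel_avg_eq_self) (auto simp: emeasure_cell intro: W)
  moreover have "(\<integral>\<^sup>+x. W x * cell_avg d s f x \<partial>lborel) = (\<integral>\<^sup>+x. f x * cell_avg d s W x \<partial>lborel)"
    unfolding cell_avg_def by (rule rel_avg_symmetric) auto
  ultimately show ?thesis by (simp add: mult.commute)
qed

lemma nn_integral_cell_avg:
  assumes "0 < d" and "f \<in> borel_measurable borel"
  shows "(\<integral>\<^sup>+x. cell_avg d s f x \<partial>lborel) = (\<integral>\<^sup>+x. f x \<partial>lborel)"
  using nn_integral_cell_avg_mult[OF assms, of "\<lambda>_. 1"] by simp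

lemma window_avg_le_cell_avgs:
  assumes l: "0 < l" and r: "0 < r" "6 * r \<le> l / 2 ^ n" "l / 2 ^ n \<le> 12 * r"
    and [measurable]: "f \<in> borel_measurable borel"
  shows "window_avg r f b \<le> 6 * (cell_avg (l / 2 ^ n) 0 f b + cell_avg (l / 2 ^ n) (l / 3) f b)"
proof -
  let ?d = "l / 2 ^ n"
  obtain s where shift: "s \<in> {0, l / 3}" "\<And>x. \<bar>x - b\<bar> < r \<Longrightarrow> cell ?d (x + s) = cell ?d (b + s)"
    using ball_in_shifted_dyadic_cell[OF l r(1,2), of b] by blast
  have "window_avg r f b
      \<le> ennreal (6 * (1 / ?d)) * (\<integral>\<^sup>+y. (if cell ?d (y + s) = cell ?d (b + s) then f y else 0) \<partial>lborel)"
    unfolding window_avg_eq[OF r(1)]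
  proof (intro mult_mono nn_integral_mono ennreal_leI)
    show "1 / (2 * r) \<le> 6 * (1 / ?d)" using r l by (simp add: field_simps)
  qed (auto dest: shift(2))
  also have "\<dots> = 6 * cell_avg ?d s f b"
    using l by (subst ennreal_mult')
      (simp_all add: cell_avg_def rel_avg_def ennreal_divide_eq_mult mult.assoc)
  also have "\<dots> \<le> 6 * (cell_avg ?d 0 f b + cell_avg ?d (l / 3) f b)"
    using shift(1) by (intro mult_left_mono) auto
  finally show ?thesis .
qed

section \<open>Averages in the plane\<close>

abbreviation plane :: "(real \<times> real) measure" where
  "plane \<equiv> lborel \<Otimes>\<^sub>M lborel"

lemma nn_integral_plane:
  fixes F :: "real \<times> real \<Rightarrow> ennreal"
  assumes "F \<in> borel_measurable (borel \<Otimes>\<^sub>M borel)"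
  shows "(\<integral>\<^sup>+z. F z \<partial>plane) = (\<integral>\<^sup>+a. \<integral>\<^sup>+b. F (a, b) \<partial>lborel \<partial>lborel)"
  by (rule lborel.nn_integral_fst[symmetric]) (use assms in simp)

lemma nn_integral_plane_shear:
  fixes F :: "real \<times> real \<Rightarrow> ennreal"
  assumes [measurable]: "F \<in> borel_measurable (borel \<Otimes>\<^sub>M borel)"
  shows "(\<integral>\<^sup>+z. F z \<partial>plane) = (\<integral>\<^sup>+b. \<integral>\<^sup>+a. F (a, b + \<sigma> * a) \<partial>lborel \<partial>lborel)"
proof -
  have "(\<integral>\<^sup>+z. F z \<partial>plane) = (\<integral>\<^sup>+a. \<integral>\<^sup>+b. F (a, b + \<sigma> * a) \<partial>lborel \<partial>lborel)"
    unfolding nn_integral_plane[OF assms]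
    by (intro nn_integral_cong nn_integral_translate[symmetric]) measurable
  also have "\<dots> = (\<integral>\<^sup>+b. \<integral>\<^sup>+a. F (a, b + \<sigma> * a) \<partial>lborel \<partial>lborel)"
    by (rule lborel_pair.Fubini') measurable
  finally show ?thesis .
qed

definition vertical_avg :: "real \<Rightarrow> (real \<times> real \<Rightarrow> ennreal) \<Rightarrow> real \<times> real \<Rightarrow> ennreal" where
  "vertical_avg r F z = window_avg r (\<lambda>y. F (fst z, y)) (snd z)"

definition line_avg :: "real \<Rightarrow> real set \<Rightarrow> real \<Rightarrow> (real \<times> real \<Rightarrow> ennreal) \<Rightarrow> real \<times> real \<Rightarrow> ennreal" where
  "line_avg d S \<sigma> F z =
    rel_avg d (\<lambda>a a'. a \<in> S \<and> a' \<in> S) (\<lambda>a'. F (a', snd z + \<sigma> * (a' - fst z))) (fst z)"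

lemma vertical_avg_measurable[measurable]:
  assumes [measurable]: "F \<in> borel_measurable (borel \<Otimes>\<^sub>M borel)"
  shows "vertical_avg r F \<in> borel_measurable (borel \<Otimes>\<^sub>M borel)"
  unfolding vertical_avg_def window_avg_def rel_avg_def by measurable

lemma line_avg_measurable[measurable]:
  assumes [measurable]: "S \<in> sets borel" "F \<in> borel_measurable (borel \<Otimes>\<^sub>M borel)"
  shows "line_avg d S \<sigma> F \<in> borel_measurable (borel \<Otimes>\<^sub>M borel)"
  unfolding line_avg_def rel_avg_def by measurable

lemma vertical_avg_symmetric:
  assumes [measurable]: "F \<in> borel_measurable (borel \<Otimes>\<^sub>M borel)" "G \<in> borel_measurable (borel \<Otimes>\<^sub>M borel)"
  shows "(\<integral>\<^sup>+z. G z * vertical_avg r F z \<partial>plane) = (\<integral>\<^sup>+z. F z * vertical_avg r G z \<partial>plane)"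
proof -
  have "(\<integral>\<^sup>+b. G (a, b) * vertical_avg r F (a, b) \<partial>lborel)
      = (\<integral>\<^sup>+b. F (a, b) * vertical_avg r G (a, b) \<partial>lborel)" for a
    unfolding vertical_avg_def window_avg_def fst_conv snd_conv
    by (rule rel_avg_symmetric) (auto simp: abs_minus_commute)
  then show ?thesis by (simp add: nn_integral_plane)
qed

text \<open>After a shear the lines of slope \<open>\<sigma>\<close> become horizontal.\<close>
lemma line_avg_symmetric:
  assumes [measurable]: "S \<in> sets borel"
    "F \<in> borel_measurable (borel \<Otimes>\<^sub>M borel)" "G \<in> borel_measurable (borel \<Otimes>\<^sub>M borel)"
  shows "(\<integral>\<^sup>+z. G z * line_avg d S \<sigma> F z \<partial>plane) = (\<integral>\<^sup>+z. F z * line_avg d S \<sigma> G z \<partial>plane)"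
proof -
  have sheared: "line_avg d S \<sigma> H (a, b + \<sigma> * a)
      = rel_avg d (\<lambda>a a'. a \<in> S \<and> a' \<in> S) (\<lambda>a'. H (a', b + \<sigma> * a')) a"
    for H a b
    by (simp add: line_avg_def algebra_simps)
  have "(\<integral>\<^sup>+a. G (a, b + \<sigma> * a) * line_avg d S \<sigma> F (a, b + \<sigma> * a) \<partial>lborel)
      = (\<integral>\<^sup>+a. F (a, b + \<sigma> * a) * line_avg d S \<sigma> G (a, b + \<sigma> * a) \<partial>lborel)" for b
    unfolding sheared by (rule rel_avg_symmetric) auto
  then show ?thesis by (simp add: nn_integral_plane_shear[of _ \<sigma>])
qed

lemma vertical_avg_mono:
  "(\<And>y. F (fst z, y) \<le> G (fst z, y)) \<Longrightarrow> vertical_avg r F z \<le> vertical_avg r G z"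
  unfolding vertical_avg_def window_avg_def by (rule rel_avg_mono)

lemma line_avg_mono: "(\<And>z. F z \<le> G z) \<Longrightarrow> line_avg d S \<sigma> F z \<le> line_avg d S \<sigma> G z"
  unfolding line_avg_def by (rule rel_avg_mono)

lemma vertical_avg_const: "0 < r \<Longrightarrow> vertical_avg r (\<lambda>_. c) z = c"
  unfolding vertical_avg_def window_avg_def by (rule rel_avg_const) (auto simp: emeasure_window)

lemma vertical_avg_le: "0 < r \<Longrightarrow> (\<And>z. F z \<le> c) \<Longrightarrow> vertical_avg r F z \<le> c"
  using vertical_avg_mono[of F z "\<lambda>_. c" r] by (simp add: vertical_avg_const)

lemma line_avg_outside: "fst z \<notin> S \<Longrightarrow> line_avg d S \<sigma> F z = 0"
  unfolding line_avg_def by (rule rel_avg_zero) simp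

lemma line_avg_le:
  assumes "0 < d" and "S \<in> sets borel" and "emeasure lborel S = ennreal d" and "\<And>z. F z \<le> c"
  shows "line_avg d S \<sigma> F z \<le> c"
proof (cases "fst z \<in> S")
  case True
  then show ?thesis unfolding line_avg_def using assms by (intro rel_avg_le) auto
qed (simp add: line_avg_outside)

lemma nn_integral_vertical_avg:
  assumes "0 < r" and [measurable]: "F \<in> borel_measurable (borel \<Otimes>\<^sub>M borel)"
  shows "(\<integral>\<^sup>+z. vertical_avg r F z \<partial>plane) = (\<integral>\<^sup>+z. F z \<partial>plane)"
  using vertical_avg_symmetric[of F "\<lambda>_. 1" r] assms(1) by (simp add: vertical_avg_const)

lemma nn_integral_line_avg_le:
  assumes "0 < d" and [measurable]: "S \<in> sets borel" and "emeasure lborel S = ennreal d"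
    and [measurable]: "F \<in> borel_measurable (borel \<Otimes>\<^sub>M borel)"
  shows "(\<integral>\<^sup>+z. line_avg d S \<sigma> F z \<partial>plane) \<le> (\<integral>\<^sup>+z. F z \<partial>plane)"
proof -
  have "(\<integral>\<^sup>+z. 1 * line_avg d S \<sigma> F z \<partial>plane) = (\<integral>\<^sup>+z. F z * line_avg d S \<sigma> (\<lambda>_. 1) z \<partial>plane)"
    by (rule line_avg_symmetric) auto
  also have "\<dots> \<le> (\<integral>\<^sup>+z. F z * 1 \<partial>plane)"
    using assms by (intro nn_integral_mono mult_left_mono line_avg_le) auto
  finally show ?thesis by simp
qed

lemma vertical_avg_sum:
  assumes "\<And>i. F i \<in> borel_measurable (borel \<Otimes>\<^sub>M borel)"
  shows "vertical_avg r (\<lambda>z. \<Sum>i\<in>I. F i z) z = (\<Sum>i\<in>I. vertical_avg r (F i) z)"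
proof -
  have [measurable]: "F i \<in> borel_measurable (borel \<Otimes>\<^sub>M borel)" for i by fact
  show ?thesis unfolding vertical_avg_def window_avg_def by (rule rel_avg_sum) measurable
qed

lemma vertical_avg_SUP:
  assumes "incseq F" and [measurable]: "\<And>k::nat. F k \<in> borel_measurable (borel \<Otimes>\<^sub>M borel)"
  shows "vertical_avg r (\<lambda>z. SUP k. F k z) z = (SUP k. vertical_avg r (F k) z)"
  unfolding vertical_avg_def window_avg_def
  using assms(1) by (intro rel_avg_SUP) (auto simp: incseq_def le_fun_def)

lemma line_avg_SUP:
  assumes "incseq F" and [measurable]: "S \<in> sets borel" "\<And>k::nat. F k \<in> borel_measurable (borel \<Otimes>\<^sub>M borel)"
  shows "line_avg d S \<sigma> (\<lambda>z. SUP k. F k z) z = (SUP k. line_avg d S \<sigma> (F k) z)"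
  unfolding line_avg_def
  using assms(1) by (intro rel_avg_SUP) (auto simp: incseq_def le_fun_def)

lemma vertical_avg_zero: "(\<And>y. F (fst z, y) = 0) \<Longrightarrow> vertical_avg r F z = 0"
  unfolding vertical_avg_def window_avg_def by (rule rel_avg_zero)

lemma line_avg_along_line:
  assumes "a \<in> S" and "a' \<in> S"
  shows "line_avg d S \<sigma> F (a', b) = line_avg d S \<sigma> F (a, b - \<sigma> * (a' - a))"
  using assms by (simp add: line_avg_def rel_avg_def algebra_simps)

lemma vertical_avg_line_avg_along_line:
  assumes [measurable]: "S \<in> sets borel" "F \<in> borel_measurable (borel \<Otimes>\<^sub>M borel)" and "a \<in> S" "a' \<in> S"
  shows "vertical_avg r (line_avg d S \<sigma> F) (a', b) = vertical_avg r (line_avg d S \<sigma> F) (a, b - \<sigma> * (a' - a))"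
  using window_avg_translate[of "\<lambda>y. line_avg d S \<sigma> F (a, y)" r b "- \<sigma> * (a' - a)"]
  by (simp add: vertical_avg_def line_avg_along_line[OF assms(3,4)])

lemma line_avg_vertical_avg_le:
  assumes S: "emeasure lborel S = ennreal d" "0 < d" "S \<in> sets borel"
    and diam: "\<And>a'. a' \<in> S \<Longrightarrow> \<bar>a' - a\<bar> \<le> d" and "a \<in> S" and r: "0 < r"
    and [measurable]: "F \<in> borel_measurable (borel \<Otimes>\<^sub>M borel)"
    and line: "\<And>a' y. a' \<in> S \<Longrightarrow> F (a', y) = F (a, y - \<sigma> * (a' - a))"
  shows "line_avg d S \<sigma>' (vertical_avg r F) (a, b) \<le> 4 * vertical_avg (\<bar>\<sigma>' - \<sigma>\<bar> * d + r) F (a, b)"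
proof -
  have "vertical_avg r F (a', b + \<sigma>' * (a' - a)) = window_avg r (\<lambda>y. F (a, y)) (b + (\<sigma>' - \<sigma>) * (a' - a))"
    if "a' \<in> S" for a'
    using window_avg_translate[of "\<lambda>y. F (a, y)" r "b + \<sigma>' * (a' - a)" "- \<sigma> * (a' - a)"]
    by (simp add: vertical_avg_def line[OF that] algebra_simps)
  then have "line_avg d S \<sigma>' (vertical_avg r F) (a, b)
      = (\<integral>\<^sup>+a'. (if a' \<in> S then window_avg r (\<lambda>y. F (a, y)) (b + (\<sigma>' - \<sigma>) * (a' - a)) else 0) \<partial>lborel)
        / ennreal d"
    using \<open>a \<in> S\<close> by (simp add: line_avg_def rel_avg_def cong: if_cong)
  also have "\<dots> \<le> 4 * vertical_avg (\<bar>\<sigma>' - \<sigma>\<bar> * d + r) F (a, b)"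
    unfolding vertical_avg_def fst_conv snd_conv
    by (rule avg_slanted_window_avg_le[OF S(1,2) diam r S(3)]) measurable
  finally show ?thesis .
qed

definition column_cell_avg :: "real \<Rightarrow> real \<Rightarrow> (real \<times> real \<Rightarrow> ennreal) \<Rightarrow> real \<times> real \<Rightarrow> ennreal" where
  "column_cell_avg d s F z = cell_avg d s (\<lambda>y. F (fst z, y)) (snd z)"

lemma column_cell_avg_measurable[measurable]:
  assumes [measurable]: "F \<in> borel_measurable (borel \<Otimes>\<^sub>M borel)"
  shows "column_cell_avg d s F \<in> borel_measurable (borel \<Otimes>\<^sub>M borel)"
  unfolding column_cell_avg_def by measurable

lemma column_cell_avg_le: "0 < d \<Longrightarrow> (\<And>z. F z \<le> c) \<Longrightarrow> column_cell_avg d s F z \<le> c"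
  unfolding column_cell_avg_def by (rule cell_avg_le)

lemma column_cell_avg_cong_cell:
  "fst z = fst z' \<Longrightarrow> cell d (snd z + s) = cell d (snd z' + s)
      \<Longrightarrow> column_cell_avg d s F z = column_cell_avg d s F z'"
  unfolding column_cell_avg_def by (metis cell_avg_cong_cell)

lemma column_cell_avg_zero: "(\<And>y. F (fst z, y) = 0) \<Longrightarrow> column_cell_avg d s F z = 0"
  unfolding column_cell_avg_def cell_avg_def by (rule rel_avg_zero)

lemma nn_integral_column_cell_avg_mult:
  assumes d: "0 < d"
    and [measurable]: "F \<in> borel_measurable (borel \<Otimes>\<^sub>M borel)" "W \<in> borel_measurable (borel \<Otimes>\<^sub>M borel)"
    and W: "\<And>z z'. fst z = fst z' \<Longrightarrow> cell d (snd z + s) = cell d (snd z' + s) \<Longrightarrow> W z = W z'"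
  shows "(\<integral>\<^sup>+z. column_cell_avg d s F z * W z \<partial>plane) = (\<integral>\<^sup>+z. F z * W z \<partial>plane)"
proof -
  have "(\<integral>\<^sup>+b. cell_avg d s (\<lambda>y. F (a, y)) b * W (a, b) \<partial>lborel) = (\<integral>\<^sup>+b. F (a, b) * W (a, b) \<partial>lborel)" for a
    by (rule nn_integral_cell_avg_mult[OF d]) (auto intro: W)
  then show ?thesis by (simp add: nn_integral_plane column_cell_avg_def)
qed

lemma nn_integral_column_cell_avg:
  assumes "0 < d" and "F \<in> borel_measurable (borel \<Otimes>\<^sub>M borel)"
  shows "(\<integral>\<^sup>+z. column_cell_avg d s F z \<partial>plane) = (\<integral>\<^sup>+z. F z \<partial>plane)"
  using nn_integral_column_cell_avg_mult[OF assms, of "\<lambda>_. 1"] by simp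

definition dyadic_max :: "real \<Rightarrow> real \<Rightarrow> nat \<Rightarrow> (real \<times> real \<Rightarrow> ennreal) \<Rightarrow> real \<times> real \<Rightarrow> ennreal" where
  "dyadic_max l s N F z = (SUP n\<in>{..<N}. column_cell_avg (l / 2 ^ n) s F z)"

lemma dyadic_max_measurable[measurable]:
  assumes [measurable]: "F \<in> borel_measurable (borel \<Otimes>\<^sub>M borel)"
  shows "dyadic_max l s N F \<in> borel_measurable (borel \<Otimes>\<^sub>M borel)"
  unfolding dyadic_max_def by measurable

lemma column_cell_avg_le_dyadic_max: "n < N \<Longrightarrow> column_cell_avg (l / 2 ^ n) s F z \<le> dyadic_max l s N F z"
  unfolding dyadic_max_def by (auto intro!: SUP_upper2[of n])

lemma dyadic_max_restrict_columns:
  "dyadic_max l s N (\<lambda>z. if Q (fst z) then F z else 0) z = (if Q (fst z) then dyadic_max l s N F z else 0)"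
proof (cases "Q (fst z)")
  case True
  then show ?thesis by (simp add: dyadic_max_def column_cell_avg_def)
next
  case False
  then have "dyadic_max l s N (\<lambda>z. if Q (fst z) then F z else 0) z \<le> 0"
    unfolding dyadic_max_def by (intro SUP_least) (simp add: column_cell_avg_zero)
  then show ?thesis using False by simp
qed

lemma vertical_avg_le_dyadic_max:
  assumes \<kappa>: "0 < \<kappa>" and r: "0 < r" "6 * r \<le> \<kappa> / 2 ^ n" "\<kappa> / 2 ^ n \<le> 12 * r" and n: "n < N"
    and [measurable]: "F \<in> borel_measurable (borel \<Otimes>\<^sub>M borel)"
  shows "vertical_avg r F z \<le> 6 * (dyadic_max \<kappa> 0 N F z + dyadic_max \<kappa> (\<kappa> / 3) N F z)"
proof -
  have "vertical_avg r F z
      \<le> 6 * (column_cell_avg (\<kappa> / 2 ^ n) 0 F z + column_cell_avg (\<kappa> / 2 ^ n) (\<kappa> / 3) F z)"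
    unfolding vertical_avg_def column_cell_avg_def by (intro window_avg_le_cell_avgs \<kappa> r) measurable
  also have "\<dots> \<le> 6 * (dyadic_max \<kappa> 0 N F z + dyadic_max \<kappa> (\<kappa> / 3) N F z)"
    by (intro mult_left_mono add_mono column_cell_avg_le_dyadic_max n) simp
  finally show ?thesis .
qed

lemma adapted_averages_columns:
  fixes \<phi> :: "'j \<Rightarrow> real \<times> real \<Rightarrow> ennreal"
  assumes l: "0 < l" and "finite J"
    and [measurable]: "\<And>j. \<phi> j \<in> borel_measurable (borel \<Otimes>\<^sub>M borel)"
    and bounded: "\<And>j z. \<phi> j z \<le> ennreal K"
  shows "adapted_averages plane J (\<lambda>j z. enn2real (\<phi> j z))
    (\<lambda>j n z. enn2real (column_cell_avg (l / 2 ^ n) s (\<phi> j) z))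
    (\<lambda>n z z'. fst z = fst z' \<and> cell (l / 2 ^ n) (snd z + s) = cell (l / 2 ^ n) (snd z' + s))"
    (is "adapted_averages _ _ _ ?x ?E")
proof
  fix j n and W :: "real \<times> real \<Rightarrow> real"
  assume W: "W \<in> borel_measurable plane" "\<And>z. 0 \<le> W z" "\<And>z z'. ?E n z z' \<Longrightarrow> W z = W z'"
  have top: "\<phi> j z < top" "column_cell_avg (l / 2 ^ n) s (\<phi> j) z < top" for z
    using l le_less_trans[OF bounded[of j z] ennreal_less_top]
      le_less_trans[OF column_cell_avg_le[of _ "\<phi> j", OF _ bounded] ennreal_less_top] by simp_all
  have "(\<integral>\<^sup>+z. column_cell_avg (l / 2 ^ n) s (\<phi> j) z * ennreal (W z) \<partial>plane)
      = (\<integral>\<^sup>+z. \<phi> j z * ennreal (W z) \<partial>plane)"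
    using l W(1) by (intro nn_integral_column_cell_avg_mult) (auto intro!: W(3) arg_cong[where f = ennreal])
  then show "(\<integral>\<^sup>+z. ennreal (?x j n z * W z) \<partial>plane) \<le> (\<integral>\<^sup>+z. ennreal (enn2real (\<phi> j z) * W z) \<partial>plane)"
    using W(2) top by (simp add: ennreal_mult'')
next
  show "?x j n z = ?x j n z'" if "?E n z z'" for j n z z'
    using that column_cell_avg_cong_cell by metis
next
  show "?E m z z'" if "m \<le> n" "?E n z z'" for m n and z z' :: "real \<times> real"
    using that cell_dyadic_mono by blast
qed (use \<open>finite J\<close> in auto)

theorem sum_dyadic_max_ineq:
  fixes \<phi> :: "'j \<Rightarrow> real \<times> real \<Rightarrow> ennreal" and D :: nat
  assumes l: "0 < l" and J: "finite J"
    and \<phi>[measurable]: "\<And>j. \<phi> j \<in> borel_measurable (borel \<Otimes>\<^sub>M borel)"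
    and bounded: "\<And>j z. \<phi> j z \<le> ennreal K"
    and integrable: "\<And>j. j \<in> J \<Longrightarrow> (\<integral>\<^sup>+z. \<phi> j z \<partial>plane) < \<infinity>"
    and D: "0 < D" and sparse: "\<And>a. \<exists>A. finite A \<and> card A \<le> D \<and> (\<forall>j\<in>J - A. \<forall>b. \<phi> j (a, b) = 0)"
  shows "(\<integral>\<^sup>+z. (\<Sum>j\<in>J. dyadic_max l s N (\<phi> j) z)\<^sup>2 \<partial>plane)
     \<le> ennreal ((6 * (2 + ln D))\<^sup>2) * (\<integral>\<^sup>+z. (\<Sum>j\<in>J. \<phi> j z)\<^sup>2 \<partial>plane)"
proof -
  define X where "X j n = column_cell_avg (l / 2 ^ n) s (\<phi> j)" for j n
  have [measurable]: "X j n \<in> borel_measurable (borel \<Otimes>\<^sub>M borel)" for j n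
    unfolding X_def by measurable
  have X_le: "X j n z \<le> ennreal K" for j n z
    unfolding X_def using l by (intro column_cell_avg_le bounded) simp
  have enn2real_X: "ennreal (enn2real (X j n z)) = X j n z"
    and enn2real_\<phi>: "ennreal (enn2real (\<phi> j z)) = \<phi> j z" for j n z
    using le_less_trans[OF X_le ennreal_less_top] le_less_trans[OF bounded ennreal_less_top] by simp_all
  have square: "ennreal ((\<Sum>i\<in>I. y i)\<^sup>2) = (\<Sum>i\<in>I. ennreal (y i))\<^sup>2" if "\<And>i. 0 \<le> y i" for y and I :: "'i set"
    using that by (simp add: sum_nonneg sum_ennreal ennreal_power)
  interpret adapted_averages plane J "\<lambda>j z. enn2real (\<phi> j z)" "\<lambda>j n z. enn2real (X j n z)"
    "\<lambda>n z z'. fst z = fst z' \<and> cell (l / 2 ^ n) (snd z + s) = cell (l / 2 ^ n) (snd z' + s)"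
    unfolding X_def by (rule adapted_averages_columns[OF l J \<phi> bounded])
  have "(\<integral>\<^sup>+z. ennreal ((\<Sum>j\<in>J. runmax (\<lambda>n. enn2real (X j n z)) N)\<^sup>2) \<partial>plane)
     \<le> ennreal ((6 * (2 + ln D))\<^sup>2) * (\<integral>\<^sup>+z. ennreal ((\<Sum>j\<in>J. enn2real (\<phi> j z))\<^sup>2) \<partial>plane)"
  proof (rule sum_maximal_ineq[OF D])
    fix z :: "real \<times> real"
    obtain A where A: "finite A" "card A \<le> D" "\<forall>j\<in>J - A. \<forall>b. \<phi> j (fst z, b) = 0" using sparse by blast
    then have "\<forall>j\<in>J - A. \<forall>n. enn2real (X j n z) = 0" by (simp add: X_def column_cell_avg_zero)
    then show "\<exists>A. finite A \<and> card A \<le> D \<and> (\<forall>j\<in>J - A. \<forall>n. enn2real (X j n z) = 0)"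
      using A(1,2) by blast
  next
    have "(\<integral>\<^sup>+z. (\<Sum>p\<in>J \<times> {..<N}. X (fst p) (snd p) z)\<^sup>2 \<partial>plane) < \<infinity>"
      using J integrable l X_le
      by (intro nn_integral_sum_power2_finite) (auto simp: X_def nn_integral_column_cell_avg)
    then show "(\<integral>\<^sup>+z. ennreal ((\<Sum>j\<in>J. \<Sum>n<N. enn2real (X j n z))\<^sup>2) \<partial>plane) < \<infinity>"
      by (simp only: sum.cartesian_product case_prod_beta square enn2real_nonneg enn2real_X)
  qed
  moreover have "dyadic_max l s N (\<phi> j) z = ennreal (runmax (\<lambda>n. enn2real (X j n z)) N)" for j z
    unfolding ennreal_runmax enn2real_X by (simp add: dyadic_max_def X_def)
  ultimately show ?thesis
    by (simp only: square runmax_nonneg enn2real_nonneg enn2real_\<phi>)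
qed

section \<open>Generations of live tiles\<close>

text \<open>The coarsest cells of the grid have length \<open>l\<close> and \<open>s\<close> is its offset; a cell is live if its density is at
  least \<open>\<eta>\<close>, and \<open>D\<close> bounds the number of slope cells recorded above a point in one generation.\<close>
locale slope_field =
  fixes l w \<eta> s :: real and v :: "real \<Rightarrow> real" and D :: nat
  assumes l: "0 < l" and w: "0 < w" and \<eta>: "0 < \<eta>" "\<eta> \<le> 1"
    and v_measurable[measurable]: "v \<in> borel_measurable borel" and D_ge: "256 / \<eta>\<^sup>2 \<le> D"
begin

definition len :: "nat \<Rightarrow> real" where
  "len n = l / 2 ^ n"

definition base_cell :: "nat \<Rightarrow> real \<Rightarrow> int" where
  "base_cell n a = cell (len n) (a + s)"

text \<open>Slope cells become coarser as \<open>n\<close> grows: their length is reciprocal to that of the base cells.\<close>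
definition slope_cell :: "nat \<Rightarrow> real \<Rightarrow> int" where
  "slope_cell n \<sigma> = cell (w / len n) \<sigma>"

definition base :: "nat \<Rightarrow> int \<Rightarrow> real set" where
  "base n m = {a. base_cell n a = m}"

lemma len_pos: "0 < len n" and len_Suc: "len n = 2 * len (Suc n)"
  using l by (auto simp: len_def)

lemma len_antimono: "n \<le> n' \<Longrightarrow> len n' \<le> len n"
  using l by (auto simp: len_def intro!: divide_left_mono power_increasing)

lemma D_pos: "0 < D" and inverse_\<eta>_le_D: "1 / \<eta> \<le> D" and D_square_ge: "256 \<le> \<eta>\<^sup>2 * D"
proof -
  show "256 \<le> \<eta>\<^sup>2 * D" using D_ge \<eta> by (simp add: field_simps)
  then show "0 < D" by (cases D) auto
  have "1 / \<eta> \<le> 256 / \<eta>\<^sup>2"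
    using \<eta> by (intro frac_le) (auto simp: power2_eq_square mult_left_le)
  then show "1 / \<eta> \<le> D" using D_ge by linarith
qed

lemma base_cell_measurable[measurable]: "base_cell n \<in> borel \<rightarrow>\<^sub>M count_space UNIV"
  unfolding base_cell_def by measurable

lemma slope_cell_measurable[measurable]: "slope_cell n \<in> borel \<rightarrow>\<^sub>M count_space UNIV"
  unfolding slope_cell_def by measurable

lemma mem_base: "a \<in> base n m \<longleftrightarrow> base_cell n a = m"
  by (simp add: base_def)

lemma base_sets[measurable]: "base n m \<in> sets borel"
  unfolding base_def by measurable

lemma emeasure_base: "emeasure lborel (base n m) = ennreal (len n)"
  unfolding base_def base_cell_def by (rule emeasure_cell[OF len_pos])

lemma base_cell_mono: "k \<le> n \<Longrightarrow> base_cell n a = base_cell n a' \<Longrightarrow> base_cell k a = base_cell k a'"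
  unfolding base_cell_def len_def by (rule cell_dyadic_mono)

lemma base_cell_Suc_div: "base_cell (Suc n) a div 2 = base_cell n a"
  using cell_dyadic_div[of n "Suc n" l "a + s"] by (simp add: base_cell_def len_def)

lemma base_cell_dist_less: "base_cell n a = base_cell n a' \<Longrightarrow> \<bar>a - a'\<bar> < len n"
  using dist_less_if_cell_eq[OF len_pos, of n "a + s" "a' + s"] by (simp add: base_cell_def)

lemma base_cell_children:
  "base_cell n a = m \<longleftrightarrow> base_cell (Suc n) a = 2 * m \<or> base_cell (Suc n) a = 2 * m + 1"
  using base_cell_Suc_div[of n a] by presburger

lemma slope_cell_div: "n \<le> n' \<Longrightarrow> slope_cell n' \<sigma> = slope_cell n \<sigma> div 2 ^ (n' - n)"
  using cell_coarsen[of "n' - n" "w / len n" \<sigma>] l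
  by (simp add: slope_cell_def len_def power_diff mult.commute)

definition cell_measure :: "nat \<Rightarrow> int \<Rightarrow> (real \<Rightarrow> bool) \<Rightarrow> real" where
  "cell_measure n m P = measure lborel {a. base_cell n a = m \<and> P a}"

lemma cell_fmeasurable:
  assumes [measurable]: "Measurable.pred borel P"
  shows "{a. base_cell n a = m \<and> P a} \<in> fmeasurable lborel"
proof (rule fmeasurableI2)
  show "base n m \<in> fmeasurable lborel" by (rule fmeasurableI) (auto simp: emeasure_base)
qed (auto simp: mem_base)

lemma emeasure_cell_measure:
  "Measurable.pred borel P \<Longrightarrow> emeasure lborel {a. base_cell n a = m \<and> P a} = ennreal (cell_measure n m P)"
  unfolding cell_measure_def using cell_fmeasurable[of P n m] by (simp add: emeasure_eq_measure2)

lemma cell_measure_le: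
  assumes "Measurable.pred borel P"
  shows "cell_measure n m P \<le> len n"
proof -
  have "ennreal (cell_measure n m P) \<le> ennreal (len n)"
    unfolding emeasure_cell_measure[OF assms, symmetric] emeasure_base[of n m, symmetric]
    by (intro emeasure_mono) (auto simp: mem_base)
  then show ?thesis using len_pos[of n] by (simp add: ennreal_le_iff)
qed

lemma cell_measure_disjoint_union:
  assumes "Measurable.pred borel P" "Measurable.pred borel Q"
    and disjoint: "\<And>a. base_cell n a = m \<Longrightarrow> \<not> (P a \<and> Q a)"
  shows "cell_measure n m (\<lambda>a. P a \<or> Q a) = cell_measure n m P + cell_measure n m Q"
proof -
  have "{a. base_cell n a = m \<and> (P a \<or> Q a)}
      = {a. base_cell n a = m \<and> P a} \<union> {a. base_cell n a = m \<and> Q a}" by auto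
  then show ?thesis
    unfolding cell_measure_def
    using disjoint cell_fmeasurable[OF assms(1), of n m] cell_fmeasurable[OF assms(2), of n m]
    by (subst measure_Union[symmetric]) (auto simp: fmeasurableD fmeasurableD2)
qed

lemma cell_measure_children:
  assumes "Measurable.pred borel P"
  shows "cell_measure n m P = cell_measure (Suc n) (2 * m) P + cell_measure (Suc n) (2 * m + 1) P"
proof -
  have "{a. base_cell n a = m \<and> P a}
      = {a. base_cell (Suc n) a = 2 * m \<and> P a} \<union> {a. base_cell (Suc n) a = 2 * m + 1 \<and> P a}"
    using base_cell_children[of n _ m] by auto
  then show ?thesis
    unfolding cell_measure_def
    using cell_fmeasurable[OF assms, of "Suc n" "2 * m"] cell_fmeasurable[OF assms, of "Suc n" "2 * m + 1"]
    by (subst measure_Union[symmetric]) (auto simp: fmeasurableD fmeasurableD2)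
qed

definition live :: "nat \<Rightarrow> int \<Rightarrow> int \<Rightarrow> bool" where
  "live n m j \<longleftrightarrow> \<eta> * len n \<le> cell_measure n m (\<lambda>a. slope_cell n (v a) = j)"

lemma cell_measure_slopes:
  "finite J \<Longrightarrow> cell_measure n m (\<lambda>a. slope_cell n (v a) \<in> J)
      = (\<Sum>j\<in>J. cell_measure n m (\<lambda>a. slope_cell n (v a) = j))"
proof (induction J rule: finite_induct)
  case (insert j J)
  have "cell_measure n m (\<lambda>a. slope_cell n (v a) = j \<or> slope_cell n (v a) \<in> J)
      = cell_measure n m (\<lambda>a. slope_cell n (v a) = j) + cell_measure n m (\<lambda>a. slope_cell n (v a) \<in> J)"
    using insert.hyps by (intro cell_measure_disjoint_union) auto
  then show ?case using insert by simp
qed (simp add: cell_measure_def)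

lemma card_live_mult_le_measure:
  assumes "finite J" and "\<And>j. j \<in> J \<Longrightarrow> live n m j"
  shows "card J * (\<eta> * len n) \<le> cell_measure n m (\<lambda>a. slope_cell n (v a) \<in> J)"
  unfolding cell_measure_slopes[OF assms(1)] using assms(2) by (intro sum_bounded_below) (simp add: live_def)

lemma live_slope_exists:
  assumes "finite J" "J \<noteq> {}" and "card J * (\<eta> * len n) \<le> cell_measure n m (\<lambda>a. slope_cell n (v a) \<in> J)"
  shows "\<exists>j\<in>J. live n m j"
proof (rule ccontr)
  assume "\<not> ?thesis"
  then have "(\<Sum>j\<in>J. cell_measure n m (\<lambda>a. slope_cell n (v a) = j)) < (\<Sum>j\<in>J. \<eta> * len n)"
    using assms(1,2) by (intro sum_strict_mono) (auto simp: live_def not_le)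
  then show False using assms(3) by (simp add: cell_measure_slopes[OF assms(1)])
qed

lemma card_live_le:
  assumes "finite J" and "\<And>j. j \<in> J \<Longrightarrow> live n m j"
  shows "card J \<le> D"
proof -
  have "card J * \<eta> * len n \<le> 1 * len n"
    using card_live_mult_le_measure[OF assms] cell_measure_le[of "\<lambda>a. slope_cell n (v a) \<in> J" n m]
    by (simp add: mult_ac)
  then have "card J * \<eta> \<le> 1" using len_pos[of n] by (simp only: mult_le_cancel_right_pos)
  then have "card J \<le> 1 / \<eta>" using \<eta> by (simp add: pos_le_divide_eq)
  then show ?thesis using inverse_\<eta>_le_D by linarith
qed

lemma finite_live: "finite {j. live n m j}"
  by (rule finite_if_finite_subsets_card_bdd[of _ D, THEN conjunct1]) (auto intro!: card_live_le)

definition fresh_slopes :: "nat \<Rightarrow> int \<Rightarrow> (nat \<times> int) set \<Rightarrow> int set" where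
  "fresh_slopes n m A = {j. live n m j \<and> (\<forall>(n', j')\<in>A. j' div 2 ^ (n - n') \<noteq> j)}"

definition fresh_cells :: "nat \<Rightarrow> int \<Rightarrow> (nat \<times> int) set \<Rightarrow> (nat \<times> int) set" where
  "fresh_cells n m A = Pair n ` fresh_slopes n m A"

lemma live_fresh_slopes: "j \<in> fresh_slopes n m A \<Longrightarrow> live n m j"
  by (simp add: fresh_slopes_def)

lemma finite_fresh_slopes: "finite (fresh_slopes n m A)"
  by (rule finite_subset[OF _ finite_live[of n m]]) (auto simp: fresh_slopes_def)

lemma finite_fresh_cells: "finite (fresh_cells n m A)"
  by (simp add: fresh_cells_def finite_fresh_slopes)

lemma card_fresh_cells: "card (fresh_cells n m A) = card (fresh_slopes n m A)"
  unfolding fresh_cells_def by (rule card_image) (simp add: inj_on_def)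

lemma card_fresh_cells_le: "card (fresh_cells n m A) \<le> D"
  unfolding card_fresh_cells using finite_fresh_slopes live_fresh_slopes by (rule card_live_le)

text \<open>Descending from the coarsest cell, a base cell inherits the slope cells recorded by its parent
  and adds its live slope cells that contain no recorded one. As soon as more than \<open>D\<close> are recorded, a
  new generation starts with the live cells only.\<close>
primrec history :: "nat \<Rightarrow> int \<Rightarrow> nat \<times> (nat \<times> int) set" where
  "history 0 m = (0, fresh_cells 0 m {})"
| "history (Suc n) m =
    (let (g, A) = history n (m div 2); A' = A \<union> fresh_cells (Suc n) m A
     in if card A' \<le> D then (g, A') else (Suc g, fresh_cells (Suc n) m {}))"

abbreviation generation :: "nat \<Rightarrow> int \<Rightarrow> nat" where
  "generation n m \<equiv> fst (history n m)"

abbreviation recorded :: "nat \<Rightarrow> int \<Rightarrow> (nat \<times> int) set" where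
  "recorded n m \<equiv> snd (history n m)"

lemma history_Suc_cases:
  obtains
    (extend) "generation (Suc n) m = generation n (m div 2)"
      "recorded (Suc n) m = recorded n (m div 2) \<union> fresh_cells (Suc n) m (recorded n (m div 2))"
      "card (recorded (Suc n) m) \<le> D"
  | (restart) "generation (Suc n) m = Suc (generation n (m div 2))"
      "recorded (Suc n) m = fresh_cells (Suc n) m {}"
      "D < card (recorded n (m div 2) \<union> fresh_cells (Suc n) m (recorded n (m div 2)))"
  by (cases "card (recorded n (m div 2) \<union> fresh_cells (Suc n) m (recorded n (m div 2))) \<le> D")
    (auto simp: Let_def case_prod_beta)

declare history.simps(2)[simp del]

lemma finite_recorded: "finite (recorded n m)"
proof (induction n arbitrary: m)
  case (Suc n)
  then show ?case by (cases rule: history_Suc_cases[of n m]) (simp_all add: finite_fresh_cells)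
qed (simp add: finite_fresh_cells)

lemma card_recorded_le: "card (recorded n m) \<le> D"
proof (cases n)
  case (Suc k)
  then show ?thesis by (cases rule: history_Suc_cases[of k m]) (simp_all add: card_fresh_cells_le)
qed (simp add: card_fresh_cells_le)

lemma recorded_depth_le: "(n', j') \<in> recorded n m \<Longrightarrow> n' \<le> n"
proof (induction n arbitrary: m)
  case (Suc n)
  have fresh: "n' = Suc n" if "(n', j') \<in> fresh_cells (Suc n) m A" for A
    using that by (auto simp: fresh_cells_def fresh_slopes_def)
  show ?case
  proof (cases rule: history_Suc_cases[of n m])
    case extend
    then have "(n', j') \<in> recorded n (m div 2) \<or> n' = Suc n" using Suc.prems fresh by blast
    then show ?thesis using Suc.IH[of "m div 2"] by linarith
  next
    case restart
    have "n' = Suc n" using Suc.prems fresh unfolding restart(2) by blast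
    then show ?thesis by simp
  qed
qed (auto simp: fresh_cells_def fresh_slopes_def)

lemma live_contains_recorded:
  assumes "live n m j"
  shows "\<exists>(n', j')\<in>recorded n m. j' div 2 ^ (n - n') = j"
proof -
  have self: ?thesis if "(n, j) \<in> recorded n m" using that by (intro bexI[of _ "(n, j)"]) simp
  show ?thesis
  proof (cases n)
    case 0
    then show ?thesis using assms by (intro self) (auto simp: fresh_cells_def fresh_slopes_def)
  next
    case (Suc k)
    have fresh: "(n, j) \<in> fresh_cells n m A" if "\<not> (\<exists>(n', j')\<in>A. j' div 2 ^ (n - n') = j)" for A
      using assms that by (auto simp: fresh_cells_def fresh_slopes_def)
    show ?thesis
    proof (cases rule: history_Suc_cases[of k m])
      case extend
      then show ?thesis using fresh[of "recorded k (m div 2)"] self unfolding Suc by blast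
    next
      case restart
      then show ?thesis using fresh[of "{}"] self unfolding Suc by simp
    qed
  qed
qed

lemma generation_mono: "n \<le> n' \<Longrightarrow> generation n (base_cell n a) \<le> generation n' (base_cell n' a)"
proof (induction n' rule: dec_induct)
  case (step k)
  then show ?case
    by (cases rule: history_Suc_cases[of k "base_cell (Suc k) a"]) (simp_all add: base_cell_Suc_div)
qed simp

lemma recorded_mono:
  "n \<le> n' \<Longrightarrow> generation n (base_cell n a) = generation n' (base_cell n' a)
    \<Longrightarrow> recorded n (base_cell n a) \<subseteq> recorded n' (base_cell n' a)"
proof (induction n' rule: dec_induct)
  case (step k)
  have "generation n (base_cell n a) \<le> generation k (base_cell k a)" using step by (intro generation_mono)
  then show ?case
    using step by (cases rule: history_Suc_cases[of k "base_cell (Suc k) a"]) (auto simp: base_cell_Suc_div)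
qed simp

lemma recorded_in_column:
  "\<exists>A. finite A \<and> card A \<le> D \<and>
    (\<forall>n\<le>N. generation n (base_cell n a) = i \<longrightarrow> recorded n (base_cell n a) \<subseteq> A)"
proof (cases "\<exists>n\<le>N. generation n (base_cell n a) = i")
  case True
  define n where "n = (GREATEST n. n \<le> N \<and> generation n (base_cell n a) = i)"
  have generation_n: "generation n (base_cell n a) = i"
    using True GreatestI_nat[of "\<lambda>n. n \<le> N \<and> generation n (base_cell n a) = i" _ N] by (auto simp: n_def)
  have "k \<le> n" if "k \<le> N" "generation k (base_cell k a) = i" for k
    unfolding n_def using that by (intro Greatest_le_nat[of _ _ N]) auto
  then show ?thesis
    using generation_n recorded_mono finite_recorded card_recorded_le
    by (intro exI[of _ "recorded n (base_cell n a)"]) simp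
qed (auto intro!: exI[of _ "{}"])

definition covered :: "(nat \<times> int) set \<Rightarrow> real \<Rightarrow> bool" where
  "covered A a \<longleftrightarrow> (\<exists>(n, j)\<in>A. slope_cell n (v a) = j)"

lemma covered_measurable[measurable]: "finite A \<Longrightarrow> Measurable.pred borel (covered A)"
  unfolding covered_def case_prod_beta by (intro pred_intros_finite) auto

text \<open>Recording a new live slope cell raises the cardinality term by \<open>len n\<close>, but uses up fresh measure
  \<open>\<eta> * len n\<close>, so the potential does not increase. Hence few points can see a new generation.\<close>
definition potential :: "nat \<Rightarrow> int \<Rightarrow> (nat \<times> int) set \<Rightarrow> real" where
  "potential n m A = card A * len n + (len n - cell_measure n m (covered A)) / \<eta>"

lemma potential_ge_card: "finite A \<Longrightarrow> card A * len n \<le> potential n m A"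
  unfolding potential_def using cell_measure_le[OF covered_measurable] \<eta> by simp

lemma potential_nonneg: "finite A \<Longrightarrow> 0 \<le> potential n m A"
  using potential_ge_card[of A n m] len_pos[of n]
  by (meson less_imp_le mult_nonneg_nonneg of_nat_0_le_iff order_trans)

lemma potential_children:
  "finite A \<Longrightarrow> potential n m A = potential (Suc n) (2 * m) A + potential (Suc n) (2 * m + 1) A"
  using cell_measure_children[OF covered_measurable, of A n m]
  by (simp add: potential_def len_Suc[of n] add_divide_distrib diff_divide_distrib distrib_left)

lemma covered_measure_fresh:
  assumes A: "finite A" "\<forall>(n', j')\<in>A. n' \<le> n"
  shows "cell_measure n m (covered A) + card (fresh_cells n m A) * (\<eta> * len n)
    \<le> cell_measure n m (covered (A \<union> fresh_cells n m A))"
proof -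
  define J where "J = fresh_slopes n m A"
  have J: "finite J" "\<And>j. j \<in> J \<Longrightarrow> live n m j"
    unfolding J_def by (rule finite_fresh_slopes) (rule live_fresh_slopes)
  have "card (fresh_cells n m A) * (\<eta> * len n) \<le> cell_measure n m (\<lambda>a. slope_cell n (v a) \<in> J)"
    unfolding card_fresh_cells J_def[symmetric] using J by (rule card_live_mult_le_measure)
  then have "cell_measure n m (covered A) + card (fresh_cells n m A) * (\<eta> * len n)
      \<le> cell_measure n m (covered A) + cell_measure n m (\<lambda>a. slope_cell n (v a) \<in> J)"
    by simp
  also have "\<dots> = cell_measure n m (\<lambda>a. covered A a \<or> slope_cell n (v a) \<in> J)"
  proof (rule cell_measure_disjoint_union[symmetric])
    fix a
    have "slope_cell n (v a) = j' div 2 ^ (n - n')" if "(n', j') \<in> A" "slope_cell n' (v a) = j'" for n' j'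
      using that A(2) slope_cell_div[of n' n "v a"] by auto
    then show "\<not> (covered A a \<and> slope_cell n (v a) \<in> J)"
      by (fastforce simp: covered_def J_def fresh_slopes_def)
  qed (use A(1) J(1) in auto)
  also have "\<dots> = cell_measure n m (covered (A \<union> fresh_cells n m A))"
    by (rule arg_cong[where f = "cell_measure n m"]) (auto simp: fun_eq_iff covered_def J_def fresh_cells_def)
  finally show ?thesis .
qed

lemma potential_fresh_le:
  assumes "finite A" and "\<forall>(n', j')\<in>A. n' \<le> n"
  shows "potential n m (A \<union> fresh_cells n m A) \<le> potential n m A"
proof -
  let ?B = "fresh_cells n m A"
  have "(len n - cell_measure n m (covered (A \<union> ?B))) / \<eta>
      \<le> (len n - (cell_measure n m (covered A) + card ?B * (\<eta> * len n))) / \<eta>"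
    using covered_measure_fresh[OF assms, of m] \<eta> by (intro divide_right_mono) auto
  also have "\<dots> = (len n - cell_measure n m (covered A)) / \<eta> - card ?B * len n"
    using \<eta> by (simp add: field_simps)
  finally have "(len n - cell_measure n m (covered (A \<union> ?B))) / \<eta>
      \<le> (len n - cell_measure n m (covered A)) / \<eta> - card ?B * len n" .
  moreover have "card (A \<union> ?B) * len n \<le> (card A + card ?B) * len n"
    using card_Un_le[of A ?B] len_pos[of n] by (intro mult_right_mono) (auto simp flip: of_nat_add)
  ultimately show ?thesis by (simp add: potential_def algebra_simps)
qed

lemma potential_restart_le: "potential n m (fresh_cells n m {}) \<le> len n / \<eta>"
  using potential_fresh_le[of "{}" n m] by (simp add: potential_def covered_def cell_measure_def)

definition decay :: real where
  "decay = 1 / (\<eta> * D)"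

lemma decay_pos: "0 < decay"
  using \<eta> D_pos by (simp add: decay_def)

lemma D_mult_decay_power_le:
  assumes "2 \<le> t"
  shows "D * decay ^ t \<le> (1/4) ^ t"
proof -
  obtain k where t: "t = 2 + k" using assms le_Suc_ex by blast
  have "\<eta>\<^sup>2 * D \<le> \<eta> * D" using \<eta> by (simp add: power2_eq_square mult_left_le mult_right_mono)
  then have decay: "decay \<le> 1/4" unfolding decay_def using D_square_ge by (intro frac_le) auto
  have "D * decay\<^sup>2 = 1 / (\<eta>\<^sup>2 * D)" using \<eta> D_pos by (simp add: decay_def power2_eq_square)
  also have "\<dots> \<le> (1/4)\<^sup>2" using D_square_ge by (simp add: power2_eq_square pos_divide_le_eq)
  finally have "D * decay\<^sup>2 * decay ^ k \<le> (1/4)\<^sup>2 * (1/4) ^ k"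
    using decay decay_pos by (intro mult_mono power_mono) auto
  then show ?thesis unfolding t power_add by (simp only: mult.assoc)
qed

definition late :: "nat \<Rightarrow> nat \<Rightarrow> real \<Rightarrow> bool" where
  "late N i a \<longleftrightarrow> i \<le> generation N (base_cell N a)"

lemma late_measurable[measurable]: "Measurable.pred borel (late N i)"
  unfolding late_def by measurable

lemma late_measure_restart_le:
  assumes bound: "\<And>t. D * cell_measure n m (late N (Suc (generation n m + t)))
      \<le> decay ^ t * potential n m (recorded n m)"
    and restart: "recorded n m = fresh_cells n m {}"
  shows "cell_measure n m (late N (generation n m + t)) \<le> decay ^ t * len n"
proof (cases t)
  case 0
  then show ?thesis using cell_measure_le[OF late_measurable] by simp
next
  case (Suc k)
  have "D * cell_measure n m (late N (generation n m + t)) \<le> decay ^ k * potential n m (fresh_cells n m {})"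
    using bound[of k] restart by (simp add: Suc)
  also have "\<dots> \<le> decay ^ k * (len n / \<eta>)"
    using decay_pos by (intro mult_left_mono potential_restart_le) auto
  also have "\<dots> = D * (decay ^ t * len n)"
    using D_pos \<eta> by (simp add: Suc decay_def)
  finally show ?thesis using D_pos by (simp only: mult_le_cancel_left_pos of_nat_0_less_iff)
qed

lemma late_measure_child_le:
  assumes IH: "\<And>t. D * cell_measure (Suc n) m (late N (Suc (generation (Suc n) m + t)))
      \<le> decay ^ t * potential (Suc n) m (recorded (Suc n) m)"
  shows "D * cell_measure (Suc n) m (late N (Suc (generation n (m div 2) + t)))
      \<le> decay ^ t * potential (Suc n) m (recorded n (m div 2))"
proof -
  define g where "g = generation n (m div 2)"
  define A where "A = recorded n (m div 2)"
  define A' where "A' = A \<union> fresh_cells (Suc n) m A"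
  have A_finite_depths: "finite A" "finite A'" "\<forall>(n', j')\<in>A. n' \<le> Suc n"
    using recorded_depth_le[of _ _ n "m div 2"]
    by (auto simp: A_def A'_def finite_recorded finite_fresh_cells intro: le_SucI)
  have A'_le: "potential (Suc n) m A' \<le> potential (Suc n) m A"
    unfolding A'_def by (rule potential_fresh_le[OF A_finite_depths(1,3)])
  show ?thesis
  proof (cases rule: history_Suc_cases[of n m])
    case extend
    then have "D * cell_measure (Suc n) m (late N (Suc (g + t))) \<le> decay ^ t * potential (Suc n) m A'"
      using IH[of t] by (simp add: g_def A_def A'_def)
    also have "\<dots> \<le> decay ^ t * potential (Suc n) m A"
      using A'_le decay_pos by (intro mult_left_mono) auto
    finally show ?thesis by (simp add: g_def A_def)
  next
    case restart
    have "D * len (Suc n) \<le> card A' * len (Suc n)"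
      using restart(3) len_pos[of "Suc n"] by (intro mult_right_mono) (auto simp: A_def A'_def)
    then have many: "D * len (Suc n) \<le> potential (Suc n) m A"
      using potential_ge_card[OF A_finite_depths(2), of "Suc n" m] A'_le by linarith
    have "D * cell_measure (Suc n) m (late N (Suc (g + t))) \<le> D * (decay ^ t * len (Suc n))"
      using late_measure_restart_le[OF IH restart(2), of t] restart(1)
      by (intro mult_left_mono) (simp_all add: g_def)
    also have "\<dots> = decay ^ t * (D * len (Suc n))" by simp
    also have "\<dots> \<le> decay ^ t * potential (Suc n) m A"
      using many decay_pos by (intro mult_left_mono) auto
    finally show ?thesis by (simp add: g_def A_def)
  qed
qed

lemma late_measure_le:
  "n \<le> N \<Longrightarrow> D * cell_measure n m (late N (Suc (generation n m + t)))
      \<le> decay ^ t * potential n m (recorded n m)"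
proof (induction n arbitrary: m t rule: inc_induct)
  case base
  have "{a. base_cell N a = m \<and> late N (Suc (generation N m + t)) a} = {}"
    by (auto simp: late_def)
  then have "cell_measure N m (late N (Suc (generation N m + t))) = 0"
    by (simp only: cell_measure_def measure_empty)
  then show ?case using decay_pos potential_nonneg[OF finite_recorded] by simp
next
  case (step n)
  let ?P = "late N (Suc (generation n m + t))" and ?A = "recorded n m"
  have "D * cell_measure n m ?P
      = D * cell_measure (Suc n) (2 * m) ?P + D * cell_measure (Suc n) (2 * m + 1) ?P"
    by (subst cell_measure_children) (auto simp: distrib_left)
  also have "\<dots> \<le> decay ^ t * potential (Suc n) (2 * m) ?A + decay ^ t * potential (Suc n) (2 * m + 1) ?A"
    using late_measure_child_le[of n "2 * m" N t] late_measure_child_le[of n "2 * m + 1" N t] step.IH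
    by (intro add_mono) auto
  also have "\<dots> = decay ^ t * potential n m ?A"
    by (simp add: potential_children[OF finite_recorded, of n m n m] distrib_left)
  finally show ?case .
qed

definition cell_integral :: "nat \<Rightarrow> int \<Rightarrow> (real \<Rightarrow> ennreal) \<Rightarrow> ennreal" where
  "cell_integral n m F = (\<integral>\<^sup>+a. (if base_cell n a = m then F a else 0) \<partial>lborel)"

lemma cell_integral_children:
  assumes [measurable]: "F \<in> borel_measurable borel"
  shows "cell_integral n m F = cell_integral (Suc n) (2 * m) F + cell_integral (Suc n) (2 * m + 1) F"
proof -
  have "(if base_cell n a = m then F a else 0)
      = (if base_cell (Suc n) a = 2 * m then F a else 0)
        + (if base_cell (Suc n) a = 2 * m + 1 then F a else 0)" for a
    using base_cell_children[of n a m] by auto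
  then show ?thesis unfolding cell_integral_def by (simp add: nn_integral_add)
qed

lemma cell_integral_const_le:
  assumes "Measurable.pred borel P" and "\<And>a. base_cell n a = m \<Longrightarrow> F a \<le> (if P a then c else 0)"
  shows "cell_integral n m F \<le> c * ennreal (cell_measure n m P)"
proof -
  have "cell_integral n m F \<le> (\<integral>\<^sup>+a. c * indicator {a. base_cell n a = m \<and> P a} a \<partial>lborel)"
    unfolding cell_integral_def
  proof (rule nn_integral_mono)
    show "(if base_cell n a = m then F a else 0) \<le> c * indicator {a. base_cell n a = m \<and> P a} a" for a
      using assms(2)[of a] by (auto split: if_splits)
  qed
  also have "\<dots> = c * ennreal (cell_measure n m P)"
    using assms(1) by (simp add: nn_integral_cmult_indicator emeasure_cell_measure)
  finally show ?thesis .
qed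

lemma le_cell_integral_if_comparable:
  assumes [measurable]: "H \<in> borel_measurable borel"
    and comparable: "\<And>a'. base_cell n a' = m \<Longrightarrow> H a \<le> c * H a'"
  shows "H a * ennreal (len n) \<le> c * cell_integral n m H"
proof -
  have "H a * ennreal (len n) = (\<integral>\<^sup>+a'. H a * indicator (base n m) a' \<partial>lborel)"
    by (simp add: nn_integral_cmult_indicator emeasure_base)
  also have "\<dots> \<le> (\<integral>\<^sup>+a'. c * (if base_cell n a' = m then H a' else 0) \<partial>lborel)"
    using comparable by (intro nn_integral_mono) (auto simp: indicator_def mem_base)
  also have "\<dots> = c * cell_integral n m H"
    unfolding cell_integral_def by (rule nn_integral_cmult) measurable
  finally show ?thesis .
qed

lemma nn_integral_le_if_cell_integral_le:
  assumes [measurable]: "F \<in> borel_measurable borel" "H \<in> borel_measurable borel"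
    and cell_integral_le: "\<And>m. cell_integral 0 m F \<le> c * cell_integral 0 m H"
  shows "(\<integral>\<^sup>+a. F a \<partial>lborel) \<le> c * (\<integral>\<^sup>+a. H a \<partial>lborel)"
proof -
  have cell_avg: "cell_avg (len 0) s G x = cell_integral 0 (base_cell 0 x) G / ennreal (len 0)" for G x
    by (simp add: cell_avg_def rel_avg_def cell_integral_def base_cell_def)
  have "(\<integral>\<^sup>+a. F a \<partial>lborel) = (\<integral>\<^sup>+x. cell_avg (len 0) s F x \<partial>lborel)"
    by (rule nn_integral_cell_avg[OF len_pos, symmetric]) measurable
  also have "\<dots> \<le> (\<integral>\<^sup>+x. c * cell_avg (len 0) s H x \<partial>lborel)"
    unfolding cell_avg ennreal_times_divide
    by (intro nn_integral_mono divide_right_mono_ennreal cell_integral_le)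
  also have "\<dots> = c * (\<integral>\<^sup>+x. cell_avg (len 0) s H x \<partial>lborel)"
    by (rule nn_integral_cmult) (unfold cell_avg_def rel_avg_def, measurable)
  also have "(\<integral>\<^sup>+x. cell_avg (len 0) s H x \<partial>lborel) = (\<integral>\<^sup>+a. H a \<partial>lborel)"
    by (rule nn_integral_cell_avg[OF len_pos]) measurable
  finally show ?thesis .
qed

lemma late_cell_integral_restart_le:
  assumes [measurable]: "H \<in> borel_measurable borel" and c: "0 \<le> c"
    and n: "n \<le> N" and i: "generation n m = Suc i" and restart: "recorded n m = fresh_cells n m {}"
    and comparable: "\<And>a a'. base_cell n a = m \<Longrightarrow> base_cell n a' = m \<Longrightarrow> H a \<le> ennreal c * H a'"
  shows "cell_integral n m (\<lambda>a. if late N (Suc (i + t)) a then H a else 0)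
    \<le> ennreal (c * decay ^ t) * cell_integral n m H"
proof -
  let ?K = "ennreal c * cell_integral n m H / ennreal (len n)"
  have "H a \<le> ?K" if "base_cell n a = m" for a
  proof -
    have "H a * ennreal (len n) / ennreal (len n) \<le> ?K"
      using comparable[OF that] by (intro divide_right_mono_ennreal le_cell_integral_if_comparable) auto
    then show ?thesis using len_pos[of n] by (simp add: mult_divide_eq_ennreal)
  qed
  then have "cell_integral n m (\<lambda>a. if late N (Suc (i + t)) a then H a else 0)
      \<le> ?K * ennreal (cell_measure n m (late N (Suc (i + t))))"
    by (intro cell_integral_const_le) auto
  also have "\<dots> \<le> ?K * ennreal (decay ^ t * len n)"
    using late_measure_restart_le[OF late_measure_le[OF n] restart, of t] i
    by (intro mult_left_mono ennreal_leI) auto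
  also have "\<dots> = ennreal (1 / len n) * ennreal c * ennreal (decay ^ t * len n) * cell_integral n m H"
    by (simp add: ennreal_divide_eq_mult[OF len_pos] mult_ac)
  also have "ennreal (1 / len n) * ennreal c * ennreal (decay ^ t * len n) = ennreal (c * decay ^ t)"
    using len_pos[of n] decay_pos c by (simp flip: ennreal_mult')
  finally show ?thesis .
qed

lemma late_cell_integral_le:
  assumes H[measurable]: "H \<in> borel_measurable borel" and c: "0 \<le> c"
    and comparable: "\<And>n m a a'. generation n m = Suc i \<Longrightarrow> base_cell n a = m \<Longrightarrow> base_cell n a' = m \<Longrightarrow>
      H a \<le> ennreal c * H a'"
  shows "n \<le> N \<Longrightarrow> generation n m \<le> i \<Longrightarrow>
    cell_integral n m (\<lambda>a. if late N (Suc (i + t)) a then H a else 0)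
      \<le> ennreal (c * decay ^ t) * cell_integral n m H"
proof (induction n arbitrary: m rule: inc_induct)
  case base
  then have "cell_integral N m (\<lambda>a. if late N (Suc (i + t)) a then H a else 0)
      = (\<integral>\<^sup>+a. 0 \<partial>(lborel :: real measure))"
    unfolding cell_integral_def by (intro nn_integral_cong) (auto simp: late_def)
  then show ?case by simp
next
  case (step n)
  let ?F = "\<lambda>a. if late N (Suc (i + t)) a then H a else 0" and ?C = "ennreal (c * decay ^ t)"
  have child: "cell_integral (Suc n) m' ?F \<le> ?C * cell_integral (Suc n) m' H" if "m' div 2 = m" for m'
  proof (cases "generation (Suc n) m' \<le> i")
    case True
    then show ?thesis by (rule step.IH)
  next
    case False
    then have "generation (Suc n) m' = Suc i" "recorded (Suc n) m' = fresh_cells (Suc n) m' {}"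
      using that step.prems by (cases rule: history_Suc_cases[of n m']; simp)+
    then show ?thesis
      using step.hyps c comparable by (intro late_cell_integral_restart_le) auto
  qed
  have "cell_integral n m ?F = cell_integral (Suc n) (2 * m) ?F + cell_integral (Suc n) (2 * m + 1) ?F"
    by (rule cell_integral_children) measurable
  also have "\<dots> \<le> ?C * cell_integral (Suc n) (2 * m) H + ?C * cell_integral (Suc n) (2 * m + 1) H"
    by (intro add_mono child) auto
  also have "\<dots> = ?C * cell_integral n m H"
    by (simp only: cell_integral_children[OF H, of n m] distrib_left)
  finally show ?case .
qed

theorem late_integral_le:
  assumes [measurable]: "H \<in> borel_measurable borel" and "0 \<le> c"
    and "\<And>n m a a'. generation n m = Suc i \<Longrightarrow> base_cell n a = m \<Longrightarrow> base_cell n a' = m \<Longrightarrow>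
      H a \<le> ennreal c * H a'"
  shows "(\<integral>\<^sup>+a. (if late N (Suc (i + t)) a then H a else 0) \<partial>lborel)
    \<le> ennreal (c * decay ^ t) * (\<integral>\<^sup>+a. H a \<partial>lborel)"
proof (rule nn_integral_le_if_cell_integral_le)
  show "cell_integral 0 m (\<lambda>a. if late N (Suc (i + t)) a then H a else 0)
      \<le> ennreal (c * decay ^ t) * cell_integral 0 m H" for m
    by (rule late_cell_integral_le[OF assms(1,2)]) (auto intro: assms(3))
qed measurable

end

datatype tile = Tile (depth: nat) (position: int) (slope_index: int)

instance tile :: countable
  by countable_datatype

context slope_field
begin

definition cell_slope :: "nat \<times> int \<Rightarrow> real" where
  "cell_slope T = of_int (snd T) * (w / len (fst T))"

definition slope :: "tile \<Rightarrow> real" where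
  "slope P = cell_slope (depth P, slope_index P)"

definition tile_base :: "tile \<Rightarrow> real set" where
  "tile_base P = base (depth P) (position P)"

definition tile_avg :: "tile \<Rightarrow> (real \<times> real \<Rightarrow> ennreal) \<Rightarrow> real \<times> real \<Rightarrow> ennreal" where
  "tile_avg P = line_avg (len (depth P)) (tile_base P) (slope P)"

definition tile_generation :: "tile \<Rightarrow> nat" where
  "tile_generation P = generation (depth P) (position P)"

definition live_tiles :: "tile set" where
  "live_tiles = {P. live (depth P) (position P) (slope_index P)}"

definition recorded_cell :: "tile \<Rightarrow> nat \<times> int" where
  "recorded_cell P = (SOME T. T \<in> recorded (depth P) (position P)
      \<and> snd T div 2 ^ (depth P - fst T) = slope_index P)"

lemma mem_tile_base: "a \<in> tile_base P \<longleftrightarrow> base_cell (depth P) a = position P"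
  by (simp add: tile_base_def mem_base)

lemma tile_base_sets[measurable]: "tile_base P \<in> sets borel"
  unfolding tile_base_def by measurable

lemma emeasure_tile_base: "emeasure lborel (tile_base P) = ennreal (len (depth P))"
  by (simp add: tile_base_def emeasure_base)

lemma tile_avg_measurable[measurable]:
  "F \<in> borel_measurable (borel \<Otimes>\<^sub>M borel) \<Longrightarrow> tile_avg P F \<in> borel_measurable (borel \<Otimes>\<^sub>M borel)"
  unfolding tile_avg_def by measurable

lemma tile_avg_le: "(\<And>z. F z \<le> c) \<Longrightarrow> tile_avg P F z \<le> c"
  unfolding tile_avg_def by (intro line_avg_le len_pos tile_base_sets emeasure_tile_base)

lemma tile_avg_outside: "fst z \<notin> tile_base P \<Longrightarrow> tile_avg P F z = 0"
  unfolding tile_avg_def by (rule line_avg_outside)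

lemma nn_integral_tile_avg_le:
  "F \<in> borel_measurable (borel \<Otimes>\<^sub>M borel) \<Longrightarrow> (\<integral>\<^sup>+z. tile_avg P F z \<partial>plane) \<le> (\<integral>\<^sup>+z. F z \<partial>plane)"
  unfolding tile_avg_def by (intro nn_integral_line_avg_le len_pos tile_base_sets emeasure_tile_base)

lemma tile_avg_vertical_avg_symmetric:
  assumes [measurable]: "F \<in> borel_measurable (borel \<Otimes>\<^sub>M borel)" "G \<in> borel_measurable (borel \<Otimes>\<^sub>M borel)"
  shows "(\<integral>\<^sup>+z. G z * tile_avg P (vertical_avg r F) z \<partial>plane)
      = (\<integral>\<^sup>+z. F z * vertical_avg r (tile_avg P G) z \<partial>plane)"
proof -
  have "(\<integral>\<^sup>+z. G z * tile_avg P (vertical_avg r F) z \<partial>plane)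
      = (\<integral>\<^sup>+z. vertical_avg r F z * tile_avg P G z \<partial>plane)"
    unfolding tile_avg_def by (rule line_avg_symmetric) measurable
  also have "\<dots> = (\<integral>\<^sup>+z. tile_avg P G z * vertical_avg r F z \<partial>plane)"
    by (simp only: mult.commute)
  also have "\<dots> = (\<integral>\<^sup>+z. F z * vertical_avg r (tile_avg P G) z \<partial>plane)"
    by (rule vertical_avg_symmetric) measurable
  finally show ?thesis .
qed

lemma cell_slope_coarsen_near:
  assumes "n' \<le> n"
  shows "\<bar>cell_slope (n, j div 2 ^ (n - n')) - cell_slope (n', j)\<bar> \<le> w / len n"
proof -
  define k where "k = n - n'"
  have len: "w / len n' = w / len n / 2 ^ k"
    using assms l by (simp add: len_def k_def power_diff)
  have "j div 2 ^ k = \<lfloor>real_of_int j / 2 ^ k\<rfloor>"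
    using floor_divide_of_int_eq[of j "2 ^ k", where ?'a = real] by simp
  then have "\<bar>of_int (j div 2 ^ k) - real_of_int j / 2 ^ k\<bar> \<le> 1" by linarith
  then have "\<bar>of_int (j div 2 ^ k) - real_of_int j / 2 ^ k\<bar> * (w / len n) \<le> 1 * (w / len n)"
    using w len_pos[of n] by (intro mult_right_mono) auto
  moreover have "cell_slope (n, j div 2 ^ k) - cell_slope (n', j)
      = (of_int (j div 2 ^ k) - real_of_int j / 2 ^ k) * (w / len n)"
    unfolding cell_slope_def fst_conv snd_conv len
    by (simp add: left_diff_distrib right_diff_distrib diff_divide_distrib mult.commute)
  ultimately show ?thesis using w len_pos[of n] by (simp add: abs_mult k_def)
qed

lemma
  assumes "P \<in> live_tiles"
  shows recorded_cell_mem: "recorded_cell P \<in> recorded (depth P) (position P)"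
    and slope_near_recorded_cell: "\<bar>slope P - cell_slope (recorded_cell P)\<bar> \<le> w / len (depth P)"
proof -
  have "\<exists>T. T \<in> recorded (depth P) (position P) \<and> snd T div 2 ^ (depth P - fst T) = slope_index P"
    using live_contains_recorded[of "depth P" "position P" "slope_index P"] assms
    by (auto simp: live_tiles_def)
  from someI_ex[OF this] show T: "recorded_cell P \<in> recorded (depth P) (position P)"
    and "\<bar>slope P - cell_slope (recorded_cell P)\<bar> \<le> w / len (depth P)"
    using cell_slope_coarsen_near[of "fst (recorded_cell P)" "depth P" "snd (recorded_cell P)"]
      recorded_depth_le[of "fst (recorded_cell P)" "snd (recorded_cell P)" "depth P" "position P"]
    unfolding recorded_cell_def[symmetric] by (auto simp: slope_def)
qed

end

section \<open>The TT* argument\<close>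

locale tile_family = slope_field +
  fixes \<rho> K :: real and Ps :: "tile set" and g :: "tile \<Rightarrow> real \<times> real \<Rightarrow> ennreal"
  assumes \<rho>: "2 * w \<le> \<rho>" and finite_Ps: "finite Ps" and live: "Ps \<subseteq> live_tiles"
    and g_measurable[measurable]: "\<And>P. g P \<in> borel_measurable (borel \<Otimes>\<^sub>M borel)"
    and g_bounded: "\<And>P z. g P z \<le> ennreal K"
    and g_integrable: "\<And>P. P \<in> Ps \<Longrightarrow> (\<integral>\<^sup>+z. g P z \<partial>plane) < \<infinity>"
begin

definition dual :: "tile \<Rightarrow> real \<times> real \<Rightarrow> ennreal" where
  "dual P = vertical_avg \<rho> (tile_avg P (g P))"

definition dual_sum :: "real \<times> real \<Rightarrow> ennreal" where
  "dual_sum z = (\<Sum>P\<in>Ps. dual P z)"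

definition tile_group :: "nat \<Rightarrow> nat \<times> int \<Rightarrow> tile set" where
  "tile_group i T = {P \<in> Ps. tile_generation P = i \<and> recorded_cell P = T}"

definition group_dual :: "nat \<Rightarrow> nat \<times> int \<Rightarrow> real \<times> real \<Rightarrow> ennreal" where
  "group_dual i T z = (\<Sum>P\<in>tile_group i T. dual P z)"

definition generation_dual :: "nat \<Rightarrow> real \<times> real \<Rightarrow> ennreal" where
  "generation_dual i z = (\<Sum>T\<in>recorded_cell ` Ps. group_dual i T z)"

definition max_depth :: nat where
  "max_depth = Max (insert 0 (depth ` Ps))"

lemma \<rho>_pos: "0 < \<rho>" and w_less_\<rho>: "w < \<rho>"
  using \<rho> w by auto

lemma depth_le_max: "P \<in> Ps \<Longrightarrow> depth P \<le> max_depth"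
  using finite_Ps by (simp add: max_depth_def)

lemma dual_measurable[measurable]: "dual P \<in> borel_measurable (borel \<Otimes>\<^sub>M borel)"
  unfolding dual_def by measurable

lemma group_dual_measurable[measurable]: "group_dual i T \<in> borel_measurable (borel \<Otimes>\<^sub>M borel)"
  unfolding group_dual_def by measurable

lemma generation_dual_measurable[measurable]: "generation_dual i \<in> borel_measurable (borel \<Otimes>\<^sub>M borel)"
  unfolding generation_dual_def by measurable

lemma dual_sum_measurable[measurable]: "dual_sum \<in> borel_measurable (borel \<Otimes>\<^sub>M borel)"
  unfolding dual_sum_def by measurable

lemma dual_le: "dual P z \<le> ennreal K"
  unfolding dual_def by (intro vertical_avg_le tile_avg_le \<rho>_pos g_bounded)

lemma dual_integrable: "P \<in> Ps \<Longrightarrow> (\<integral>\<^sup>+z. dual P z \<partial>plane) < \<infinity>"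
  unfolding dual_def using g_integrable[of P] nn_integral_tile_avg_le[of "g P" P]
  by (subst nn_integral_vertical_avg) (auto simp: \<rho>_pos)

lemma dual_outside: "a \<notin> tile_base P \<Longrightarrow> dual P (a, b) = 0"
  unfolding dual_def by (intro vertical_avg_zero tile_avg_outside) simp

lemma dual_along_line:
  assumes "base_cell (depth P) a = base_cell (depth P) a'"
  shows "dual P (a', y) = dual P (a, y - slope P * (a' - a))"
proof (cases "a \<in> tile_base P")
  case True
  then show ?thesis
    using assms unfolding dual_def tile_avg_def
    by (intro vertical_avg_line_avg_along_line) (auto simp: mem_tile_base)
next
  case False
  then show ?thesis using assms by (simp add: dual_outside mem_tile_base)
qed

lemma group_dual_le: "group_dual i T z \<le> ennreal (card Ps * max 0 K)"
proof -
  have "group_dual i T z \<le> (\<Sum>P\<in>tile_group i T. ennreal (max 0 K))"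
    unfolding group_dual_def by (intro sum_mono order_trans[OF dual_le] ennreal_leI) simp
  also have "\<dots> \<le> (\<Sum>P\<in>Ps. ennreal (max 0 K))"
    by (rule sum_mono2[OF finite_Ps]) (auto simp: tile_group_def)
  finally show ?thesis by (simp add: ennreal_mult' ennreal_of_nat_eq_real_of_nat)
qed

lemma group_dual_integrable: "(\<integral>\<^sup>+z. group_dual i T z \<partial>plane) < \<infinity>"
  unfolding group_dual_def using dual_integrable
  by (subst nn_integral_sum) (auto simp: tile_group_def finite_Ps)

lemma dual_sum_square_integrable: "(\<integral>\<^sup>+z. (dual_sum z)\<^sup>2 \<partial>plane) < \<infinity>"
  unfolding dual_sum_def using finite_Ps dual_le dual_integrable
  by (intro nn_integral_sum_power2_finite[where K = K]) auto

lemma sum_by_groups: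
  "(\<Sum>P | P \<in> Ps \<and> tile_generation P \<in> X. f P)
    = (\<Sum>i\<in>tile_generation ` Ps \<inter> X. \<Sum>T\<in>recorded_cell ` Ps. \<Sum>P\<in>tile_group i T. f P)" (is "?lhs = _")
  for f :: "tile \<Rightarrow> ennreal"
proof -
  have "(\<Sum>T\<in>recorded_cell ` Ps. \<Sum>P\<in>tile_group i T. f P) = (\<Sum>P | P \<in> Ps \<and> tile_generation P = i. f P)" for i
  proof -
    have "(\<Sum>T\<in>recorded_cell ` Ps. \<Sum>P\<in>tile_group i T. f P)
        = (\<Sum>T\<in>recorded_cell ` Ps. \<Sum>P\<in>{P \<in> {P \<in> Ps. tile_generation P = i}. recorded_cell P = T}. f P)"
      by (intro sum.cong refl) (auto simp: tile_group_def)
    also have "\<dots> = (\<Sum>P | P \<in> Ps \<and> tile_generation P = i. f P)"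
      by (rule sum.group) (use finite_Ps in auto)
    finally show ?thesis .
  qed
  moreover have "?lhs = (\<Sum>i\<in>tile_generation ` Ps \<inter> X. \<Sum>P | P \<in> Ps \<and> tile_generation P = i. f P)"
  proof -
    have "?lhs = (\<Sum>i\<in>tile_generation ` Ps \<inter> X.
        \<Sum>P\<in>{P \<in> {P \<in> Ps. tile_generation P \<in> X}. tile_generation P = i}. f P)"
      by (rule sum.group[symmetric]) (use finite_Ps in auto)
    also have "\<dots> = (\<Sum>i\<in>tile_generation ` Ps \<inter> X. \<Sum>P | P \<in> Ps \<and> tile_generation P = i. f P)"
      by (intro sum.cong) auto
    finally show ?thesis .
  qed
  ultimately show ?thesis by simp
qed

lemma dual_sum_eq_generations: "dual_sum z = (\<Sum>i\<in>tile_generation ` Ps. generation_dual i z)"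
  using sum_by_groups[of "\<lambda>P. dual P z" UNIV] by (simp add: dual_sum_def generation_dual_def group_dual_def)

lemma sum_generation_dual_squares_le:
  "(\<Sum>i\<in>tile_generation ` Ps. \<integral>\<^sup>+z. (generation_dual i z)\<^sup>2 \<partial>plane) \<le> (\<integral>\<^sup>+z. (dual_sum z)\<^sup>2 \<partial>plane)"
proof -
  have "(\<Sum>i\<in>tile_generation ` Ps. \<integral>\<^sup>+z. (generation_dual i z)\<^sup>2 \<partial>plane)
      = (\<integral>\<^sup>+z. (\<Sum>i\<in>tile_generation ` Ps. (generation_dual i z)\<^sup>2) \<partial>plane)"
    by (rule nn_integral_sum[symmetric]) measurable
  also have "\<dots> \<le> (\<integral>\<^sup>+z. (dual_sum z)\<^sup>2 \<partial>plane)"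
    unfolding dual_sum_eq_generations using finite_Ps
    by (intro nn_integral_mono ennreal_sum_of_squares_le) auto
  finally show ?thesis .
qed

lemma few_groups_in_column:
  "\<exists>A. finite A \<and> card A \<le> D \<and> (\<forall>T\<in>recorded_cell ` Ps - A. \<forall>b. group_dual i T (a, b) = 0)"
proof -
  obtain A where A: "finite A" "card A \<le> D"
    "\<And>n. n \<le> max_depth \<Longrightarrow> generation n (base_cell n a) = i \<Longrightarrow> recorded n (base_cell n a) \<subseteq> A"
    using recorded_in_column[of max_depth a i] by blast
  have "dual P (a, b) = 0" if "P \<in> tile_group i T" "T \<notin> A" for P T b
  proof (rule dual_outside, rule notI)
    assume a: "a \<in> tile_base P"
    have P: "P \<in> Ps" "tile_generation P = i" "recorded_cell P = T" using that by (auto simp: tile_group_def)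
    have "recorded_cell P \<in> recorded (depth P) (base_cell (depth P) a)"
      using recorded_cell_mem[of P] P(1) live a by (auto simp: mem_tile_base)
    moreover have "recorded (depth P) (base_cell (depth P) a) \<subseteq> A"
      using P a depth_le_max by (intro A(3)) (auto simp: tile_generation_def mem_tile_base)
    ultimately show False using that P by blast
  qed
  then show ?thesis using A(1,2) by (intro exI[of _ A]) (simp add: group_dual_def)
qed

lemma dual_translate_le:
  assumes P: "P \<in> Ps" and same: "base_cell (depth P) a' = base_cell (depth P) a"
  defines "y \<equiv> cell_slope (recorded_cell P) * (a - a')"
  shows "dual P (a, b) \<le> dual P (a', b - y - w) + dual P (a', b - y + w)"
proof -
  define e where "e = (cell_slope (recorded_cell P) - slope P) * (a - a')"
  have "\<bar>e\<bar> \<le> w / len (depth P) * len (depth P)"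
    unfolding e_def abs_mult
    using slope_near_recorded_cell[of P] P live base_cell_dist_less[OF same] w len_pos[of "depth P"]
    by (intro mult_mono) (auto simp: abs_minus_commute)
  then have e_le: "\<bar>e\<bar> \<le> w" using len_pos[of "depth P"] by simp
  have "dual P (a, b) = dual P (a', b - slope P * (a - a'))"
    by (rule dual_along_line[OF same])
  also have "b - slope P * (a - a') = b - y + e" by (simp add: y_def e_def algebra_simps)
  also have "dual P (a', b - y + e) \<le> dual P (a', b - y - w) + dual P (a', b - y + w)"
    unfolding dual_def vertical_avg_def fst_conv snd_conv
    by (intro window_avg_perturb_le e_le w_less_\<rho>) measurable
  finally show ?thesis .
qed

lemma depth_le_if_later_generation:
  assumes "tile_generation P < generation n (base_cell n a)" and "a \<in> tile_base P"
  shows "depth P \<le> n"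
proof (rule ccontr)
  assume "\<not> depth P \<le> n"
  then have "generation n (base_cell n a) \<le> generation (depth P) (base_cell (depth P) a)"
    by (intro generation_mono) auto
  then show False using assms by (simp add: tile_generation_def mem_tile_base)
qed

text \<open>Within a base cell of a later generation all tiles of a group are constant along lines of nearly
  the same slope, so that the columns of the group are comparable up to a vertical translation.\<close>
lemma group_dual_translate_le:
  fixes T :: "nat \<times> int"
  assumes "generation n m = Suc i" and a: "base_cell n a = m" "base_cell n a' = m"
  defines "y \<equiv> cell_slope T * (a - a')"
  shows "group_dual i T (a, b) \<le> group_dual i T (a', b + (- y - w)) + group_dual i T (a', b + (- y + w))"
proof -
  have "dual P (a, b) \<le> dual P (a', b - y - w) + dual P (a', b - y + w)" if "P \<in> tile_group i T" for P
  proof (cases "a \<in> tile_base P")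
    case True
    have P: "P \<in> Ps" "tile_generation P = i" "recorded_cell P = T" using that by (auto simp: tile_group_def)
    then have "depth P \<le> n" using depth_le_if_later_generation[OF _ True, of n] assms(1) a by simp
    then have "base_cell (depth P) a' = base_cell (depth P) a"
      using base_cell_mono[of "depth P" n a' a] a by simp
    then show ?thesis using dual_translate_le[OF P(1)] by (simp add: y_def P(3))
  qed (simp add: dual_outside)
  then have "group_dual i T (a, b) \<le> (\<Sum>P\<in>tile_group i T. dual P (a', b - y - w) + dual P (a', b - y + w))"
    unfolding group_dual_def by (intro sum_mono)
  then show ?thesis by (simp add: group_dual_def sum.distrib algebra_simps)
qed

lemma group_dual_square_comparable:
  assumes "generation n m = Suc i" and "base_cell n a = m" "base_cell n a' = m"
  shows "(\<integral>\<^sup>+b. (group_dual i T (a, b))\<^sup>2 \<partial>lborel) \<le> 4 * (\<integral>\<^sup>+b. (group_dual i T (a', b))\<^sup>2 \<partial>lborel)"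
proof -
  define y where "y = cell_slope T * (a - a')"
  let ?J = "\<lambda>c. \<integral>\<^sup>+b. (group_dual i T (a', b + c))\<^sup>2 \<partial>lborel"
  have "(\<integral>\<^sup>+b. (group_dual i T (a, b))\<^sup>2 \<partial>lborel)
      \<le> (\<integral>\<^sup>+b. (group_dual i T (a', b + (- y - w)) + group_dual i T (a', b + (- y + w)))\<^sup>2 \<partial>lborel)"
    unfolding y_def by (intro nn_integral_mono power_mono group_dual_translate_le[OF assms]) simp
  also have "\<dots> \<le> 4 * ?J 0"
    using nn_integral_translate[of "\<lambda>b. (group_dual i T (a', b))\<^sup>2"]
    by (intro nn_integral_add_power2_le) simp_all
  finally show ?thesis by simp
qed

definition column_energy :: "nat \<Rightarrow> real \<Rightarrow> ennreal" where
  "column_energy i a = (\<integral>\<^sup>+b. (generation_dual i (a, b))\<^sup>2 \<partial>lborel)"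

lemma column_energy_measurable[measurable]: "column_energy i \<in> borel_measurable borel"
  unfolding column_energy_def by measurable

lemma nn_integral_column_energy:
  "(\<integral>\<^sup>+z. (if Q (fst z) then generation_dual i z else 0)\<^sup>2 \<partial>plane)
      = (\<integral>\<^sup>+a. (if Q a then column_energy i a else 0) \<partial>lborel)"
  if [measurable]: "Measurable.pred borel Q"
  by (subst nn_integral_plane) (auto simp: column_energy_def intro!: nn_integral_cong)

lemma column_energy_le_groups:
  "column_energy i a \<le> of_nat D * (\<Sum>T\<in>recorded_cell ` Ps. \<integral>\<^sup>+b. (group_dual i T (a, b))\<^sup>2 \<partial>lborel)"
proof -
  obtain A where A: "finite A" "card A \<le> D" "\<forall>T\<in>recorded_cell ` Ps - A. \<forall>b. group_dual i T (a, b) = 0"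
    using few_groups_in_column by blast
  let ?I = "recorded_cell ` Ps \<inter> A"
  have "(generation_dual i (a, b))\<^sup>2 \<le> of_nat D * (\<Sum>T\<in>recorded_cell ` Ps. (group_dual i T (a, b))\<^sup>2)" for b
  proof -
    have "generation_dual i (a, b) = (\<Sum>T\<in>?I. group_dual i T (a, b))"
      unfolding generation_dual_def using finite_Ps A(3) by (intro sum.mono_neutral_right) auto
    then have "(generation_dual i (a, b))\<^sup>2 \<le> of_nat (card ?I) * (\<Sum>T\<in>?I. (group_dual i T (a, b))\<^sup>2)"
      using ennreal_sum_power2_le[of ?I "\<lambda>T. group_dual i T (a, b)"] A(1) by simp
    also have "\<dots> \<le> of_nat D * (\<Sum>T\<in>recorded_cell ` Ps. (group_dual i T (a, b))\<^sup>2)"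
      using finite_Ps A card_mono[of A ?I] by (intro mult_mono sum_mono2) auto
    finally show ?thesis .
  qed
  then have "column_energy i a
      \<le> (\<integral>\<^sup>+b. of_nat D * (\<Sum>T\<in>recorded_cell ` Ps. (group_dual i T (a, b))\<^sup>2) \<partial>lborel)"
    unfolding column_energy_def by (rule nn_integral_mono)
  then show ?thesis by (simp add: nn_integral_cmult nn_integral_sum)
qed

lemma column_energy_comparable:
  assumes "generation n m = Suc i" and "base_cell n a = m" "base_cell n a' = m"
  shows "column_energy i a \<le> ennreal (4 * real D) * column_energy i a'"
proof -
  have "column_energy i a \<le> of_nat D
      * (\<Sum>T\<in>recorded_cell ` Ps. 4 * (\<integral>\<^sup>+b. (group_dual i T (a', b))\<^sup>2 \<partial>lborel))"
    by (rule order_trans[OF column_energy_le_groups])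
      (intro mult_left_mono sum_mono group_dual_square_comparable[OF assms], simp)
  also have "\<dots> = of_nat D * (4 * (\<integral>\<^sup>+b. (\<Sum>T\<in>recorded_cell ` Ps. (group_dual i T (a', b))\<^sup>2) \<partial>lborel))"
    by (simp add: nn_integral_sum sum_distrib_left)
  also have "\<dots> \<le> of_nat D * (4 * column_energy i a')"
    unfolding column_energy_def generation_dual_def using finite_Ps
    by (intro mult_left_mono nn_integral_mono ennreal_sum_of_squares_le) auto
  also have "\<dots> = ennreal (4 * real D) * column_energy i a'"
    by (simp add: ennreal_mult' ennreal_of_nat_eq_real_of_nat mult_ac)
  finally show ?thesis .
qed

lemma late_generation_dual_square_le:
  "(\<integral>\<^sup>+z. (if late max_depth (i + t) (fst z) then generation_dual i z else 0)\<^sup>2 \<partial>plane)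
    \<le> ennreal (16 * (1/4) ^ t) * (\<integral>\<^sup>+z. (generation_dual i z)\<^sup>2 \<partial>plane)"
proof (cases "3 \<le> t")
  case True
  then obtain k where t: "t = Suc k" and k: "2 \<le> k" by (cases t) auto
  have "(\<integral>\<^sup>+z. (if late max_depth (i + t) (fst z) then generation_dual i z else 0)\<^sup>2 \<partial>plane)
      = (\<integral>\<^sup>+a. (if late max_depth (Suc (i + k)) a then column_energy i a else 0) \<partial>lborel)"
    using nn_integral_column_energy[of "late max_depth (i + t)" i] by (simp add: t)
  also have "\<dots> \<le> ennreal (4 * real D * decay ^ k) * (\<integral>\<^sup>+a. column_energy i a \<partial>lborel)"
    by (rule late_integral_le[OF column_energy_measurable _ column_energy_comparable]) simp
  also have "\<dots> \<le> ennreal (16 * (1/4) ^ t) * (\<integral>\<^sup>+a. column_energy i a \<partial>lborel)"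
    using D_mult_decay_power_le[OF k] by (intro mult_right_mono ennreal_leI) (auto simp: t)
  also have "(\<integral>\<^sup>+a. column_energy i a \<partial>lborel) = (\<integral>\<^sup>+z. (generation_dual i z)\<^sup>2 \<partial>plane)"
    using nn_integral_column_energy[of "\<lambda>_. True" i] by simp
  finally show ?thesis .
next
  case False
  then have "t = 0 \<or> t = 1 \<or> t = 2" by auto
  then have one_le: "1 \<le> ennreal (16 * (1/4) ^ t)" by (auto simp: power2_eq_square simp flip: ennreal_1)
  have "(\<integral>\<^sup>+z. (if late max_depth (i + t) (fst z) then generation_dual i z else 0)\<^sup>2 \<partial>plane)
      \<le> 1 * (\<integral>\<^sup>+z. (generation_dual i z)\<^sup>2 \<partial>plane)"
    by (simp, intro nn_integral_mono) auto
  also have "\<dots> \<le> ennreal (16 * (1/4) ^ t) * (\<integral>\<^sup>+z. (generation_dual i z)\<^sup>2 \<partial>plane)"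
    by (intro mult_right_mono one_le) simp
  finally show ?thesis .
qed

end

definition tile_const :: "nat \<Rightarrow> real" where
  "tile_const D = 9216 * (2 + ln D)"

lemma tile_const_pos: "0 < D \<Longrightarrow> 0 < tile_const D"
  by (simp add: tile_const_def add_pos_nonneg)

context tile_family
begin

definition pair_radius :: "tile \<Rightarrow> nat \<times> int \<Rightarrow> real" where
  "pair_radius P' T = \<bar>slope P' - cell_slope T\<bar> * len (depth P') + \<rho> + w"

lemma pair_radius_pos: "0 < pair_radius P' T"
  using \<rho>_pos w len_pos[of "depth P'"] by (auto simp: pair_radius_def intro!: add_nonneg_pos)

lemma pair_radius_comparable:
  assumes P: "P \<in> Ps" and "depth P \<le> depth P'"
  defines "r \<equiv> \<bar>slope P' - slope P\<bar> * len (depth P') + \<rho>"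
  shows "r \<le> pair_radius P' (recorded_cell P)" and "pair_radius P' (recorded_cell P) \<le> 2 * r"
proof -
  let ?L = "len (depth P')" and ?\<sigma> = "cell_slope (recorded_cell P)"
  have L_pos: "0 < ?L" by (rule len_pos)
  have "w / len (depth P) \<le> w / ?L"
    using w L_pos assms(2) by (intro divide_left_mono len_antimono mult_pos_pos len_pos) auto
  then have "\<bar>slope P - ?\<sigma>\<bar> \<le> w / ?L" using slope_near_recorded_cell[of P] P live by fastforce
  then have near: "\<bar>slope P - ?\<sigma>\<bar> * ?L \<le> w" using L_pos by (simp add: pos_le_divide_eq)
  have "\<bar>slope P' - slope P\<bar> * ?L \<le> (\<bar>slope P' - ?\<sigma>\<bar> + \<bar>slope P - ?\<sigma>\<bar>) * ?L"
    and "\<bar>slope P' - ?\<sigma>\<bar> * ?L \<le> (\<bar>slope P' - slope P\<bar> + \<bar>slope P - ?\<sigma>\<bar>) * ?L"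
    using L_pos by (intro mult_right_mono; linarith)+
  moreover have "0 \<le> \<bar>slope P' - slope P\<bar> * ?L" using L_pos by simp
  ultimately show "r \<le> pair_radius P' (recorded_cell P)" "pair_radius P' (recorded_cell P) \<le> 2 * r"
    using near \<rho> by (simp_all add: r_def pair_radius_def distrib_right)
qed

text \<open>On its base \<open>dual P\<close> is constant along lines of slope \<open>slope P\<close>, so averaging it over a shorter
  tile amounts to a vertical average in a single column.\<close>
lemma tile_avg_dual_le:
  assumes P: "P \<in> Ps" and depths: "depth P \<le> depth P'" and a: "a \<in> tile_base P'"
  shows "tile_avg P' (vertical_avg \<rho> (dual P)) (a, b)
      \<le> 8 * vertical_avg (pair_radius P' (recorded_cell P)) (dual P) (a, b)"
proof -
  define r where "r = \<bar>slope P' - slope P\<bar> * len (depth P') + \<rho>"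
  have "tile_avg P' (vertical_avg \<rho> (dual P)) (a, b) \<le> 4 * vertical_avg r (dual P) (a, b)"
    unfolding tile_avg_def r_def
  proof (rule line_avg_vertical_avg_le
      [OF emeasure_tile_base len_pos tile_base_sets _ a \<rho>_pos dual_measurable])
    fix a' assume "a' \<in> tile_base P'"
    then have same: "base_cell (depth P') a = base_cell (depth P') a'" using a by (simp add: mem_tile_base)
    then show "\<bar>a' - a\<bar> \<le> len (depth P')" using base_cell_dist_less[of "depth P'" a' a] by simp
    show "dual P (a', y) = dual P (a, y - slope P * (a' - a))" for y
      by (rule dual_along_line[OF base_cell_mono[OF depths same]])
  qed
  also have "vertical_avg r (dual P) (a, b)
      \<le> 2 * vertical_avg (pair_radius P' (recorded_cell P)) (dual P) (a, b)"
    unfolding vertical_avg_def fst_conv snd_conv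
  proof (rule window_avg_le_double_radius)
    show "0 < r" using \<rho>_pos len_pos[of "depth P'"] by (simp add: r_def add_nonneg_pos)
  qed (use pair_radius_comparable[OF P depths] in \<open>simp_all add: r_def\<close>)
  finally show ?thesis by (simp add: mult_left_mono mult.assoc[symmetric])
qed

definition generation_max :: "real \<Rightarrow> nat \<Rightarrow> nat \<Rightarrow> real \<times> real \<Rightarrow> ennreal" where
  "generation_max \<kappa> N i z =
    (\<Sum>T\<in>recorded_cell ` Ps. dyadic_max \<kappa> 0 N (group_dual i T) z + dyadic_max \<kappa> (\<kappa> / 3) N (group_dual i T) z)"

definition late_generation_max :: "real \<Rightarrow> nat \<Rightarrow> nat \<Rightarrow> nat \<Rightarrow> real \<times> real \<Rightarrow> ennreal" where
  "late_generation_max \<kappa> N j i z = (if late max_depth j (fst z) then generation_max \<kappa> N i z else 0)"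

lemma late_generation_max_measurable[measurable]:
  "late_generation_max \<kappa> N j i \<in> borel_measurable (borel \<Otimes>\<^sub>M borel)"
  unfolding late_generation_max_def generation_max_def by measurable

lemma sum_tile_avg_dual_le_groups:
  assumes a: "a \<in> tile_base P'"
  shows "(\<Sum>P | P \<in> Ps \<and> depth P \<le> depth P'. tile_avg P' (vertical_avg \<rho> (dual P)) (a, b))
    \<le> 8 * (\<Sum>i\<in>tile_generation ` Ps \<inter> {..tile_generation P'}. \<Sum>T\<in>recorded_cell ` Ps.
        vertical_avg (pair_radius P' T) (group_dual i T) (a, b))"
proof -
  define V where "V P = vertical_avg (pair_radius P' (recorded_cell P)) (dual P) (a, b)" for P
  have V_group: "(\<Sum>P\<in>tile_group i T. V P) = vertical_avg (pair_radius P' T) (group_dual i T) (a, b)" for i T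
    unfolding group_dual_def by (subst vertical_avg_sum) (auto simp: V_def tile_group_def)
  have "tile_avg P' (vertical_avg \<rho> (dual P)) (a, b)
      \<le> 8 * (if tile_generation P \<le> tile_generation P' then V P else 0)"
    if P: "P \<in> Ps" "depth P \<le> depth P'" for P
  proof (cases "a \<in> tile_base P")
    case True
    then have "tile_generation P \<le> tile_generation P'"
      using generation_mono[OF P(2), of a] a by (simp add: tile_generation_def mem_tile_base)
    then show ?thesis using tile_avg_dual_le[OF P a] by (simp add: V_def)
  next
    case False
    then have "V P = 0" unfolding V_def by (intro vertical_avg_zero) (simp add: dual_outside)
    then show ?thesis using tile_avg_dual_le[OF P a, of b] by (simp add: V_def)
  qed
  then have "(\<Sum>P | P \<in> Ps \<and> depth P \<le> depth P'. tile_avg P' (vertical_avg \<rho> (dual P)) (a, b))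
      \<le> (\<Sum>P | P \<in> Ps \<and> depth P \<le> depth P'. 8 * (if tile_generation P \<le> tile_generation P' then V P else 0))"
    by (intro sum_mono) auto
  also have "\<dots> \<le> (\<Sum>P\<in>Ps. 8 * (if tile_generation P \<le> tile_generation P' then V P else 0))"
    using finite_Ps by (intro sum_mono2) auto
  also have "\<dots> = 8 * (\<Sum>P | P \<in> Ps \<and> tile_generation P \<in> {..tile_generation P'}. V P)"
    using finite_Ps by (simp add: sum.inter_filter sum_distrib_left)
  also have "\<dots> = 8 * (\<Sum>i\<in>tile_generation ` Ps \<inter> {..tile_generation P'}.
      \<Sum>T\<in>recorded_cell ` Ps. \<Sum>P\<in>tile_group i T. V P)"
    by (simp only: sum_by_groups)
  finally show ?thesis unfolding V_group .
qed

lemma sum_tile_avg_dual_le_max: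
  assumes P': "P' \<in> Ps" and \<kappa>: "0 < \<kappa>"
    and scale: "\<And>T. T \<in> recorded_cell ` Ps \<Longrightarrow>
      \<exists>k<N. 6 * pair_radius P' T \<le> \<kappa> / 2 ^ k \<and> \<kappa> / 2 ^ k \<le> 12 * pair_radius P' T"
  shows "(\<Sum>P | P \<in> Ps \<and> depth P \<le> depth P'. tile_avg P' (vertical_avg \<rho> (dual P)) z)
    \<le> 48 * (\<Sum>i\<in>tile_generation ` Ps \<inter> {..tile_generation P'}.
        late_generation_max \<kappa> N (tile_generation P') i z)"
proof (cases "fst z \<in> tile_base P'")
  case False
  then show ?thesis by (simp add: tile_avg_outside)
next
  case True
  obtain a b where z: "z = (a, b)" by (cases z)
  have a: "a \<in> tile_base P'" using True z by simp
  then have late: "late max_depth (tile_generation P') (fst z)"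
    using generation_mono[OF depth_le_max[OF P'], of a]
    by (simp add: late_def tile_generation_def mem_tile_base z)
  define M where "M i T = dyadic_max \<kappa> 0 N (group_dual i T) z
      + dyadic_max \<kappa> (\<kappa> / 3) N (group_dual i T) z" for i T
  have "vertical_avg (pair_radius P' T) (group_dual i T) z \<le> 6 * M i T" if "T \<in> recorded_cell ` Ps" for i T
    using scale[OF that] vertical_avg_le_dyadic_max[OF \<kappa> pair_radius_pos _ _ _ group_dual_measurable]
    unfolding M_def by blast
  then have "8 * (\<Sum>i\<in>tile_generation ` Ps \<inter> {..tile_generation P'}. \<Sum>T\<in>recorded_cell ` Ps.
        vertical_avg (pair_radius P' T) (group_dual i T) z)
      \<le> 8 * (\<Sum>i\<in>tile_generation ` Ps \<inter> {..tile_generation P'}. \<Sum>T\<in>recorded_cell ` Ps. 6 * M i T)"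
    by (intro mult_left_mono sum_mono) auto
  also have "\<dots> = 48 * (\<Sum>i\<in>tile_generation ` Ps \<inter> {..tile_generation P'}. \<Sum>T\<in>recorded_cell ` Ps. M i T)"
    by (simp add: mult.assoc[symmetric] flip: sum_distrib_left)
  also have "\<dots> = 48 * (\<Sum>i\<in>tile_generation ` Ps \<inter> {..tile_generation P'}.
      late_generation_max \<kappa> N (tile_generation P') i z)"
    using late by (simp add: late_generation_max_def generation_max_def M_def)
  finally show ?thesis
    using sum_tile_avg_dual_le_groups[OF a, of b] unfolding z by (rule order_trans[rotated])
qed

lemma late_dyadic_max_square_le:
  assumes \<kappa>: "0 < \<kappa>" and ij: "i \<le> j"
  shows "(\<integral>\<^sup>+z. (\<Sum>T\<in>recorded_cell ` Ps.
      if late max_depth j (fst z) then dyadic_max \<kappa> h N (group_dual i T) z else 0)\<^sup>2 \<partial>plane)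
    \<le> ennreal ((6 * (2 + ln D))\<^sup>2) * (ennreal (16 * (1/4) ^ (j - i)) * (\<integral>\<^sup>+z. (generation_dual i z)\<^sup>2 \<partial>plane))"
    (is "?lhs \<le> ennreal ?q * _")
proof -
  define F where "F T z = (if late max_depth j (fst z) then group_dual i T z else 0)" for T z
  have [measurable]: "F T \<in> borel_measurable (borel \<Otimes>\<^sub>M borel)" for T
    unfolding F_def by measurable
  have F_le: "F T z \<le> group_dual i T z" for T z by (simp add: F_def)
  have sum_F: "(\<Sum>T\<in>recorded_cell ` Ps. F T z)
      = (if late max_depth j (fst z) then generation_dual i z else 0)" for z
    by (simp add: F_def generation_dual_def)
  have "?lhs = (\<integral>\<^sup>+z. (\<Sum>T\<in>recorded_cell ` Ps. dyadic_max \<kappa> h N (F T) z)\<^sup>2 \<partial>plane)"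
    unfolding F_def dyadic_max_restrict_columns ..
  also have "\<dots> \<le> ennreal ?q * (\<integral>\<^sup>+z. (\<Sum>T\<in>recorded_cell ` Ps. F T z)\<^sup>2 \<partial>plane)"
  proof (rule sum_dyadic_max_ineq[OF \<kappa>])
    show "F T z \<le> ennreal (card Ps * max 0 K)" for T z
      by (rule order_trans[OF F_le group_dual_le])
    show "(\<integral>\<^sup>+z. F T z \<partial>plane) < \<infinity>" for T
      by (rule le_less_trans[OF nn_integral_mono[OF F_le] group_dual_integrable])
    show "\<exists>A. finite A \<and> card A \<le> D \<and> (\<forall>T\<in>recorded_cell ` Ps - A. \<forall>b. F T (a, b) = 0)" for a
      using few_groups_in_column[of i a] by (auto simp: F_def)
  qed (use finite_Ps D_pos in auto)
  also have "\<dots> \<le> ennreal ?q * (ennreal (16 * (1/4) ^ (j - i)) * (\<integral>\<^sup>+z. (generation_dual i z)\<^sup>2 \<partial>plane))"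
    unfolding sum_F using late_generation_dual_square_le[of i "j - i"] ij by (intro mult_left_mono) auto
  finally show ?thesis .
qed

lemma late_generation_max_square_le:
  assumes "0 < \<kappa>" and "i \<le> j"
  shows "(\<integral>\<^sup>+z. (late_generation_max \<kappa> N j i z)\<^sup>2 \<partial>plane)
    \<le> ennreal ((48 * (2 + ln D))\<^sup>2 * (1/4) ^ (j - i)) * (\<integral>\<^sup>+z. (generation_dual i z)\<^sup>2 \<partial>plane)"
proof -
  define q where "q = (6 * (2 + ln (real D)))\<^sup>2"
  have q_nonneg: "0 \<le> q" by (simp add: q_def)
  define V where "V h z = (\<Sum>T\<in>recorded_cell ` Ps.
    if late max_depth j (fst z) then dyadic_max \<kappa> h N (group_dual i T) z else 0)" for h z
  let ?I = "\<integral>\<^sup>+z. (generation_dual i z)\<^sup>2 \<partial>plane"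
  have [measurable]: "V h \<in> borel_measurable (borel \<Otimes>\<^sub>M borel)" for h
    unfolding V_def by measurable
  have "late_generation_max \<kappa> N j i z = V 0 z + V (\<kappa> / 3) z" for z
    by (simp add: V_def late_generation_max_def generation_max_def sum.distrib)
  then have "(\<integral>\<^sup>+z. (late_generation_max \<kappa> N j i z)\<^sup>2 \<partial>plane)
      \<le> 4 * (ennreal q * (ennreal (16 * (1/4) ^ (j - i)) * ?I))"
    using late_dyadic_max_square_le[OF assms, of 0 N] late_dyadic_max_square_le[OF assms, of "\<kappa> / 3" N]
      nn_integral_add_power2_le[of "V 0" plane "V (\<kappa> / 3)"]
    by (simp add: q_def V_def)
  also have "\<dots> = ennreal (4 * (q * (16 * (1/4) ^ (j - i)))) * ?I"
    by (simp only: ennreal_mult' ennreal_numeral zero_le_numeral q_nonneg mult.assoc)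
  also have "4 * (q * (16 * (1/4) ^ (j - i))) = (48 * (2 + ln D))\<^sup>2 * (1/4) ^ (j - i)"
    unfolding q_def by (simp only: power_mult_distrib) simp
  finally show ?thesis .
qed

lemma dual_product_integral:
  "(\<integral>\<^sup>+z. dual P' z * dual P z \<partial>plane) = (\<integral>\<^sup>+z. g P' z * tile_avg P' (vertical_avg \<rho> (dual P)) z \<partial>plane)"
  using tile_avg_vertical_avg_symmetric[of "dual P" "g P'" P' \<rho>] by (simp add: dual_def[of P'] mult.commute)

lemma dual_sum_square_le_ordered_pairs:
  "(dual_sum z)\<^sup>2 \<le> 2 * (\<Sum>P'\<in>Ps. \<Sum>P | P \<in> Ps \<and> depth P \<le> depth P'. dual P' z * dual P z)"
proof -
  let ?A = "\<Sum>P'\<in>Ps. \<Sum>P | P \<in> Ps \<and> depth P \<le> depth P'. dual P' z * dual P z"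
  have "(dual_sum z)\<^sup>2 = (\<Sum>P'\<in>Ps. \<Sum>P\<in>Ps. dual P' z * dual P z)"
    by (simp add: dual_sum_def power2_eq_square sum_product)
  also have "\<dots> \<le> (\<Sum>P'\<in>Ps. \<Sum>P\<in>Ps. (if depth P \<le> depth P' then dual P' z * dual P z else 0)
      + (if depth P' \<le> depth P then dual P z * dual P' z else 0))"
    by (intro sum_mono) (auto simp: mult.commute)
  also have "\<dots> = ?A + (\<Sum>P'\<in>Ps. \<Sum>P\<in>Ps. if depth P' \<le> depth P then dual P z * dual P' z else 0)"
    using finite_Ps by (simp add: sum.distrib sum.inter_filter)
  also have "(\<Sum>P'\<in>Ps. \<Sum>P\<in>Ps. if depth P' \<le> depth P then dual P z * dual P' z else 0) = ?A"
    using finite_Ps by (subst sum.swap) (simp add: sum.inter_filter)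
  finally show ?thesis by (simp add: mult_2)
qed

definition generation_sum :: "nat \<Rightarrow> real \<times> real \<Rightarrow> ennreal" where
  "generation_sum j z = (\<Sum>P | P \<in> Ps \<and> tile_generation P = j. g P z)"

lemma generation_sum_measurable[measurable]: "generation_sum j \<in> borel_measurable (borel \<Otimes>\<^sub>M borel)"
  unfolding generation_sum_def by measurable

lemma sum_generation_sum_squares_le:
  "(\<Sum>j\<in>tile_generation ` Ps. \<integral>\<^sup>+z. (generation_sum j z)\<^sup>2 \<partial>plane) \<le> (\<integral>\<^sup>+z. (\<Sum>P\<in>Ps. g P z)\<^sup>2 \<partial>plane)"
proof -
  have sum: "(\<Sum>j\<in>tile_generation ` Ps. generation_sum j z) = (\<Sum>P\<in>Ps. g P z)" for z
    unfolding generation_sum_def by (rule sum.group) (use finite_Ps in auto)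
  have "(\<Sum>j\<in>tile_generation ` Ps. \<integral>\<^sup>+z. (generation_sum j z)\<^sup>2 \<partial>plane)
      = (\<integral>\<^sup>+z. (\<Sum>j\<in>tile_generation ` Ps. (generation_sum j z)\<^sup>2) \<partial>plane)"
    by (rule nn_integral_sum[symmetric]) measurable
  also have "\<dots> \<le> (\<integral>\<^sup>+z. (\<Sum>j\<in>tile_generation ` Ps. generation_sum j z)\<^sup>2 \<partial>plane)"
    using finite_Ps by (intro nn_integral_mono ennreal_sum_of_squares_le) auto
  finally show ?thesis unfolding sum .
qed

lemma sum_integral_by_generations:
  assumes [measurable]: "\<And>i j. S j i \<in> borel_measurable (borel \<Otimes>\<^sub>M borel)"
  shows "(\<Sum>P\<in>Ps. \<Sum>i\<in>I (tile_generation P). \<integral>\<^sup>+z. g P z * S (tile_generation P) i z \<partial>plane)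
    = (\<Sum>j\<in>tile_generation ` Ps. \<Sum>i\<in>I j. \<integral>\<^sup>+z. generation_sum j z * S j i z \<partial>plane)"
proof -
  have "(\<Sum>P | P \<in> Ps \<and> tile_generation P = j.
      \<Sum>i\<in>I (tile_generation P). \<integral>\<^sup>+z. g P z * S (tile_generation P) i z \<partial>plane)
      = (\<Sum>i\<in>I j. \<integral>\<^sup>+z. generation_sum j z * S j i z \<partial>plane)" for j
  proof -
    have "(\<Sum>P | P \<in> Ps \<and> tile_generation P = j.
        \<Sum>i\<in>I (tile_generation P). \<integral>\<^sup>+z. g P z * S (tile_generation P) i z \<partial>plane)
        = (\<Sum>P | P \<in> Ps \<and> tile_generation P = j. \<Sum>i\<in>I j. \<integral>\<^sup>+z. g P z * S j i z \<partial>plane)"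
      by (rule sum.cong[OF refl]) simp
    also have "\<dots> = (\<Sum>i\<in>I j. \<Sum>P | P \<in> Ps \<and> tile_generation P = j. \<integral>\<^sup>+z. g P z * S j i z \<partial>plane)"
      by (rule sum.swap)
    also have "\<dots> = (\<Sum>i\<in>I j. \<integral>\<^sup>+z. generation_sum j z * S j i z \<partial>plane)"
      by (simp add: generation_sum_def sum_distrib_right nn_integral_sum)
    finally show ?thesis .
  qed
  then show ?thesis
    using sum.group[of Ps "tile_generation ` Ps" tile_generation
        "\<lambda>P. \<Sum>i\<in>I (tile_generation P). \<integral>\<^sup>+z. g P z * S (tile_generation P) i z \<partial>plane"] finite_Ps by simp
qed

lemma dual_sum_square_integral_le_generations:
  obtains \<kappa> N where "0 < \<kappa>"
    "(\<integral>\<^sup>+z. (dual_sum z)\<^sup>2 \<partial>plane) \<le> 96 * (\<Sum>j\<in>tile_generation ` Ps. \<Sum>i\<in>tile_generation ` Ps \<inter> {..j}.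
      \<integral>\<^sup>+z. generation_sum j z * late_generation_max \<kappa> N j i z \<partial>plane)"
proof -
  let ?I = "tile_generation ` Ps" and ?gen = tile_generation
  obtain \<kappa> N where \<kappa>: "0 < \<kappa>" and scale: "\<And>p. p \<in> Ps \<times> recorded_cell ` Ps \<Longrightarrow>
      \<exists>k<N. 6 * pair_radius (fst p) (snd p) \<le> \<kappa> / 2 ^ k \<and> \<kappa> / 2 ^ k \<le> 12 * pair_radius (fst p) (snd p)"
    using dyadic_scales[of "Ps \<times> recorded_cell ` Ps" "\<lambda>p. pair_radius (fst p) (snd p)"]
      finite_Ps pair_radius_pos by auto
  let ?S = "late_generation_max \<kappa> N"
  have "(\<integral>\<^sup>+z. (dual_sum z)\<^sup>2 \<partial>plane)
      \<le> (\<integral>\<^sup>+z. 2 * (\<Sum>P'\<in>Ps. \<Sum>P | P \<in> Ps \<and> depth P \<le> depth P'. dual P' z * dual P z) \<partial>plane)"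
    by (intro nn_integral_mono dual_sum_square_le_ordered_pairs)
  also have "\<dots> = 2 * (\<Sum>P'\<in>Ps. \<integral>\<^sup>+z. g P' z
      * (\<Sum>P | P \<in> Ps \<and> depth P \<le> depth P'. tile_avg P' (vertical_avg \<rho> (dual P)) z) \<partial>plane)"
    by (simp add: nn_integral_cmult nn_integral_sum dual_product_integral sum_distrib_left)
  also have "\<dots> \<le> 2 * (\<Sum>P'\<in>Ps. \<integral>\<^sup>+z. g P' z * (48 * (\<Sum>i\<in>?I \<inter> {..?gen P'}. ?S (?gen P') i z)) \<partial>plane)"
    using scale by (intro mult_left_mono sum_mono nn_integral_mono sum_tile_avg_dual_le_max \<kappa>) force+
  also have "\<dots> = 96 * (\<Sum>P'\<in>Ps. \<Sum>i\<in>?I \<inter> {..?gen P'}. \<integral>\<^sup>+z. g P' z * ?S (?gen P') i z \<partial>plane)"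
  proof -
    have "(\<integral>\<^sup>+z. g P' z * (48 * (\<Sum>i\<in>?I \<inter> {..?gen P'}. ?S (?gen P') i z)) \<partial>plane)
      = 48 * (\<Sum>i\<in>?I \<inter> {..?gen P'}. \<integral>\<^sup>+z. g P' z * ?S (?gen P') i z \<partial>plane)" for P'
      by (simp add: mult.left_commute[of _ 48] sum_distrib_left nn_integral_cmult nn_integral_sum)
    then show ?thesis by (simp add: mult.assoc[symmetric] flip: sum_distrib_left)
  qed
  also have "\<dots> = 96 * (\<Sum>j\<in>?I. \<Sum>i\<in>?I \<inter> {..j}. \<integral>\<^sup>+z. generation_sum j z * ?S j i z \<partial>plane)"
    using sum_integral_by_generations[of ?S "\<lambda>j. ?I \<inter> {..j}"] by simp
  finally show thesis using that[OF \<kappa>] by blast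
qed

lemma generation_pair_integral_le:
  assumes \<kappa>: "0 < \<kappa>" and ij: "i \<le> j" and \<Lambda>: "0 < \<Lambda>"
  shows "2 * (\<integral>\<^sup>+z. generation_sum j z * late_generation_max \<kappa> N j i z \<partial>plane)
    \<le> ennreal ((1/2) ^ (j - i)) * (ennreal ((48 * (2 + ln D))\<^sup>2 / \<Lambda>) * (\<integral>\<^sup>+z. (generation_dual i z)\<^sup>2 \<partial>plane)
      + ennreal \<Lambda> * (\<integral>\<^sup>+z. (generation_sum j z)\<^sup>2 \<partial>plane))"
proof -
  define t where "t = (1/2::real) ^ (j - i)"
  define q where "q = (48 * (2 + ln (real D)))\<^sup>2"
  let ?S = "late_generation_max \<kappa> N j i"
  let ?X = "\<integral>\<^sup>+z. (generation_dual i z)\<^sup>2 \<partial>plane" and ?Y = "\<integral>\<^sup>+z. (generation_sum j z)\<^sup>2 \<partial>plane"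
  have t: "0 < t" "(1/4) ^ (j - i) = t * t" by (simp_all add: t_def flip: power_mult_distrib)
  have "2 * (\<integral>\<^sup>+z. generation_sum j z * ?S z \<partial>plane) = (\<integral>\<^sup>+z. 2 * (generation_sum j z * ?S z) \<partial>plane)"
    by (simp add: nn_integral_cmult)
  also have "\<dots> \<le> (\<integral>\<^sup>+z. ennreal (\<Lambda> * t) * (generation_sum j z)\<^sup>2 + ennreal (1 / (\<Lambda> * t)) * (?S z)\<^sup>2 \<partial>plane)"
    using \<Lambda> t by (intro nn_integral_mono ennreal_two_mult_le_weighted_squares) simp
  also have "\<dots> = ennreal (\<Lambda> * t) * ?Y + ennreal (1 / (\<Lambda> * t)) * (\<integral>\<^sup>+z. (?S z)\<^sup>2 \<partial>plane)"
    by (simp add: nn_integral_add nn_integral_cmult)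
  also have "\<dots> \<le> ennreal (\<Lambda> * t) * ?Y + ennreal (1 / (\<Lambda> * t)) * (ennreal (q * (t * t)) * ?X)"
    unfolding t(2)[symmetric] q_def
    by (intro add_left_mono mult_left_mono late_generation_max_square_le \<kappa> ij) simp
  also have "ennreal (1 / (\<Lambda> * t)) * (ennreal (q * (t * t)) * ?X) = ennreal (t * (q / \<Lambda>)) * ?X"
  proof -
    have "ennreal (1 / (\<Lambda> * t)) * ennreal (q * (t * t)) = ennreal (1 / (\<Lambda> * t) * (q * (t * t)))"
      using \<Lambda> t(1) by (intro ennreal_mult'[symmetric]) simp
    also have "1 / (\<Lambda> * t) * (q * (t * t)) = t * (q / \<Lambda>)" using \<Lambda> t(1) by simp
    finally show ?thesis by (simp only: mult.assoc[symmetric])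
  qed
  also have "ennreal (\<Lambda> * t) * ?Y + ennreal (t * (q / \<Lambda>)) * ?X
      = ennreal t * (ennreal (q / \<Lambda>) * ?X + ennreal \<Lambda> * ?Y)"
    using t(1)
    by (simp only: ennreal_mult'[OF less_imp_le] mult.commute[of \<Lambda> t] distrib_left mult.assoc add.commute)
  finally show ?thesis by (simp only: t_def q_def)
qed

theorem dual_sum_square_integral_le:
  "(\<integral>\<^sup>+z. (dual_sum z)\<^sup>2 \<partial>plane) \<le> ennreal ((tile_const D)\<^sup>2) * (\<integral>\<^sup>+z. (\<Sum>P\<in>Ps. g P z)\<^sup>2 \<partial>plane)"
proof -
  define q where "q = (48 * (2 + ln (real D)))\<^sup>2"
  let ?I = "tile_generation ` Ps"
  let ?X = "\<integral>\<^sup>+z. (dual_sum z)\<^sup>2 \<partial>plane" and ?Y = "\<integral>\<^sup>+z. (\<Sum>P\<in>Ps. g P z)\<^sup>2 \<partial>plane"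
  have q_pos: "0 < q" using tile_const_pos[OF D_pos] by (auto simp: q_def tile_const_def)
  then have \<Lambda>: "0 < 192 * q" by simp
  have I: "?I \<inter> {..j} = {i \<in> ?I. i \<le> j}" for j by auto
  obtain \<kappa> N where \<kappa>: "0 < \<kappa>" and X_le: "?X \<le> 96 * (\<Sum>j\<in>?I. \<Sum>i\<in>?I \<inter> {..j}.
      \<integral>\<^sup>+z. generation_sum j z * late_generation_max \<kappa> N j i z \<partial>plane)"
    by (rule dual_sum_square_integral_le_generations)
  note X_le
  also have "96 * (\<Sum>j\<in>?I. \<Sum>i\<in>?I \<inter> {..j}. \<integral>\<^sup>+z. generation_sum j z * late_generation_max \<kappa> N j i z \<partial>plane)
      = 48 * (\<Sum>j\<in>?I. \<Sum>i\<in>?I \<inter> {..j}. 2 * (\<integral>\<^sup>+z. generation_sum j z * late_generation_max \<kappa> N j i z \<partial>plane))"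
    by (simp add: mult.assoc[symmetric] flip: sum_distrib_left)
  also have "\<dots> \<le> 48 * (\<Sum>j\<in>?I. \<Sum>i\<in>?I \<inter> {..j}. ennreal ((1/2) ^ (j - i))
      * (ennreal (q / (192 * q)) * (\<integral>\<^sup>+z. (generation_dual i z)\<^sup>2 \<partial>plane)
        + ennreal (192 * q) * (\<integral>\<^sup>+z. (generation_sum j z)\<^sup>2 \<partial>plane)))"
    unfolding q_def[symmetric] using generation_pair_integral_le[OF \<kappa> _ \<Lambda>, of _ _ N]
    by (intro mult_left_mono sum_mono) (auto simp: q_def)
  also have "\<dots> \<le> 48 * (2 * ((\<Sum>i\<in>?I. ennreal (q / (192 * q)) * (\<integral>\<^sup>+z. (generation_dual i z)\<^sup>2 \<partial>plane))
      + (\<Sum>j\<in>?I. ennreal (192 * q) * (\<integral>\<^sup>+z. (generation_sum j z)\<^sup>2 \<partial>plane))))"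
    unfolding I using finite_Ps by (intro mult_left_mono sum_geometric_pairs_le) auto
  also have "\<dots> \<le> 48 * (2 * (ennreal (q / (192 * q)) * ?X + ennreal (192 * q) * ?Y))"
    unfolding sum_distrib_left[symmetric]
    by (intro mult_left_mono add_mono sum_generation_dual_squares_le sum_generation_sum_squares_le) auto
  also have "\<dots> = ennreal 96 * ennreal (192 * q) * ?Y + ennreal 96 * ennreal (q / (192 * q)) * ?X"
    by (simp add: distrib_left mult.assoc[symmetric] add.commute)
  also have "\<dots> = ennreal (18432 * q) * ?Y + ennreal (1 / 2) * ?X"
    using q_pos by (simp only: ennreal_mult'[symmetric] zero_le_numeral) simp
  finally have "?X \<le> 2 * (ennreal (18432 * q) * ?Y)"
    using dual_sum_square_integrable
    by (intro ennreal_le_twice_if_le_add_half) (auto simp: divide_ennreal_def mult.commute)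
  also have "\<dots> = ennreal (2 * (18432 * q)) * ?Y"
    using q_pos by (simp add: ennreal_mult' mult.assoc)
  also have "2 * (18432 * q) = (tile_const D)\<^sup>2"
    by (simp only: q_def tile_const_def power_mult_distrib) simp
  finally show ?thesis .
qed

end

section \<open>The tile maximal operator\<close>

lemma finite_SUP_linearization:
  fixes a :: "'i \<Rightarrow> 'a \<Rightarrow> ennreal"
  assumes "finite I" and a[measurable]: "\<And>i. a i \<in> borel_measurable M"
  shows "\<exists>g. (\<forall>i. g i \<in> borel_measurable M) \<and> (\<forall>z. (\<Sum>i\<in>I. g i z) = (SUP i\<in>I. a i z)) \<and>
    (\<forall>i z. g i z \<noteq> 0 \<longrightarrow> g i z = a i z \<and> a i z = (SUP i\<in>I. a i z))"
  using assms(1)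
proof (induction I rule: finite_induct)
  case empty
  show ?case by (intro exI[of _ "\<lambda>_ _. 0"]) (simp add: bot_ennreal)
next
  case (insert j I)
  then obtain g where g[measurable]: "\<And>i. g i \<in> borel_measurable M"
    and sum_g: "\<And>z. (\<Sum>i\<in>I. g i z) = (SUP i\<in>I. a i z)"
    and select: "\<And>i z. g i z \<noteq> 0 \<Longrightarrow> g i z = a i z \<and> a i z = (SUP i\<in>I. a i z)" by blast
  define s where "s z = (SUP i\<in>I. a i z)" for z
  define g' where "g' i z = (if i = j then (if s z < a j z then a j z else 0)
      else (if s z < a j z then 0 else g i z))" for i z
  have [measurable]: "s \<in> borel_measurable M" unfolding sum_g[symmetric] s_def by measurable
  have SUP_insert: "(SUP i\<in>insert j I. a i z) = (if s z < a j z then a j z else s z)" for z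
    by (auto simp: s_def sup_absorb1 sup_absorb2 not_less)
  show ?case
  proof (intro exI[of _ g'] conjI allI impI)
    show "g' i \<in> borel_measurable M" for i unfolding g'_def by measurable
    have "(\<Sum>i\<in>I. g' i z) = (\<Sum>i\<in>I. if s z < a j z then 0 else g i z)" for z
      using \<open>j \<notin> I\<close> by (intro sum.cong) (auto simp: g'_def)
    then have "(\<Sum>i\<in>I. g' i z) = (if s z < a j z then 0 else s z)" for z
      by (simp add: sum_g s_def)
    then show "(\<Sum>i\<in>insert j I. g' i z) = (SUP i\<in>insert j I. a i z)" for z
      unfolding SUP_insert using insert.hyps by (simp add: g'_def)
    show "g' i z = a i z" "a i z = (SUP i\<in>insert j I. a i z)" if "g' i z \<noteq> 0" for i z
      unfolding SUP_insert using that select[of i z] by (auto simp: g'_def s_def split: if_splits)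
  qed
qed

lemma (in tile_family) tile_avg_pairing_le:
  assumes [measurable]: "f \<in> borel_measurable (borel \<Otimes>\<^sub>M borel)"
  shows "(\<integral>\<^sup>+z. (\<Sum>P\<in>Ps. g P z * tile_avg P (vertical_avg \<rho> f) z) \<partial>plane)\<^sup>2
    \<le> ennreal ((tile_const D)\<^sup>2) * (\<integral>\<^sup>+z. (f z)\<^sup>2 \<partial>plane) * (\<integral>\<^sup>+z. (\<Sum>P\<in>Ps. g P z)\<^sup>2 \<partial>plane)"
    (is "?lhs\<^sup>2 \<le> _ * ?Y * ?X")
proof -
  have "?lhs = (\<integral>\<^sup>+z. f z * dual_sum z \<partial>plane)"
    by (simp add: nn_integral_sum tile_avg_vertical_avg_symmetric dual_sum_def dual_def sum_distrib_left)
  then have "?lhs\<^sup>2 \<le> ?Y * (\<integral>\<^sup>+z. (dual_sum z)\<^sup>2 \<partial>plane)"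
    by (simp add: Cauchy_Schwarz_nn_integral)
  also have "\<dots> \<le> ?Y * (ennreal ((tile_const D)\<^sup>2) * ?X)"
    by (intro mult_left_mono dual_sum_square_integral_le) simp
  finally show ?thesis by (simp only: mult_ac)
qed

lemma (in slope_field) finite_tile_max_ineq:
  fixes f :: "real \<times> real \<Rightarrow> ennreal"
  assumes r: "2 * w \<le> r" and Ps: "finite Ps" "Ps \<subseteq> live_tiles"
    and f[measurable]: "f \<in> borel_measurable (borel \<Otimes>\<^sub>M borel)"
    and f_bounded: "\<And>z. f z \<le> ennreal K" and f_integrable: "(\<integral>\<^sup>+z. f z \<partial>plane) < \<infinity>"
  shows "(\<integral>\<^sup>+z. (SUP P\<in>Ps. tile_avg P (vertical_avg r f) z)\<^sup>2 \<partial>plane)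
    \<le> ennreal ((tile_const D)\<^sup>2) * (\<integral>\<^sup>+z. (f z)\<^sup>2 \<partial>plane)"
proof -
  define a where "a P = tile_avg P (vertical_avg r f)" for P
  define h where "h z = (SUP P\<in>Ps. a P z)" for z
  have a_measurable[measurable]: "a P \<in> borel_measurable (borel \<Otimes>\<^sub>M borel)" for P
    unfolding a_def by measurable
  obtain g where [measurable]: "\<And>P. g P \<in> borel_measurable (borel \<Otimes>\<^sub>M borel)"
    and g_sum: "\<And>z. (\<Sum>P\<in>Ps. g P z) = h z"
    and g_select: "\<And>P z. g P z \<noteq> 0 \<Longrightarrow> g P z = a P z \<and> a P z = h z"
    using finite_SUP_linearization[OF Ps(1), of a, OF a_measurable] unfolding h_def by blast
  have r_pos: "0 < r" using r w by linarith
  have g_le: "g P z \<le> a P z" for P z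
    using g_select[of P z] by (cases "g P z = 0") auto
  have g_bounded: "g P z \<le> ennreal K" for P z
    by (rule order_trans[OF g_le]) (unfold a_def, intro tile_avg_le vertical_avg_le r_pos f_bounded)
  have "(\<integral>\<^sup>+z. a P z \<partial>plane) < \<infinity>" for P
    using nn_integral_tile_avg_le[of "vertical_avg r f" P] f_integrable
    by (simp add: a_def nn_integral_vertical_avg[OF r_pos f])
  then have g_integrable: "(\<integral>\<^sup>+z. g P z \<partial>plane) < \<infinity>" for P
    by (rule le_less_trans[OF nn_integral_mono[OF g_le]])
  interpret tile_family l w \<eta> s v D r K Ps g
    by unfold_locales (use r Ps g_bounded g_integrable in auto)
  have "(\<integral>\<^sup>+z. (h z)\<^sup>2 \<partial>plane) < top"
    using nn_integral_sum_power2_finite[OF Ps(1), of g plane K] g_bounded g_integrable by (simp add: g_sum)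
  moreover have "(\<Sum>P\<in>Ps. g P z * a P z) = (h z)\<^sup>2" for z
  proof -
    have "(\<Sum>P\<in>Ps. g P z * a P z) = (\<Sum>P\<in>Ps. g P z * h z)"
      using g_select by (intro sum.cong refl) (metis mult_zero_left)
    then show ?thesis by (simp add: g_sum power2_eq_square flip: sum_distrib_right)
  qed
  then have "(\<integral>\<^sup>+z. (h z)\<^sup>2 \<partial>plane)\<^sup>2
      \<le> ennreal ((tile_const D)\<^sup>2) * (\<integral>\<^sup>+z. (f z)\<^sup>2 \<partial>plane) * (\<integral>\<^sup>+z. (h z)\<^sup>2 \<partial>plane)"
    using tile_avg_pairing_le[OF f] by (simp add: g_sum flip: a_def)
  ultimately show ?thesis
    unfolding a_def[symmetric] h_def[symmetric] by (rule ennreal_le_if_square_le)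
qed

definition truncation :: "nat \<Rightarrow> (real \<times> real \<Rightarrow> ennreal) \<Rightarrow> real \<times> real \<Rightarrow> ennreal" where
  "truncation k f z = (if \<bar>fst z\<bar> \<le> real k \<and> \<bar>snd z\<bar> \<le> real k then min (f z) (ennreal (real k)) else 0)"

lemma truncation_measurable[measurable]:
  assumes [measurable]: "f \<in> borel_measurable (borel \<Otimes>\<^sub>M borel)"
  shows "truncation k f \<in> borel_measurable (borel \<Otimes>\<^sub>M borel)"
  unfolding truncation_def by measurable

lemma truncation_le: "truncation k f z \<le> f z" and truncation_le_const: "truncation k f z \<le> ennreal (real k)"
  by (simp_all add: truncation_def)

lemma incseq_truncation: "incseq (\<lambda>k. truncation k f)"
  by (auto simp: incseq_def le_fun_def truncation_def min.coboundedI2 ennreal_leI intro: min.coboundedI1)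

lemma SUP_truncation: "(SUP k. truncation k f z) = f z"
proof (rule antisym)
  show "f z \<le> (SUP k. truncation k f z)"
  proof (rule dense_le)
    fix t assume t: "t < f z"
    then obtain r where r: "0 \<le> r" "t = ennreal r" by (cases t) auto
    obtain k :: nat where k: "max r (max \<bar>fst z\<bar> \<bar>snd z\<bar>) \<le> real k" using real_arch_simple by blast
    then have "t \<le> truncation k f z" using t r by (auto simp: truncation_def ennreal_leI)
    then show "t \<le> (SUP k. truncation k f z)" by (rule SUP_upper2[OF UNIV_I])
  qed
qed (intro SUP_least truncation_le)

lemma truncation_integrable: "(\<integral>\<^sup>+z. truncation k f z \<partial>plane) < \<infinity>"
proof -
  let ?Q = "{- real k..real k} \<times> {- real k..real k}"
  have "(\<integral>\<^sup>+z. truncation k f z \<partial>plane) \<le> (\<integral>\<^sup>+z. ennreal (real k) * indicator ?Q z \<partial>plane)"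
    by (intro nn_integral_mono) (auto simp: truncation_def indicator_def)
  also have "\<dots> = ennreal (real k) * emeasure plane ?Q"
    by (rule nn_integral_cmult_indicator) measurable
  also have "\<dots> < \<infinity>"
    by (subst lborel.emeasure_pair_measure_Times) (auto simp: ennreal_mult_less_top)
  finally show ?thesis .
qed

context slope_field
begin

definition tile_max :: "(real \<times> real \<Rightarrow> ennreal) \<Rightarrow> real \<times> real \<Rightarrow> ennreal" where
  "tile_max f z = (SUP P\<in>live_tiles. tile_avg P (vertical_avg (5 * w) f) z)"

definition truncated_tile_max :: "nat \<Rightarrow> (real \<times> real \<Rightarrow> ennreal) \<Rightarrow> real \<times> real \<Rightarrow> ennreal" where
  "truncated_tile_max k f z =
    (SUP P\<in>{P \<in> live_tiles. to_nat P < k}. tile_avg P (vertical_avg (5 * w) (truncation k f)) z)"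

lemma tile_max_measurable[measurable]:
  "f \<in> borel_measurable (borel \<Otimes>\<^sub>M borel) \<Longrightarrow> tile_max f \<in> borel_measurable (borel \<Otimes>\<^sub>M borel)"
  unfolding tile_max_def by measurable

lemma truncated_tile_max_measurable[measurable]:
  "f \<in> borel_measurable (borel \<Otimes>\<^sub>M borel) \<Longrightarrow> truncated_tile_max k f \<in> borel_measurable (borel \<Otimes>\<^sub>M borel)"
  unfolding truncated_tile_max_def by measurable

lemma tile_avg_truncation_mono:
  "k \<le> k' \<Longrightarrow> tile_avg P (vertical_avg r (truncation k f)) z \<le> tile_avg P (vertical_avg r (truncation k' f)) z"
  unfolding tile_avg_def using incseq_truncation[of f]
  by (intro line_avg_mono vertical_avg_mono) (auto simp: incseq_def le_fun_def)

lemma tile_avg_SUP_truncation: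
  assumes [measurable]: "f \<in> borel_measurable (borel \<Otimes>\<^sub>M borel)"
  shows "tile_avg P (vertical_avg r f) z = (SUP k. tile_avg P (vertical_avg r (truncation k f)) z)"
proof -
  have "vertical_avg r f = (\<lambda>z. SUP k. vertical_avg r (truncation k f) z)"
    using vertical_avg_SUP[OF incseq_truncation[of f], of r] by (simp add: SUP_truncation fun_eq_iff)
  moreover have "incseq (\<lambda>k. vertical_avg r (truncation k f))"
    using incseq_truncation[of f] by (auto simp: incseq_def le_fun_def intro!: vertical_avg_mono)
  ultimately show ?thesis unfolding tile_avg_def by (simp add: line_avg_SUP tile_base_sets)
qed

lemma incseq_truncated_tile_max: "incseq (\<lambda>k. truncated_tile_max k f)"
proof -
  have "truncated_tile_max k f z \<le> truncated_tile_max k' f z" if "k \<le> k'" for k k' z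
    unfolding truncated_tile_max_def
  proof (rule SUP_mono)
    fix P assume "P \<in> {P \<in> live_tiles. to_nat P < k}"
    then show "\<exists>P'\<in>{P \<in> live_tiles. to_nat P < k'}. tile_avg P (vertical_avg (5 * w) (truncation k f)) z
        \<le> tile_avg P' (vertical_avg (5 * w) (truncation k' f)) z"
      using that tile_avg_truncation_mono[OF that] by (intro bexI[of _ P]) auto
  qed
  then show ?thesis by (auto simp: incseq_def le_fun_def)
qed

lemma tile_max_le_SUP_truncated:
  assumes "f \<in> borel_measurable (borel \<Otimes>\<^sub>M borel)"
  shows "tile_max f z \<le> (SUP k. truncated_tile_max k f z)"
  unfolding tile_max_def tile_avg_SUP_truncation[OF assms]
proof (intro SUP_least)
  fix P k assume P: "P \<in> live_tiles"
  define k' where "k' = max k (Suc (to_nat P))"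
  have "tile_avg P (vertical_avg (5 * w) (truncation k f)) z
      \<le> tile_avg P (vertical_avg (5 * w) (truncation k' f)) z"
    by (rule tile_avg_truncation_mono) (simp add: k'_def)
  also have "\<dots> \<le> truncated_tile_max k' f z"
    unfolding truncated_tile_max_def using P by (intro SUP_upper) (simp add: k'_def less_max_iff_disj)
  also have "\<dots> \<le> (SUP k. truncated_tile_max k f z)" by (rule SUP_upper) simp
  finally show "tile_avg P (vertical_avg (5 * w) (truncation k f)) z \<le> (SUP k. truncated_tile_max k f z)" .
qed

lemma truncated_tile_max_ineq:
  assumes [measurable]: "f \<in> borel_measurable (borel \<Otimes>\<^sub>M borel)"
  shows "(\<integral>\<^sup>+z. (truncated_tile_max k f z)\<^sup>2 \<partial>plane) \<le> ennreal ((tile_const D)\<^sup>2) * (\<integral>\<^sup>+z. (f z)\<^sup>2 \<partial>plane)"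
proof -
  have "finite {P \<in> live_tiles. to_nat P < k}"
    by (rule finite_subset[of _ "to_nat -` {..<k}"]) (auto intro: finite_vimageI)
  then have "(\<integral>\<^sup>+z. (truncated_tile_max k f z)\<^sup>2 \<partial>plane)
      \<le> ennreal ((tile_const D)\<^sup>2) * (\<integral>\<^sup>+z. (truncation k f z)\<^sup>2 \<partial>plane)"
    unfolding truncated_tile_max_def
    using w truncation_le_const truncation_integrable by (intro finite_tile_max_ineq) auto
  also have "\<dots> \<le> ennreal ((tile_const D)\<^sup>2) * (\<integral>\<^sup>+z. (f z)\<^sup>2 \<partial>plane)"
    by (intro mult_left_mono nn_integral_mono power_mono truncation_le) auto
  finally show ?thesis .
qed

theorem tile_max_ineq:
  assumes [measurable]: "f \<in> borel_measurable (borel \<Otimes>\<^sub>M borel)"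
  shows "(\<integral>\<^sup>+z. (tile_max f z)\<^sup>2 \<partial>plane) \<le> ennreal ((tile_const D)\<^sup>2) * (\<integral>\<^sup>+z. (f z)\<^sup>2 \<partial>plane)"
proof -
  have "(\<integral>\<^sup>+z. (tile_max f z)\<^sup>2 \<partial>plane) \<le> (\<integral>\<^sup>+z. (SUP k. (truncated_tile_max k f z)\<^sup>2) \<partial>plane)"
    unfolding ennreal_SUP_power2[symmetric]
    by (intro nn_integral_mono power_mono tile_max_le_SUP_truncated assms) auto
  also have "\<dots> = (SUP k. \<integral>\<^sup>+z. (truncated_tile_max k f z)\<^sup>2 \<partial>plane)"
    using incseq_truncated_tile_max[of f]
    by (intro nn_integral_monotone_convergence_SUP) (auto simp: incseq_def le_fun_def intro: power_mono)
  also have "\<dots> \<le> ennreal ((tile_const D)\<^sup>2) * (\<integral>\<^sup>+z. (f z)\<^sup>2 \<partial>plane)"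
    by (intro SUP_least truncated_tile_max_ineq assms)
  finally show ?thesis .
qed

end

section \<open>From parallelograms to tiles\<close>

definition parallelogram :: "real \<times> real \<Rightarrow> real \<Rightarrow> real \<Rightarrow> real \<Rightarrow> (real \<times> real) set" where
  "parallelogram c \<sigma> L w = {p. \<bar>fst p - fst c\<bar> < L \<and> \<bar>snd p - snd c - \<sigma> * (fst p - fst c)\<bar> < w}"

definition matching_columns :: "(real \<Rightarrow> real) \<Rightarrow> real \<Rightarrow> real \<Rightarrow> real \<Rightarrow> real \<Rightarrow> real set" where
  "matching_columns v c \<sigma> L w = {a. \<bar>a - c\<bar> < L \<and> \<bar>v a - \<sigma>\<bar> \<le> w / (2 * L)}"

lemma parallelogram_sets[measurable]: "parallelogram c \<sigma> L w \<in> sets (borel \<Otimes>\<^sub>M borel)"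
proof -
  have "{p \<in> space (borel \<Otimes>\<^sub>M borel). \<bar>fst p - fst c\<bar> < L \<and> \<bar>snd p - snd c - \<sigma> * (fst p - fst c)\<bar> < w}
      \<in> sets (borel \<Otimes>\<^sub>M borel)"
    by measurable
  then show ?thesis by (simp add: parallelogram_def space_pair_measure)
qed

lemma parallelogram_change_slope:
  assumes z: "z \<in> parallelogram c \<sigma> L w" and p: "p \<in> parallelogram c \<sigma> L w" and \<tau>: "\<bar>\<sigma> - \<tau>\<bar> * (2 * L) \<le> 3 * w"
  shows "\<bar>snd p - snd z - \<tau> * (fst p - fst z)\<bar> < 5 * w"
proof -
  have "\<bar>(\<sigma> - \<tau>) * (fst p - fst z)\<bar> \<le> \<bar>\<sigma> - \<tau>\<bar> * (2 * L)"
    unfolding abs_mult using z p by (intro mult_left_mono) (auto simp: parallelogram_def)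
  then have tilt: "\<bar>(\<sigma> - \<tau>) * (fst p - fst z)\<bar> \<le> 3 * w" using \<tau> by linarith
  have "snd p - snd z - \<tau> * (fst p - fst z) = (snd p - snd c - \<sigma> * (fst p - fst c))
      - (snd z - snd c - \<sigma> * (fst z - fst c)) + (\<sigma> - \<tau>) * (fst p - fst z)"
    by (simp add: algebra_simps)
  then show ?thesis using z p tilt unfolding parallelogram_def mem_Collect_eq by linarith
qed

lemma line_avg_vertical_avg_eq:
  assumes d: "0 < d" and r: "0 < r" and z: "fst z \<in> S"
    and [measurable]: "S \<in> sets borel" "F \<in> borel_measurable (borel \<Otimes>\<^sub>M borel)"
  shows "ennreal (d * (2 * r)) * line_avg d S \<sigma> (vertical_avg r F) z
    = (\<integral>\<^sup>+p. (if fst p \<in> S \<and> \<bar>snd p - snd z - \<sigma> * (fst p - fst z)\<bar> < r then F p else 0) \<partial>plane)"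
proof -
  define W where "W a = (\<integral>\<^sup>+b. (if \<bar>b - (snd z + \<sigma> * (a - fst z))\<bar> < r then F (a, b) else 0) \<partial>lborel)" for a
  have [measurable]: "W \<in> borel_measurable borel" unfolding W_def by measurable
  have "line_avg d S \<sigma> (vertical_avg r F) z
      = ennreal (1 / d) * (\<integral>\<^sup>+a. ennreal (1 / (2 * r)) * (if a \<in> S then W a else 0) \<partial>lborel)"
    unfolding line_avg_def rel_avg_def vertical_avg_def fst_conv snd_conv
      window_avg_eq[OF r] ennreal_divide_eq_mult[OF d]
    using z by (intro arg_cong2[where f = "(*)"] refl nn_integral_cong) (simp add: W_def)
  also have "\<dots> = ennreal (1 / d) * (ennreal (1 / (2 * r)) * (\<integral>\<^sup>+a. (if a \<in> S then W a else 0) \<partial>lborel))"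
    by (subst nn_integral_cmult) measurable
  also have "(\<integral>\<^sup>+a. (if a \<in> S then W a else 0) \<partial>lborel)
      = (\<integral>\<^sup>+p. (if fst p \<in> S \<and> \<bar>snd p - snd z - \<sigma> * (fst p - fst z)\<bar> < r then F p else 0) \<partial>plane)"
    (is "?I = ?J")
    by (subst nn_integral_plane) (auto simp: W_def diff_diff_eq intro!: nn_integral_cong)
  finally have "ennreal (d * (2 * r)) * line_avg d S \<sigma> (vertical_avg r F) z
      = ennreal (d * (2 * r)) * ennreal (1 / d) * ennreal (1 / (2 * r)) * ?J"
    by (simp only: mult.assoc)
  also have "ennreal (d * (2 * r)) * ennreal (1 / d) * ennreal (1 / (2 * r))
      = ennreal (d * (2 * r) * (1 / d) * (1 / (2 * r)))"
    using d r by (simp only: ennreal_mult'' divide_nonneg_pos zero_le_one mult_pos_pos zero_less_numeral)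
  also have "d * (2 * r) * (1 / d) * (1 / (2 * r)) = 1" using d r by simp
  finally show ?thesis by simp
qed

context slope_field
begin

lemma live_slope_near:
  assumes L: "6 * L \<le> len n" "len n \<le> 12 * L"
    and inside: "\<And>a. \<bar>a - c\<bar> < L \<Longrightarrow> base_cell n a = m"
    and dense: "13 * (\<eta> * len n) \<le> measure lborel (matching_columns v c \<sigma> L w)"
  shows "\<exists>j. live n m j \<and> \<bar>\<sigma> - cell_slope (n, j)\<bar> * (2 * L) \<le> 3 * w"
proof -
  define q where "q = w / len n"
  define k where "k = slope_cell n \<sigma>"
  define J where "J = {k - 6..k + 6}"
  have L_pos: "0 < L" using L(2) len_pos[of n] by linarith
  have q_pos: "0 < q" using w len_pos by (simp add: q_def)
  have match: "slope_cell n (v a) \<in> J" if "a \<in> matching_columns v c \<sigma> L w" for a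
  proof -
    have "w / (2 * L) \<le> 6 * q" using L L_pos w len_pos[of n] by (simp add: q_def field_simps)
    then have "\<bar>v a - \<sigma>\<bar> \<le> 6 * q" using that by (simp add: matching_columns_def)
    then have "\<bar>v a / q - \<sigma> / q\<bar> \<le> 6" using q_pos by (simp add: diff_divide_distrib[symmetric] field_simps)
    then show ?thesis by (auto simp: J_def slope_cell_def cell_def k_def q_def[symmetric]; linarith)
  qed
  have "card J * (\<eta> * len n) \<le> measure lborel (matching_columns v c \<sigma> L w)"
    using dense by (simp add: J_def)
  also have "\<dots> \<le> cell_measure n m (\<lambda>a. slope_cell n (v a) \<in> J)"
    unfolding cell_measure_def
  proof (rule measure_mono_fmeasurable)
    show "matching_columns v c \<sigma> L w \<subseteq> {a. base_cell n a = m \<and> slope_cell n (v a) \<in> J}"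
      using match inside by (auto simp: matching_columns_def)
    show "{a. base_cell n a = m \<and> slope_cell n (v a) \<in> J} \<in> fmeasurable lborel"
      by (rule cell_fmeasurable) measurable
  qed (simp add: matching_columns_def)
  finally obtain j where j: "j \<in> J" "live n m j"
    using live_slope_exists[of J n m] by (auto simp: J_def)
  then have "\<bar>\<sigma> / q - of_int j\<bar> \<le> 7"
    by (auto simp: J_def k_def slope_cell_def cell_def q_def[symmetric]; linarith)
  then have "\<bar>\<sigma> / q - of_int j\<bar> * q \<le> 7 * q" using q_pos by (intro mult_right_mono) auto
  moreover have "\<sigma> - cell_slope (n, j) = (\<sigma> / q - of_int j) * q"
    using q_pos by (simp add: cell_slope_def q_def[symmetric] left_diff_distrib)
  ultimately have "\<bar>\<sigma> - cell_slope (n, j)\<bar> \<le> 7 * q" using q_pos by (simp add: abs_mult)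
  then have "\<bar>\<sigma> - cell_slope (n, j)\<bar> * (2 * L) \<le> 7 * q * (2 * L)" using L_pos by (intro mult_right_mono) auto
  also have "\<dots> \<le> 3 * w" using L w len_pos[of n] by (simp add: q_def field_simps)
  finally show ?thesis using j(2) by blast
qed

lemma parallelogram_integral_le_tile_max:
  assumes L: "6 * L \<le> len n" "len n \<le> 12 * L"
    and inside: "\<And>a. \<bar>a - fst c\<bar> < L \<Longrightarrow> base_cell n a = m"
    and dense: "13 * (\<eta> * len n) \<le> measure lborel (matching_columns v (fst c) \<sigma> L w)"
    and z: "z \<in> parallelogram c \<sigma> L w"
    and [measurable]: "f \<in> borel_measurable (borel \<Otimes>\<^sub>M borel)"
  shows "(\<integral>\<^sup>+p\<in>parallelogram c \<sigma> L w. f p \<partial>plane) \<le> ennreal (120 * L * w) * tile_max f z"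
proof -
  obtain j where j: "live n m j" "\<bar>\<sigma> - cell_slope (n, j)\<bar> * (2 * L) \<le> 3 * w"
    using live_slope_near[OF L inside dense] by blast
  define P where "P = Tile n m j"
  have in_base: "fst p \<in> tile_base P" if "p \<in> parallelogram c \<sigma> L w" for p
    using that inside by (auto simp: P_def mem_tile_base parallelogram_def)
  have "(\<integral>\<^sup>+p\<in>parallelogram c \<sigma> L w. f p \<partial>plane) \<le> (\<integral>\<^sup>+p. (if fst p \<in> tile_base P
      \<and> \<bar>snd p - snd z - slope P * (fst p - fst z)\<bar> < 5 * w then f p else 0) \<partial>plane)"
    using in_base parallelogram_change_slope[OF z _ j(2)]
    by (intro nn_integral_mono) (auto simp: indicator_def slope_def P_def)
  also have "\<dots> = ennreal (len n * (2 * (5 * w))) * tile_avg P (vertical_avg (5 * w) f) z"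
    unfolding tile_avg_def using w len_pos[of n] in_base[OF z]
    by (subst line_avg_vertical_avg_eq[symmetric]) (auto simp: P_def)
  also have "\<dots> \<le> ennreal (120 * L * w) * tile_max f z"
  proof (rule mult_mono)
    show "tile_avg P (vertical_avg (5 * w) f) z \<le> tile_max f z"
      unfolding tile_max_def using j(1) by (intro SUP_upper) (simp add: live_tiles_def P_def)
    have "len n * (2 * (5 * w)) \<le> 12 * L * (2 * (5 * w))" using L w by (intro mult_right_mono) auto
    then show "ennreal (len n * (2 * (5 * w))) \<le> ennreal (120 * L * w)" by (intro ennreal_leI) simp
  qed auto
  finally show ?thesis .
qed

end

definition grid_max ::
  "real \<Rightarrow> real \<Rightarrow> real \<Rightarrow> (real \<Rightarrow> real) \<Rightarrow> (real \<times> real \<Rightarrow> ennreal) \<Rightarrow> real \<times> real \<Rightarrow> ennreal" where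
  "grid_max l w \<eta> v f z = slope_field.tile_max l w \<eta> 0 v f z + slope_field.tile_max l w \<eta> (l / 3) v f z"

lemma grid_max_measurable:
  assumes "slope_field l w \<eta> v D" and f: "f \<in> borel_measurable (borel \<Otimes>\<^sub>M borel)"
  shows "grid_max l w \<eta> v f \<in> borel_measurable (borel \<Otimes>\<^sub>M borel)"
  unfolding grid_max_def[abs_def]
  by (intro borel_measurable_add slope_field.tile_max_measurable[OF assms(1) f])

lemma grid_max_ineq:
  assumes field: "slope_field l w \<eta> v D" and f: "f \<in> borel_measurable (borel \<Otimes>\<^sub>M borel)"
  shows "(\<integral>\<^sup>+z. (grid_max l w \<eta> v f z)\<^sup>2 \<partial>plane) \<le> ennreal ((2 * tile_const D)\<^sup>2) * (\<integral>\<^sup>+z. (f z)\<^sup>2 \<partial>plane)"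
proof -
  let ?M = "\<lambda>s. slope_field.tile_max l w \<eta> s v f"
    and ?C = "ennreal ((tile_const D)\<^sup>2) * (\<integral>\<^sup>+z. (f z)\<^sup>2 \<partial>plane)"
  have [measurable]: "?M s \<in> borel_measurable (borel \<Otimes>\<^sub>M borel)" for s
    by (rule slope_field.tile_max_measurable[OF field f])
  have "(\<integral>\<^sup>+z. (grid_max l w \<eta> v f z)\<^sup>2 \<partial>plane) \<le> 4 * ?C"
    unfolding grid_max_def
    by (intro nn_integral_add_power2_le slope_field.tile_max_ineq[OF field f]) measurable
  also have "\<dots> = ennreal ((2 * tile_const D)\<^sup>2) * (\<integral>\<^sup>+z. (f z)\<^sup>2 \<partial>plane)"
    by (simp only: power_mult_distrib ennreal_mult' zero_le_power2 mult.assoc) simp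
  finally show ?thesis .
qed

lemma parallelogram_integral_le_grid_max:
  assumes field: "slope_field l w \<eta> v D" and L: "0 < L" "6 * L \<le> l"
    and dense: "156 * \<eta> * L \<le> measure lborel (matching_columns v (fst c) \<sigma> L w)"
    and z: "z \<in> parallelogram c \<sigma> L w" and f: "f \<in> borel_measurable (borel \<Otimes>\<^sub>M borel)"
  shows "(\<integral>\<^sup>+p\<in>parallelogram c \<sigma> L w. f p \<partial>plane) \<le> ennreal (120 * L * w) * grid_max l w \<eta> v f z"
proof -
  have l_pos: "0 < l" and \<eta>: "0 < \<eta>" using field by (auto simp: slope_field_def)
  have "1 \<le> l / (6 * L)" using L by simp
  then obtain n where "2 ^ n \<le> l / (6 * L)" "l / (6 * L) < 2 ^ Suc n"
    using power_of_two_between by blast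
  then have len_bounds: "6 * L \<le> l / 2 ^ n" "l / 2 ^ n \<le> 12 * L" using L by (simp_all add: field_simps)
  obtain s where shift: "s \<in> {0, l / 3}"
    and cells: "\<And>a. \<bar>a - fst c\<bar> < L \<Longrightarrow> cell (l / 2 ^ n) (a + s) = cell (l / 2 ^ n) (fst c + s)"
    using ball_in_shifted_dyadic_cell[OF l_pos L(1) len_bounds(1), of "fst c"] by blast
  interpret slope_field l w \<eta> s v D by (rule field)
  have "(\<integral>\<^sup>+p\<in>parallelogram c \<sigma> L w. f p \<partial>plane) \<le> ennreal (120 * L * w) * tile_max f z"
  proof (rule parallelogram_integral_le_tile_max[OF _ _ _ _ z f])
    show "6 * L \<le> len n" "len n \<le> 12 * L" using len_bounds by (simp_all add: len_def)
    show "base_cell n a = base_cell n (fst c)" if "\<bar>a - fst c\<bar> < L" for a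
      using cells[OF that] by (simp add: base_cell_def len_def)
    have "\<eta> * len n \<le> \<eta> * (12 * L)" using len_bounds \<eta> by (intro mult_left_mono) (auto simp: len_def)
    then show "13 * (\<eta> * len n) \<le> measure lborel (matching_columns v (fst c) \<sigma> L w)"
      using dense by (simp add: mult_ac)
  qed
  also have "\<dots> \<le> ennreal (120 * L * w) * grid_max l w \<eta> v f z"
    unfolding grid_max_def using shift by (intro mult_left_mono) (auto intro: add_increasing add_increasing2)
  finally show ?thesis .
qed

section \<open>Rectangles\<close>

lemma mem_rect_set:
  "p \<in> rect_set (c, \<phi>, L, w) \<longleftrightarrow>
    \<bar>(fst p - fst c) * cos \<phi> + (snd p - snd c) * sin \<phi>\<bar> < L / 2 \<and>
    \<bar>(snd p - snd c) * cos \<phi> - (fst p - fst c) * sin \<phi>\<bar> < w / 2"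
  by (cases p; cases c) (simp add: rect_set_def)

lemma rect_set_sets[measurable]: "rect_set R \<in> sets (borel \<Otimes>\<^sub>M borel)"
proof -
  obtain c \<phi> L w where R: "R = (c, \<phi>, L, w)" by (cases R)
  have "{p \<in> space (borel \<Otimes>\<^sub>M borel). p \<in> rect_set R} \<in> sets (borel \<Otimes>\<^sub>M borel)"
    unfolding R mem_rect_set by measurable
  then show ?thesis by (simp add: space_pair_measure)
qed

lemma rect_subset_parallelogram:
  assumes cos_ge: "1 / 2 \<le> \<bar>cos \<phi>\<bar>" and L: "w \<le> L"
  shows "rect_set (c, \<phi>, L, w) \<subseteq> parallelogram c (tan \<phi>) L w"
proof
  fix p assume p: "p \<in> rect_set (c, \<phi>, L, w)"
  define x where "x = fst p - fst c"
  define y where "y = snd p - snd c"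
  define s where "s = x * cos \<phi> + y * sin \<phi>"
  define t where "t = y * cos \<phi> - x * sin \<phi>"
  have st_less: "\<bar>s\<bar> < L / 2" "\<bar>t\<bar> < w / 2"
    using p by (auto simp: mem_rect_set s_def t_def x_def y_def)
  have "s * cos \<phi> - t * sin \<phi> = x * ((cos \<phi>)\<^sup>2 + (sin \<phi>)\<^sup>2)"
    unfolding s_def t_def by algebra
  then have "x = s * cos \<phi> - t * sin \<phi>" by simp
  moreover have "\<bar>s * cos \<phi>\<bar> \<le> \<bar>s\<bar>" "\<bar>t * sin \<phi>\<bar> \<le> \<bar>t\<bar>"
    by (simp_all add: abs_mult mult_left_le)
  ultimately have x_less: "\<bar>x\<bar> < L" using st_less L by linarith
  have "cos \<phi> \<noteq> 0" using cos_ge by auto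
  then have "(y - tan \<phi> * x) * cos \<phi> = t" by (simp add: t_def tan_def field_simps)
  then have "\<bar>y - tan \<phi> * x\<bar> * \<bar>cos \<phi>\<bar> = \<bar>t\<bar>" by (metis abs_mult)
  moreover have "\<bar>y - tan \<phi> * x\<bar> * (1 / 2) \<le> \<bar>y - tan \<phi> * x\<bar> * \<bar>cos \<phi>\<bar>"
    using cos_ge by (intro mult_left_mono) auto
  ultimately have "\<bar>y - tan \<phi> * x\<bar> * (1 / 2) \<le> \<bar>t\<bar>" by simp
  then have "\<bar>y - tan \<phi> * x\<bar> * (1 / 2) < w / 2" using st_less(2) by (rule le_less_trans)
  then have "\<bar>y - tan \<phi> * x\<bar> < w" by simp
  then show "p \<in> parallelogram c (tan \<phi>) L w"
    using x_less by (simp add: parallelogram_def x_def y_def)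
qed

lemma parallelogram_subset_rect:
  assumes cos_ge: "1 / 2 \<le> \<bar>cos \<phi>\<bar>" and L: "0 < w" "w \<le> L"
  shows "parallelogram c (tan \<phi>) (L / 8) (w / 4) \<subseteq> rect_set (c, \<phi>, L, w)"
proof
  fix p assume p: "p \<in> parallelogram c (tan \<phi>) (L / 8) (w / 4)"
  define x where "x = fst p - fst c"
  define y where "y = snd p - snd c"
  define e where "e = y - tan \<phi> * x"
  have xe_less: "\<bar>x\<bar> < L / 8" "\<bar>e\<bar> < w / 4"
    using p by (auto simp: parallelogram_def x_def y_def e_def)
  have cos_nz: "cos \<phi> \<noteq> 0" using cos_ge by auto
  have y_eq: "y = x * sin \<phi> / cos \<phi> + e" by (simp add: e_def tan_def)
  have "x * (cos \<phi> * cos \<phi>) + x * (sin \<phi> * sin \<phi>) = x * ((cos \<phi>)\<^sup>2 + (sin \<phi>)\<^sup>2)"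
    by algebra
  then have "x * (cos \<phi> * cos \<phi>) + x * (sin \<phi> * sin \<phi>) = x" by simp
  then have long_coordinate: "x * cos \<phi> + y * sin \<phi> = x / cos \<phi> + e * sin \<phi>"
    unfolding y_eq using cos_nz by (simp add: field_simps)
  have short_coordinate: "y * cos \<phi> - x * sin \<phi> = e * cos \<phi>"
    unfolding y_eq using cos_nz by (simp add: field_simps)
  have "\<bar>x\<bar> * 1 \<le> \<bar>x\<bar> * (2 * \<bar>cos \<phi>\<bar>)" using cos_ge by (intro mult_left_mono) auto
  then have "\<bar>x / cos \<phi>\<bar> \<le> 2 * \<bar>x\<bar>" using cos_nz by (simp add: abs_divide field_simps)
  moreover have "\<bar>e * sin \<phi>\<bar> \<le> \<bar>e\<bar>" "\<bar>e * cos \<phi>\<bar> \<le> \<bar>e\<bar>"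
    by (simp_all add: abs_mult mult_left_le)
  ultimately have "\<bar>x / cos \<phi> + e * sin \<phi>\<bar> < L / 2" "\<bar>e * cos \<phi>\<bar> < w / 2"
    using xe_less L by linarith+
  then show "p \<in> rect_set (c, \<phi>, L, w)"
    unfolding mem_rect_set x_def[symmetric] y_def[symmetric] long_coordinate short_coordinate by simp
qed

lemma
  fixes Q :: "real \<Rightarrow> bool" and g :: "real \<Rightarrow> real"
  assumes [measurable]: "Measurable.pred borel Q" "g \<in> borel_measurable borel" and r: "0 < r"
  shows graph_band_sets: "{z. Q (fst z) \<and> \<bar>snd z - g (fst z)\<bar> < r} \<in> sets (borel \<Otimes>\<^sub>M borel)" (is "?S \<in> _")
    and emeasure_graph_band: "emeasure plane {z. Q (fst z) \<and> \<bar>snd z - g (fst z)\<bar> < r}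
      = emeasure lborel {a. Q a} * ennreal (2 * r)"
proof -
  have "{z \<in> space (borel \<Otimes>\<^sub>M borel). Q (fst z) \<and> \<bar>snd z - g (fst z)\<bar> < r} \<in> sets (borel \<Otimes>\<^sub>M borel)"
    by measurable
  then show [measurable]: "?S \<in> sets (borel \<Otimes>\<^sub>M borel)" by (simp add: space_pair_measure)
  have "emeasure plane ?S = (\<integral>\<^sup>+z. indicator ?S z \<partial>plane)"
    by (intro nn_integral_indicator[symmetric]) (simp cong: sets_pair_measure_cong)
  also have "\<dots> = (\<integral>\<^sup>+a. \<integral>\<^sup>+b. indicator ?S (a, b) \<partial>lborel \<partial>lborel)"
    by (rule nn_integral_plane) measurable
  also have "\<dots> = (\<integral>\<^sup>+a. indicator {a. Q a} a * ennreal (2 * r) \<partial>lborel)"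
  proof (rule nn_integral_cong)
    fix a
    have "(\<integral>\<^sup>+b. indicator ?S (a, b) \<partial>lborel)
        = (\<integral>\<^sup>+b. indicator {a. Q a} a * indicator {b. \<bar>b - g a\<bar> < r} b \<partial>lborel)"
      by (intro nn_integral_cong) (auto simp: indicator_def)
    also have "\<dots> = indicator {a. Q a} a * ennreal (2 * r)"
      using r by (subst nn_integral_cmult_indicator) (auto simp: emeasure_window)
    finally show "(\<integral>\<^sup>+b. indicator ?S (a, b) \<partial>lborel) = indicator {a. Q a} a * ennreal (2 * r)" .
  qed
  also have "\<dots> = emeasure lborel {a. Q a} * ennreal (2 * r)"
    by (subst nn_integral_multc) auto
  finally show "emeasure plane ?S = emeasure lborel {a. Q a} * ennreal (2 * r)" .
qed

lemma emeasure_parallelogram: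
  assumes "0 < L" "0 < w"
  shows "emeasure plane (parallelogram c \<sigma> L w) = ennreal (4 * L * w)"
proof -
  have "parallelogram c \<sigma> L w = {z. \<bar>fst z - fst c\<bar> < L \<and> \<bar>snd z - (snd c + \<sigma> * (fst z - fst c))\<bar> < w}"
    by (auto simp: parallelogram_def algebra_simps)
  then show ?thesis
    using emeasure_graph_band[of "\<lambda>a. \<bar>a - fst c\<bar> < L" "\<lambda>a. snd c + \<sigma> * (a - fst c)" w] assms
    by (simp add: emeasure_window ennreal_mult''[symmetric] mult_ac)
qed

lemma
  fixes S :: "(real \<times> real) set"
  assumes "S \<in> sets (borel \<Otimes>\<^sub>M borel)"
  shows sets_lebesgue_plane: "S \<in> sets lebesgue"
    and emeasure_lebesgue_plane: "emeasure lebesgue S = emeasure plane S"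
proof -
  have "S \<in> sets borel" using assms by (simp only: borel_prod)
  then show "S \<in> sets lebesgue" "emeasure lebesgue S = emeasure plane S"
    by (simp_all add: lborel_prod)
qed

lemma AE_lebesgue_plane_fst:
  fixes P :: "real \<Rightarrow> bool"
  assumes "AE a in lborel. P a"
  shows "AE z in (lebesgue :: (real \<times> real) measure). P (fst z)"
proof -
  obtain N where N: "{a. \<not> P a} \<subseteq> N" "emeasure lborel N = 0" "N \<in> sets borel"
    using AE_E[OF assms] by auto
  have "emeasure plane (N \<times> (UNIV :: real set)) = 0"
    using N by (subst lborel.emeasure_pair_measure_Times) auto
  then have "N \<times> (UNIV :: real set) \<in> null_sets lborel"
    unfolding lborel_prod null_sets_def using pair_measureI[OF N(3), of UNIV borel]
    by (simp add: borel_prod[symmetric])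
  then have "AE z in lborel. z \<notin> N \<times> (UNIV :: real set)" by (rule AE_not_in)
  then have "AE z in lebesgue. z \<notin> N \<times> (UNIV :: real set)" by (rule AE_completion)
  then show ?thesis by (rule AE_mp) (use N(1) in \<open>auto intro!: AE_I2\<close>)
qed

lemma cos_ge_half_if_V_set_nonempty:
  assumes "V_set v (c, \<phi>, L, w) \<noteq> {}" and L: "0 < L" "w \<le> L" and v: "\<And>a. 0 \<le> v a \<and> v a \<le> 1"
  shows "1 / 2 \<le> \<bar>cos \<phi>\<bar>"
proof -
  obtain p where "v (fst p) \<in> theta (c, \<phi>, L, w)" using assms(1) by (auto simp: V_set_def)
  then have tan_near: "\<bar>v (fst p) - tan \<phi>\<bar> \<le> w / (2 * L)" and cos_nz: "cos \<phi> \<noteq> 0"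
    by (auto simp: theta_def split: if_splits)
  have "w / (2 * L) \<le> 1 / 2" using L by simp
  then have "\<bar>tan \<phi>\<bar> \<le> 3 / 2" using tan_near v[of "fst p"] by linarith
  then have "(tan \<phi>)\<^sup>2 \<le> (3 / 2)\<^sup>2" by (simp add: abs_le_square_iff[symmetric])
  then have "(cos \<phi>)\<^sup>2 * (1 + (tan \<phi>)\<^sup>2) \<le> (cos \<phi>)\<^sup>2 * (1 + (3 / 2)\<^sup>2)"
    by (intro mult_left_mono) auto
  moreover have "(cos \<phi>)\<^sup>2 * (1 + (tan \<phi>)\<^sup>2) = 1"
    using cos_nz sin_cos_squared_add2[of \<phi>] by (simp add: tan_def field_simps)
  ultimately have "(1 / 2)\<^sup>2 \<le> (cos \<phi>)\<^sup>2" by (simp add: power2_eq_square)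
  then show ?thesis using abs_le_square_iff[of "1 / 2" "cos \<phi>"] by simp
qed

lemma rect_area_ge:
  assumes cos_ge: "1 / 2 \<le> \<bar>cos \<phi>\<bar>" and w: "0 < w" "w \<le> L"
  shows "L * w / 8 \<le> measure lebesgue (rect_set (c, \<phi>, L, w))" (is "_ \<le> measure _ ?R")
proof -
  have "emeasure lebesgue ?R \<le> emeasure lebesgue (parallelogram c (tan \<phi>) L w)"
    using rect_subset_parallelogram[OF cos_ge w(2)]
    by (intro emeasure_mono sets_lebesgue_plane parallelogram_sets)
  also have "\<dots> < top" using w by (simp add: emeasure_lebesgue_plane emeasure_parallelogram)
  finally have emeasure_rect: "emeasure lebesgue ?R = ennreal (measure lebesgue ?R)"
    by (intro emeasure_eq_ennreal_measure) simp
  have "ennreal (4 * (L / 8) * (w / 4)) = emeasure lebesgue (parallelogram c (tan \<phi>) (L / 8) (w / 4))"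
    using w by (simp add: emeasure_lebesgue_plane emeasure_parallelogram)
  also have "\<dots> \<le> ennreal (measure lebesgue ?R)"
    unfolding emeasure_rect[symmetric] using parallelogram_subset_rect[OF cos_ge w]
    by (intro emeasure_mono sets_lebesgue_plane rect_set_sets)
  finally show ?thesis by (simp add: ennreal_le_iff)
qed

lemma measure_V_set_le:
  assumes cos_ge: "1 / 2 \<le> \<bar>cos \<phi>\<bar>" and w: "0 < w" "w \<le> L"
    and [measurable]: "v' \<in> borel_measurable borel" and v': "AE a in lborel. v a = v' a"
  shows "measure lebesgue (V_set v (c, \<phi>, L, w))
      \<le> measure lborel (matching_columns v' (fst c) (tan \<phi>) L w) * (2 * w)"
    (is "measure _ ?V \<le> measure _ ?A * _")
proof -
  let ?B = "{z. fst z \<in> ?A \<and> \<bar>snd z - (snd c + tan \<phi> * (fst z - fst c))\<bar> < w}"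
  have [measurable]: "Measurable.pred borel (\<lambda>a. a \<in> ?A)" by (simp add: matching_columns_def)
  have band_sets[measurable]: "?B \<in> sets (borel \<Otimes>\<^sub>M borel)" by (rule graph_band_sets) (use w in simp_all)
  have "emeasure lborel ?A \<le> emeasure lborel {a. \<bar>a - fst c\<bar> < L}"
    by (intro emeasure_mono) (auto simp: matching_columns_def)
  then have emeasure_columns: "emeasure lborel ?A = ennreal (measure lborel ?A)"
    using w by (intro emeasure_eq_ennreal_measure) (auto simp: emeasure_window top_unique)
  have "ennreal (measure lebesgue ?V) \<le> emeasure lebesgue ?V" by (simp add: measure_def ennreal_enn2real_if)
  also have "\<dots> \<le> emeasure lebesgue ?B"
  proof (rule emeasure_mono_AE)
    have in_B: "z \<in> ?B" if "z \<in> ?V" "v (fst z) = v' (fst z)" for z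
    proof -
      have "z \<in> parallelogram c (tan \<phi>) L w" and v: "v (fst z) \<in> theta (c, \<phi>, L, w)"
        using that(1) rect_subset_parallelogram[OF cos_ge w(2), of c] by (auto simp: V_set_def)
      moreover have "\<bar>v (fst z) - tan \<phi>\<bar> \<le> w / (2 * L)"
        using v unfolding theta_def by (simp add: abs_le_iff split: if_splits; linarith)
      ultimately show ?thesis
        using that(2) by (simp add: matching_columns_def parallelogram_def diff_diff_eq)
    qed
    show "AE z in lebesgue. z \<in> ?V \<longrightarrow> z \<in> ?B"
      using AE_lebesgue_plane_fst[OF v'] by eventually_elim (intro impI in_B)
  qed (rule sets_lebesgue_plane[OF band_sets])
  also have "\<dots> = emeasure lborel ?A * ennreal (2 * w)"
    using emeasure_graph_band[of "\<lambda>a. a \<in> ?A" "\<lambda>a. snd c + tan \<phi> * (a - fst c)" w] w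
    by (simp add: emeasure_lebesgue_plane)
  also have "\<dots> = ennreal (measure lborel ?A * (2 * w))"
    unfolding emeasure_columns using w by (simp add: ennreal_mult'')
  finally show ?thesis using w by (subst (asm) ennreal_le_iff) auto
qed

lemma R_delta_parallelogram:
  assumes R: "R \<in> R_delta v w \<delta>" "measure lebesgue (rect_set R) \<noteq> 0"
    and w: "0 < w" and \<delta>: "0 < \<delta>" and v: "\<And>a. 0 \<le> v a \<and> v a \<le> 1"
    and v': "v' \<in> borel_measurable borel" "AE a in lborel. v a = v' a"
  obtains c \<sigma> L where "0 < L" "rect_set R \<subseteq> parallelogram c \<sigma> L w" "L * w / 8 \<le> measure lebesgue (rect_set R)"
    "\<delta> * L / 16 \<le> measure lborel (matching_columns v' (fst c) \<sigma> L w)"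
proof -
  obtain c \<phi> L where R_eq: "R = (c, \<phi>, L, w)" and L: "w \<le> L"
    and dense: "\<delta> * measure lebesgue (rect_set R) \<le> measure lebesgue (V_set v R)"
    using R(1) by (cases R) (auto simp: R_delta_def rect_width_def rect_length_def)
  have L_pos: "0 < L" using w L by linarith
  have "0 < \<delta> * measure lebesgue (rect_set R)" using R(2) \<delta> by (simp add: zero_less_measure_iff)
  then have "V_set v R \<noteq> {}" using dense by auto
  then have cos_ge: "1 / 2 \<le> \<bar>cos \<phi>\<bar>"
    unfolding R_eq by (rule cos_ge_half_if_V_set_nonempty[OF _ L_pos L v])
  have subset: "rect_set R \<subseteq> parallelogram c (tan \<phi>) L w"
    unfolding R_eq by (rule rect_subset_parallelogram[OF cos_ge L])
  have area: "L * w / 8 \<le> measure lebesgue (rect_set R)" unfolding R_eq by (rule rect_area_ge[OF cos_ge w L])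
  have "\<delta> * (L * w / 8) \<le> \<delta> * measure lebesgue (rect_set R)" using area \<delta> by (intro mult_left_mono) auto
  also note dense
  also have "measure lebesgue (V_set v R)
      \<le> measure lborel (matching_columns v' (fst c) (tan \<phi>) L w) * (2 * w)"
    unfolding R_eq by (rule measure_V_set_le[OF cos_ge w L v'])
  finally have "\<delta> * L / 16 * (2 * w) \<le> measure lborel (matching_columns v' (fst c) (tan \<phi>) L w) * (2 * w)"
    by (simp add: mult_ac)
  then have "\<delta> * L / 16 \<le> measure lborel (matching_columns v' (fst c) (tan \<phi>) L w)"
    using w by (simp only: mult_le_cancel_right)
  then show thesis by (rule that[OF L_pos subset area])
qed

definition rect_avg :: "(real \<times> real \<Rightarrow> real) \<Rightarrow> rect_data \<Rightarrow> real" where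
  "rect_avg f R = (1 / measure lebesgue (rect_set R)) * (\<integral>p\<in>rect_set R. f p \<partial>lebesgue)"

lemma rect_avg_le:
  fixes f :: "real \<times> real \<Rightarrow> real" and F :: "real \<times> real \<Rightarrow> ennreal"
  assumes F: "AE z in plane. ennreal \<bar>f z\<bar> = F z" and subset: "rect_set R \<subseteq> S"
    and m: "0 < m" "m \<le> measure lebesgue (rect_set R)"
  shows "ennreal \<bar>rect_avg f R\<bar> \<le> ennreal (1 / m) * (\<integral>\<^sup>+z\<in>S. F z \<partial>plane)"
proof -
  let ?g = "\<lambda>p. indicator (rect_set R) p *\<^sub>R f p"
  have "ennreal \<bar>\<integral>p\<in>rect_set R. f p \<partial>lebesgue\<bar> \<le> (\<integral>\<^sup>+p. ennreal (norm (?g p)) \<partial>lebesgue)"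
  proof (cases "integrable lebesgue ?g")
    case True
    from integral_norm_bound_ennreal[OF this] show ?thesis by (simp add: set_lebesgue_integral_def)
  next
    case False
    then show ?thesis by (simp add: set_lebesgue_integral_def not_integrable_integral_eq)
  qed
  also have "\<dots> = (\<integral>\<^sup>+p. ennreal (norm (?g p)) \<partial>plane)"
    by (simp only: nn_integral_completion lborel_prod)
  also have "\<dots> \<le> (\<integral>\<^sup>+z\<in>S. F z \<partial>plane)"
    using F by (intro nn_integral_mono_AE, elim AE_mp, intro AE_I2 impI)
      (use subset in \<open>auto simp: indicator_def\<close>)
  finally have integral_le: "ennreal \<bar>\<integral>p\<in>rect_set R. f p \<partial>lebesgue\<bar> \<le> (\<integral>\<^sup>+z\<in>S. F z \<partial>plane)" .
  have "ennreal \<bar>rect_avg f R\<bar>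
      = ennreal (1 / measure lebesgue (rect_set R)) * ennreal \<bar>\<integral>p\<in>rect_set R. f p \<partial>lebesgue\<bar>"
    unfolding rect_avg_def abs_mult by (subst ennreal_mult') auto
  also have "\<dots> \<le> ennreal (1 / m) * (\<integral>\<^sup>+z\<in>S. F z \<partial>plane)"
    using m by (intro mult_mono integral_le ennreal_leI divide_left_mono) auto
  finally show ?thesis .
qed

lemma e2ennreal_abs_SUP_le:
  fixes q :: "'a \<Rightarrow> real"
  assumes "X \<noteq> {}"
  shows "e2ennreal \<bar>SUP R\<in>X. ereal (q R)\<bar> \<le> (SUP R\<in>X. ennreal \<bar>q R\<bar>)"
proof -
  define S where "S = (SUP R\<in>X. ennreal \<bar>q R\<bar>)"
  obtain R0 where R0: "R0 \<in> X" using assms by auto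
  have q_le: "ereal \<bar>q R\<bar> \<le> enn2ereal S" if "R \<in> X" for R
  proof -
    have "enn2ereal (ennreal \<bar>q R\<bar>) \<le> enn2ereal S"
      unfolding S_def less_eq_ennreal.rep_eq[symmetric] by (rule SUP_upper[OF that])
    then show ?thesis by simp
  qed
  have "\<bar>SUP R\<in>X. ereal (q R)\<bar> \<le> enn2ereal S"
  proof (rule ereal_abs_leI)
    show "(SUP R\<in>X. ereal (q R)) \<le> enn2ereal S"
      by (intro SUP_least order_trans[OF _ q_le]) auto
    have "ereal (q R0) \<le> (SUP R\<in>X. ereal (q R))" by (rule SUP_upper[OF R0])
    then have "- (SUP R\<in>X. ereal (q R)) \<le> - ereal (q R0)" by (simp only: ereal_minus_le_minus)
    also have "\<dots> \<le> ereal \<bar>q R0\<bar>" by simp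
    also have "\<dots> \<le> enn2ereal S" by (rule q_le[OF R0])
    finally show "- (SUP R\<in>X. ereal (q R)) \<le> enn2ereal S" .
  qed
  then have "e2ennreal \<bar>SUP R\<in>X. ereal (q R)\<bar> \<le> e2ennreal (enn2ereal S)" by (rule e2ennreal_mono)
  then show ?thesis by (simp add: S_def)
qed

lemma maxop_le_SUP_rect_avg:
  "e2ennreal \<bar>maxop \<R> f x\<bar> \<le> (SUP R\<in>{R \<in> \<R>. x \<in> rect_set R}. ennreal \<bar>rect_avg f R\<bar>)"
proof (cases "\<exists>R\<in>\<R>. x \<in> rect_set R")
  case True
  then have maxop: "maxop \<R> f x = (SUP R\<in>{R \<in> \<R>. x \<in> rect_set R}. ereal (rect_avg f R))"
    by (simp add: maxop_def rect_avg_def)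
  show ?thesis unfolding maxop by (rule e2ennreal_abs_SUP_le) (use True in blast)
qed (simp add: maxop_def e2ennreal_neg)

section \<open>The maximal operator\<close>

definition recorded_bound :: "real \<Rightarrow> nat" where
  "recorded_bound \<eta> = nat \<lceil>256 / \<eta>\<^sup>2\<rceil>"

lemma tile_const_recorded_bound_le:
  fixes \<delta> :: real
  assumes "0 < \<delta>" "\<delta> \<le> 1"
  shows "tile_const (recorded_bound (\<delta> / 4096)) \<le> 322560 * (1 + ln (1 / \<delta>))"
proof -
  let ?t = "256 / (\<delta> / 4096)\<^sup>2"
  have t_eq: "?t = 2 ^ 32 / \<delta>\<^sup>2" by (simp add: power_divide)
  have "1 \<le> 2 ^ 32 / \<delta>\<^sup>2" using assms power_le_one[of \<delta> 2] by (simp add: field_simps)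
  then have "1 \<le> ?t" unfolding t_eq .
  then have "real (nat \<lceil>?t\<rceil>) \<le> 2 * ?t" "1 \<le> real (nat \<lceil>?t\<rceil>)" using ceiling_correct[of ?t] by linarith+
  then have "ln (real (nat \<lceil>?t\<rceil>)) \<le> ln (2 * ?t)" by simp
  also have "\<dots> = ln (2 ^ 33 * (1 / \<delta>)\<^sup>2)" unfolding t_eq by (simp add: power_divide)
  also have "\<dots> = 33 * ln 2 + 2 * ln (1 / \<delta>)"
    using assms ln_realpow[of "2::real" 33] ln_realpow[of "1 / \<delta>" 2] by (subst ln_mult) simp_all
  also have "\<dots> \<le> 33 + 2 * ln (1 / \<delta>)" using ln_2_less_1 by simp
  finally have "ln (recorded_bound (\<delta> / 4096)) \<le> 33 + 2 * ln (1 / \<delta>)" by (simp add: recorded_bound_def)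
  moreover have "0 \<le> ln (1 / \<delta>)" using assms by simp
  ultimately show ?thesis by (simp add: tile_const_def)
qed

locale direction_field =
  fixes w \<delta> :: real and v v' :: "real \<Rightarrow> real" and f :: "real \<times> real \<Rightarrow> real" and F :: "real \<times> real \<Rightarrow> ennreal"
  assumes w: "0 < w" and \<delta>: "0 < \<delta>" "\<delta> \<le> 1" and v: "\<And>a. 0 \<le> v a \<and> v a \<le> 1"
    and v': "v' \<in> borel_measurable borel" "AE a in lborel. v a = v' a"
    and F: "F \<in> borel_measurable (borel \<Otimes>\<^sub>M borel)" "AE z in plane. ennreal \<bar>f z\<bar> = F z"
begin

abbreviation D :: nat where
  "D \<equiv> recorded_bound (\<delta> / 4096)"

text \<open>The density is \<open>\<delta> / 4096\<close> because the matching columns have density \<open>\<delta> / 16\<close> and a live tile needs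
  \<open>156\<close> times its own density. As \<open>K\<close> grows, the grids accommodate longer and longer rectangles.\<close>
definition scale_max :: "nat \<Rightarrow> real \<times> real \<Rightarrow> ennreal" where
  "scale_max K = grid_max (2 ^ K * w) w (\<delta> / 4096) v' F"

lemma slope_field: "slope_field (2 ^ K * w) w (\<delta> / 4096) v' D"
  using w \<delta> v' by (auto simp: slope_field_def recorded_bound_def)

lemma scale_max_measurable[measurable]: "scale_max K \<in> borel_measurable (borel \<Otimes>\<^sub>M borel)"
  unfolding scale_max_def by (rule grid_max_measurable[OF slope_field F(1)])

lemma rect_avg_le_scale_max:
  assumes R: "R \<in> R_delta v w \<delta>" and x: "x \<in> rect_set R"
  shows "\<forall>\<^sub>F K in sequentially. ennreal \<bar>rect_avg f R\<bar> \<le> 960 * scale_max K x"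
proof (cases "measure lebesgue (rect_set R) = 0")
  case False
  then obtain c \<sigma> L where L: "0 < L" and subset: "rect_set R \<subseteq> parallelogram c \<sigma> L w"
    and area: "L * w / 8 \<le> measure lebesgue (rect_set R)"
    and dense: "\<delta> * L / 16 \<le> measure lborel (matching_columns v' (fst c) \<sigma> L w)"
    by (rule R_delta_parallelogram[OF R _ w \<delta>(1) v v'])
  obtain K0 :: nat where K0: "6 * L / w < 2 ^ K0" using real_arch_pow[of 2 "6 * L / w"] by auto
  have "ennreal \<bar>rect_avg f R\<bar> \<le> 960 * scale_max K x" if K: "K0 \<le> K" for K
  proof -
    have "(2::real) ^ K0 \<le> 2 ^ K" using K by (intro power_increasing) auto
    then have "6 * L / w \<le> 2 ^ K" using K0 by linarith
    then have large_scale: "6 * L \<le> 2 ^ K * w" using w by (simp add: field_simps)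
    have "156 * (\<delta> / 4096) * L \<le> \<delta> * L / 16" using \<delta> L by simp
    also note dense
    finally have parallelogram_le: "(\<integral>\<^sup>+z\<in>parallelogram c \<sigma> L w. F z \<partial>plane)
        \<le> ennreal (120 * L * w) * scale_max K x"
      unfolding scale_max_def using x subset
      by (intro parallelogram_integral_le_grid_max[OF slope_field L large_scale _ _ F(1)]) auto
    have "ennreal \<bar>rect_avg f R\<bar> \<le> ennreal (1 / (L * w / 8)) * (\<integral>\<^sup>+z\<in>parallelogram c \<sigma> L w. F z \<partial>plane)"
      using L w by (intro rect_avg_le F subset area) auto
    also have "\<dots> \<le> ennreal (1 / (L * w / 8)) * (ennreal (120 * L * w) * scale_max K x)"
      by (intro mult_left_mono parallelogram_le) simp
    also have "\<dots> = ennreal (1 / (L * w / 8) * (120 * L * w)) * scale_max K x"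
      using L w by (subst ennreal_mult') (auto simp: mult.assoc)
    also have "1 / (L * w / 8) * (120 * L * w) = 960" using L w by (simp add: field_simps)
    finally show ?thesis by simp
  qed
  then show ?thesis unfolding eventually_sequentially by blast
qed (simp add: rect_avg_def)

lemma maxop_square_le_liminf:
  "(e2ennreal \<bar>maxop (R_delta v w \<delta>) f x\<bar>)\<^sup>2 \<le> liminf (\<lambda>K. (960 * scale_max K x)\<^sup>2)"
proof -
  have "(e2ennreal \<bar>maxop (R_delta v w \<delta>) f x\<bar>)\<^sup>2
      \<le> (SUP R\<in>{R \<in> R_delta v w \<delta>. x \<in> rect_set R}. ennreal \<bar>rect_avg f R\<bar>)\<^sup>2"
    by (intro power_mono maxop_le_SUP_rect_avg) simp
  also have "\<dots> \<le> liminf (\<lambda>K. (960 * scale_max K x)\<^sup>2)"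
    unfolding ennreal_SUP_power2
  proof (intro SUP_least Liminf_bounded)
    fix R assume "R \<in> {R \<in> R_delta v w \<delta>. x \<in> rect_set R}"
    then have "\<forall>\<^sub>F K in sequentially. ennreal \<bar>rect_avg f R\<bar> \<le> 960 * scale_max K x"
      by (intro rect_avg_le_scale_max) auto
    then show "\<forall>\<^sub>F K in sequentially. (ennreal \<bar>rect_avg f R\<bar>)\<^sup>2 \<le> (960 * scale_max K x)\<^sup>2"
      by (rule eventually_mono) (rule power_mono, simp_all)
  qed
  finally show ?thesis .
qed

lemma scale_max_ineq:
  "(\<integral>\<^sup>+z. (960 * scale_max K z)\<^sup>2 \<partial>plane) \<le> ennreal ((1920 * tile_const D)\<^sup>2) * (\<integral>\<^sup>+z. (F z)\<^sup>2 \<partial>plane)"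
proof -
  have "(\<integral>\<^sup>+z. (960 * scale_max K z)\<^sup>2 \<partial>plane) = ennreal (960\<^sup>2) * (\<integral>\<^sup>+z. (scale_max K z)\<^sup>2 \<partial>plane)"
    by (simp add: power_mult_distrib nn_integral_cmult)
  also have "\<dots> \<le> ennreal (960\<^sup>2) * (ennreal ((2 * tile_const D)\<^sup>2) * (\<integral>\<^sup>+z. (F z)\<^sup>2 \<partial>plane))"
    unfolding scale_max_def by (intro mult_left_mono grid_max_ineq[OF slope_field F(1)]) simp
  also have "\<dots> = ennreal (960\<^sup>2 * (2 * tile_const D)\<^sup>2) * (\<integral>\<^sup>+z. (F z)\<^sup>2 \<partial>plane)"
    by (subst ennreal_mult') (simp_all only: mult.assoc zero_le_power2)
  also have "960\<^sup>2 * (2 * tile_const D)\<^sup>2 = (1920 * tile_const D)\<^sup>2"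
    by (simp only: power_mult_distrib) simp
  finally show ?thesis .
qed

lemma maxop_R_delta_ineq:
  "(\<integral>\<^sup>+x. (e2ennreal \<bar>maxop (R_delta v w \<delta>) f x\<bar>)\<^sup>2 \<partial>lebesgue)
    \<le> ennreal ((1920 * tile_const D)\<^sup>2) * (\<integral>\<^sup>+x. ennreal ((f x)\<^sup>2) \<partial>lebesgue)"
proof -
  have "(\<integral>\<^sup>+x. (e2ennreal \<bar>maxop (R_delta v w \<delta>) f x\<bar>)\<^sup>2 \<partial>lebesgue)
      = (\<integral>\<^sup>+x. (e2ennreal \<bar>maxop (R_delta v w \<delta>) f x\<bar>)\<^sup>2 \<partial>plane)"
    by (simp only: nn_integral_completion lborel_prod)
  also have "\<dots> \<le> (\<integral>\<^sup>+x. liminf (\<lambda>K. (960 * scale_max K x)\<^sup>2) \<partial>plane)"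
    by (intro nn_integral_mono maxop_square_le_liminf)
  also have "\<dots> \<le> liminf (\<lambda>K. \<integral>\<^sup>+x. (960 * scale_max K x)\<^sup>2 \<partial>plane)"
    by (intro nn_integral_liminf) measurable
  also have "\<dots> \<le> limsup (\<lambda>K. \<integral>\<^sup>+x. (960 * scale_max K x)\<^sup>2 \<partial>plane)"
    by (intro Liminf_le_Limsup) simp
  also have "\<dots> \<le> ennreal ((1920 * tile_const D)\<^sup>2) * (\<integral>\<^sup>+z. (F z)\<^sup>2 \<partial>plane)"
    by (intro Limsup_bounded always_eventually allI scale_max_ineq)
  also have "(\<integral>\<^sup>+z. (F z)\<^sup>2 \<partial>plane) = (\<integral>\<^sup>+x. ennreal ((f x)\<^sup>2) \<partial>lebesgue)"
  proof -
    have "AE z in plane. (F z)\<^sup>2 = ennreal ((f z)\<^sup>2)"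
      using F(2) by eventually_elim (metis abs_ge_zero ennreal_power power2_abs)
    then show ?thesis
      unfolding nn_integral_completion lborel_prod[symmetric] by (rule nn_integral_cong_AE)
  qed
  finally show ?thesis .
qed

end

theorem maxop_R_delta_L2_bound:
  fixes v :: "real \<Rightarrow> real" and f :: "real \<times> real \<Rightarrow> real"
  assumes w: "0 < w" and \<delta>: "0 < \<delta>" "\<delta> \<le> 1"
    and v: "v \<in> borel_measurable lebesgue" "\<And>a. 0 \<le> v a \<and> v a \<le> 1" and f: "f \<in> borel_measurable lebesgue"
  shows "(\<integral>\<^sup>+x. (e2ennreal \<bar>maxop (R_delta v w \<delta>) f x\<bar>)\<^sup>2 \<partial>lebesgue)
    \<le> ennreal ((619315200 * (1 + ln (1 / \<delta>)))\<^sup>2) * (\<integral>\<^sup>+x. ennreal ((f x)\<^sup>2) \<partial>lebesgue)"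
proof -
  obtain v' where v': "v' \<in> borel_measurable borel" "AE a in lborel. v a = v' a"
    using completion_ex_borel_measurable_real[OF v(1)] by auto
  obtain f' where f': "f' \<in> borel_measurable borel" "AE z in lborel. f z = f' z"
    using completion_ex_borel_measurable_real[OF f] by auto
  have [measurable]: "f' \<in> borel_measurable (borel \<Otimes>\<^sub>M borel)" using f'(1) by (simp only: borel_prod)
  have "AE z in plane. ennreal \<bar>f z\<bar> = ennreal \<bar>f' z\<bar>"
    unfolding lborel_prod using f'(2) by auto
  then interpret direction_field w \<delta> v v' f "\<lambda>z. ennreal \<bar>f' z\<bar>"
    by unfold_locales (use w \<delta> v(2) v' in auto)
  have "0 \<le> tile_const D"
    using slope_field.D_pos[OF slope_field] by (intro less_imp_le tile_const_pos)
  then have "(1920 * tile_const D)\<^sup>2 \<le> (1920 * (322560 * (1 + ln (1 / \<delta>))))\<^sup>2"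
    using tile_const_recorded_bound_le[OF \<delta>] by (intro power_mono mult_left_mono) auto
  then have "(1920 * tile_const D)\<^sup>2 \<le> (619315200 * (1 + ln (1 / \<delta>)))\<^sup>2"
    by (simp only: mult.assoc[symmetric]) simp
  with maxop_R_delta_ineq show ?thesis
    by (rule order_trans[OF _ mult_right_mono[OF ennreal_leI]]) simp
qed

theorem theorem1p1:
  shows "\<exists>C>0. \<forall>(w::real) (\<delta>::real) (v::real \<Rightarrow> real) (f::real \<times> real \<Rightarrow> real).
     0 < w \<and> w \<le> 1 \<and> 0 < \<delta> \<and> \<delta> \<le> 1 \<and>
     v \<in> borel_measurable lebesgue \<and> (\<forall>a. 0 \<le> v a \<and> v a \<le> 1) \<and>
     f \<in> borel_measurable lebesgue \<and> integrable lebesgue (\<lambda>x. (f x)^2)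
     \<longrightarrow> (\<integral>\<^sup>+ x. (e2ennreal \<bar>maxop (R_delta v w \<delta>) f x\<bar>)^2 \<partial>lebesgue)
         \<le> ennreal ((C * (1 + ln (1 / \<delta>)) powr (3/2))^2 * (\<integral>x. (f x)^2 \<partial>lebesgue))"
proof (intro exI[of _ "619315200 :: real"] conjI allI impI; (elim conjE)?)
  fix w \<delta> :: real and v :: "real \<Rightarrow> real" and f :: "real \<times> real \<Rightarrow> real"
  assume w: "0 < w" and \<delta>: "0 < \<delta>" "\<delta> \<le> 1" and v: "v \<in> borel_measurable lebesgue" "\<forall>a. 0 \<le> v a \<and> v a \<le> 1"
    and f: "f \<in> borel_measurable lebesgue" and f_square: "integrable lebesgue (\<lambda>x. (f x)\<^sup>2)"
  let ?a = "619315200 * (1 + ln (1 / \<delta>))" and ?b = "619315200 * (1 + ln (1 / \<delta>)) powr (3/2)"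
  have "1 + ln (1 / \<delta>) \<le> (1 + ln (1 / \<delta>)) powr (3/2)"
    using \<delta> powr_mono[of 1 "3/2" "1 + ln (1 / \<delta>)"] by simp
  then have const: "?a\<^sup>2 \<le> ?b\<^sup>2" using \<delta> by (intro power_mono mult_left_mono) auto
  have "(\<integral>\<^sup>+x. (e2ennreal \<bar>maxop (R_delta v w \<delta>) f x\<bar>)\<^sup>2 \<partial>lebesgue)
      \<le> ennreal (?a\<^sup>2) * (\<integral>\<^sup>+x. ennreal ((f x)\<^sup>2) \<partial>lebesgue)"
    using v by (intro maxop_R_delta_L2_bound w \<delta> f) auto
  also have "\<dots> = ennreal (?a\<^sup>2) * ennreal (\<integral>x. (f x)\<^sup>2 \<partial>lebesgue)"
    by (simp add: nn_integral_eq_integral[OF f_square])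
  also have "\<dots> \<le> ennreal (?b\<^sup>2) * ennreal (\<integral>x. (f x)\<^sup>2 \<partial>lebesgue)"
    by (intro mult_right_mono ennreal_leI const) simp
  also have "\<dots> = ennreal (?b\<^sup>2 * (\<integral>x. (f x)\<^sup>2 \<partial>lebesgue))"
    by (rule ennreal_mult'[symmetric]) simp
  finally show "(\<integral>\<^sup>+x. (e2ennreal \<bar>maxop (R_delta v w \<delta>) f x\<bar>)\<^sup>2 \<partial>lebesgue)
      \<le> ennreal (?b\<^sup>2 * (\<integral>x. (f x)\<^sup>2 \<partial>lebesgue))" .
qed simp

end
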